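(* Let $\lambda=(p,q,r;a,b;x)$ satisfy $p,q,r,a,b\in\mathbb{R}$, $0<q\le p$, $p+q\le r$, $0<x<1$, and suppose that $\lambda$ is a non-elementary solution of type (A) to the closed-form problem (so $p,q,r$ are integers). Then: (1) The number $x$ is a root of $Y(z)$ in the interval $0<z<1$. In particular $x$ is an algebraic number of degree at most $r-1$ if $p\neq q$ and at most $r-p-1$ if $p=q$. (2) The integer $r-p-q$ is positive and even. (3) $P(w)$ is exactly of degree $r$, and $R(w)=f(w+1)/f(w)$ is given by $$R(w)=(1-x)^{r-p-q-1}\cdot\frac{(rw)_r}{P(w)}.$$ Moreover, in $\mathbb{C}[w]$, $$P(w)\ \big|\ (pw+a+1)_{p-1}\,(qw+b+1)_{q-1}\,((r-p)w-a)_{r-p}\,((r-q)w-b)_{r-q}.$$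
   Context: Put $f(w)={}_2F_1(pw+a,\,qw+b;\,rw;\,x)$ (Gauss hypergeometric series), meromorphic in $w\in\mathbb{C}$. $\lambda$ is a solution to the closed-form problem if $R(w):=f(w+1)/f(w)\in\mathbb{C}(w)$; it is elementary if $f$ has at most finitely many poles in $\mathbb{C}$, and non-elementary otherwise. A canonical form of $R(w)$ is a representation $R(w)=\frac{S(w+1)}{S(w)}\cdot d\cdot\frac{(w+u_1)\cdots(w+u_m)}{(w+v_1)\cdots(w+v_n)}$ with $S(w)$ a rational function, $d\neq0$, $u_i-v_j\notin\mathbb{Z}$ for all $i,j$, and $S$, $d$, $\prod_i(w+u_i)$, $\prod_j(w+v_j)$ real when $R$ is real. A non-elementary solution is of type (A) if $r$ is a positive integer, $p,q\in\mathbb{Z}$, $p+q+r$ is even, and $pu_i-a,\ qu_i-b\in\mathbb{R}\setminus\mathbb{Z}$ for $i=1,\dots,m$. Let $\varDelta=\varDelta(z):=(p-q)^2z^2-2\{(p+q)r-2pq\}z+r^2$, which is positive for $0\le z<1$ (take $\sqrt{\varDelta}>0$ there), and $$Z_\pm(z):=\{r+(p-q)z\pm\sqrt{\varDelta}\}^p\{r-(p-q)z\pm\sqrt{\varDelta}\}^q\{(2r-p-q)z-r\mp\sqrt{\varDelta}\}^{r-p-q}.$$ There are polynomials $X(z),Y(z)$ with integer coefficients such that $Z_\pm(z)=X(z)\pm Y(z)\sqrt{\varDelta}$; this defines $Y(z)$ (a nonzero polynomial). For a power series $\varphi(z)=\sum_{j\ge0}c_jz^j$ let $\langle\varphi(z)\rangle_k:=\sum_{j=0}^kc_jz^j$.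 Write ${}_2F_1(\boldsymbol{a};z)={}_2F_1(a_1,a_2;a_3;z)$ for $\boldsymbol{a}=(a_1,a_2;a_3)$. With $\boldsymbol{\alpha}^*(w):=((r-p)w-a,\,(r-q)w-b;\,rw)$, $\boldsymbol{1}:=(1,1;1)$ and $(t)_k=t(t+1)\cdots(t+k-1)$, $$P(w):=(rw)_r\,\big\langle{}_2F_1(\boldsymbol{\alpha}^*(w);z)\cdot{}_2F_1(\boldsymbol{1}-\boldsymbol{\alpha}^*(w+1);z)\big\rangle_{r-q-1}\Big|_{z=x},$$ which is a polynomial in $w$. *)

theory Defs
  imports
    "HOL-Complex_Analysis.Complex_Analysis"
    "HOL-Computational_Algebra.Computational_Algebra"
begin

text \<open>
  Meromorphic and rational functions on the complex plane are represented by functions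
  of type \<^typ>\<open>complex \<Rightarrow> complex\<close>, whose values on a discrete set are irrelevant.  Accordingly,
  equality of two such functions is stated as equality outside a sparse set (quantifier
  \<open>\<forall>\<^sub>\<approx>\<close>).
\<close>

section \<open>The closed-form problem\<close>

definition hyp2F1_fps :: "complex \<Rightarrow> complex \<Rightarrow> complex \<Rightarrow> complex fps" where
  "hyp2F1_fps a1 a2 a3 = fps_hypergeo [a1, a2] [a3] 1"

text \<open>Only meaningful for \<open>norm z < 1\<close> and \<open>a3\<close> not a nonpositive integer.\<close>

definition hyp2F1 :: "complex \<Rightarrow> complex \<Rightarrow> complex \<Rightarrow> complex \<Rightarrow> complex" where
  "hyp2F1 a1 a2 a3 z = eval_fps (hyp2F1_fps a1 a2 a3) z"

text \<open>
  At the discrete set where \<open>r * w\<close> is a nonpositive integer the value is arbitrary.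
  The predicate \<^const>\<open>is_pole\<close> does not depend on these values.
\<close>

definition hyp_f ::
  "complex \<Rightarrow> complex \<Rightarrow> complex \<Rightarrow> complex \<Rightarrow> complex \<Rightarrow> complex \<Rightarrow> complex \<Rightarrow> complex" where
  "hyp_f p q r a b x w = hyp2F1 (p * w + a) (q * w + b) (r * w) x"

definition hyp_R ::
  "complex \<Rightarrow> complex \<Rightarrow> complex \<Rightarrow> complex \<Rightarrow> complex \<Rightarrow> complex \<Rightarrow> complex \<Rightarrow> complex" where
  "hyp_R p q r a b x w = hyp_f p q r a b x (w + 1) / hyp_f p q r a b x w"

text \<open>
  Rational functions with coefficients in \<open>K\<close>: \<open>K = UNIV\<close> gives \<open>\<complex>(w)\<close>, and
  \<open>K = \<real>\<close> gives the real rational functions.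
\<close>

definition rational_fun_over :: "complex set \<Rightarrow> (complex \<Rightarrow> complex) \<Rightarrow> bool" where
  "rational_fun_over K g \<longleftrightarrow>
     (\<exists>n d. d \<noteq> 0 \<and> (\<forall>i. coeff n i \<in> K) \<and> (\<forall>i. coeff d i \<in> K) \<and>
            (\<forall>\<^sub>\<approx>w\<in>UNIV. g w = poly n w / poly d w))"

definition closed_form_solution ::
  "complex \<Rightarrow> complex \<Rightarrow> complex \<Rightarrow> complex \<Rightarrow> complex \<Rightarrow> complex \<Rightarrow> bool" where
  "closed_form_solution p q r a b x \<longleftrightarrow> rational_fun_over UNIV (hyp_R p q r a b x)"

definition elementary ::
  "complex \<Rightarrow> complex \<Rightarrow> complex \<Rightarrow> complex \<Rightarrow> complex \<Rightarrow> complex \<Rightarrow> bool" where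
  "elementary p q r a b x \<longleftrightarrow> finite {w. is_pole (hyp_f p q r a b x) w}"

text \<open>The lists \<open>us\<close> and \<open>vs\<close> hold \<open>u\<^sub>1,\<dots>,u\<^sub>m\<close> and \<open>v\<^sub>1,\<dots>,v\<^sub>n\<close> (with multiplicity).\<close>

definition canonical_form ::
  "(complex \<Rightarrow> complex) \<Rightarrow> (complex \<Rightarrow> complex) \<Rightarrow> complex \<Rightarrow> complex list \<Rightarrow> complex list \<Rightarrow> bool" where
  "canonical_form R S d us vs \<longleftrightarrow>
     rational_fun_over UNIV S \<and> \<not> (\<forall>\<^sub>\<approx>w\<in>UNIV. S w = 0) \<and> d \<noteq> 0 \<and>
     (\<forall>u\<in>set us. \<forall>v\<in>set vs. u - v \<notin> \<int>) \<and>
     (\<forall>\<^sub>\<approx>w\<in>UNIV. R w = S (w + 1) / S w * d * ((\<Prod>u\<leftarrow>us. w + u) / (\<Prod>v\<leftarrow>vs. w + v))) \<and>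
     (rational_fun_over \<real> R \<longrightarrow>
        rational_fun_over \<real> S \<and> d \<in> \<real> \<and>
        (\<forall>i. coeff (\<Prod>u\<leftarrow>us. [:u, 1:]) i \<in> \<real>) \<and>
        (\<forall>i. coeff (\<Prod>v\<leftarrow>vs. [:v, 1:]) i \<in> \<real>))"

text \<open>
  The canonical form is not unique, but the \<open>u\<^sub>i\<close> are unique modulo integers up to
  permutation, and \<open>p\<close>, \<open>q\<close> are integers here; so the condition does not depend on
  which canonical form is chosen.
\<close>

definition type_A ::
  "complex \<Rightarrow> complex \<Rightarrow> complex \<Rightarrow> complex \<Rightarrow> complex \<Rightarrow> complex \<Rightarrow> bool" where
  "type_A p q r a b x \<longleftrightarrow>
     (\<exists>p' q' r' :: int. p = of_int p' \<and> q = of_int q' \<and> r = of_int r' \<and>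
                        r' > 0 \<and> even (p' + q' + r')) \<and>
     (\<exists>S d us vs. canonical_form (hyp_R p q r a b x) S d us vs \<and>
        (\<forall>u\<in>set us. p * u - a \<in> \<real> - \<int> \<and> q * u - b \<in> \<real> - \<int>))"


section \<open>The polynomials \<open>Y(z)\<close> and \<open>P(w)\<close>\<close>

definition hyp_Delta :: "nat \<Rightarrow> nat \<Rightarrow> nat \<Rightarrow> real \<Rightarrow> real" where
  "hyp_Delta p q r z =
     (real p - real q)^2 * z^2 - 2 * ((real p + real q) * real r - 2 * real p * real q) * z
       + (real r)^2"

text \<open>\<open>Z\<^sub>+\<close> is the case \<open>s = 1\<close> and \<open>Z\<^sub>-\<close> the case \<open>s = -1\<close>.  Assumes \<open>p + q \<le> r\<close>.\<close>

definition hyp_Z :: "real \<Rightarrow> nat \<Rightarrow> nat \<Rightarrow> nat \<Rightarrow> real \<Rightarrow> real" where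
  "hyp_Z s p q r z =
     (real r + (real p - real q) * z + s * sqrt (hyp_Delta p q r z)) ^ p *
     (real r - (real p - real q) * z + s * sqrt (hyp_Delta p q r z)) ^ q *
     ((2 * real r - real p - real q) * z - real r - s * sqrt (hyp_Delta p q r z)) ^ (r - p - q)"

text \<open>
  Since \<open>\<Delta> > 0\<close> on \<open>[0,1)\<close>, the two identities determine the polynomials \<open>X\<close> and \<open>Y\<close>.
\<close>

definition is_XY :: "nat \<Rightarrow> nat \<Rightarrow> nat \<Rightarrow> int poly \<Rightarrow> int poly \<Rightarrow> bool" where
  "is_XY p q r X Y \<longleftrightarrow>
     (\<forall>z\<in>{0..<1::real}. \<forall>s\<in>{1, -1}.
        hyp_Z s p q r z =
          poly (map_poly of_int X) z + s * poly (map_poly of_int Y) z * sqrt (hyp_Delta p q r z))"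

text \<open>The degree of the minimal polynomial over the rationals (for algebraic \<open>x\<close>).\<close>

definition algebraic_degree :: "real \<Rightarrow> nat" where
  "algebraic_degree x =
     (LEAST n. \<exists>g :: real poly. g \<noteq> 0 \<and> (\<forall>i. coeff g i \<in> \<rat>) \<and> poly g x = 0 \<and> degree g = n)"

text \<open>
  The truncation \<open>\<langle>\<phi>(z)\<rangle>\<^sub>k\<close> keeps the terms of degree at most \<open>k\<close>.
\<close>

definition fps_trunc :: "nat \<Rightarrow> complex fps \<Rightarrow> complex poly" where
  "fps_trunc k \<phi> = truncate_fps (Suc k) \<phi>"

text \<open>
  The right-hand side of the definition of \<open>P(w)\<close>.  It is literally meaningful where
  \<open>(rw)\<^sub>r \<noteq> 0\<close>: the denominators occurring in the truncation are \<open>(rw)\<^sub>j\<close> and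
  \<open>(1 - r(w+1))\<^sub>j\<close> with \<open>j < r\<close>, whose factors all divide \<open>(rw)\<^sub>r\<close>.
\<close>

definition hyp_P_val ::
  "nat \<Rightarrow> nat \<Rightarrow> nat \<Rightarrow> complex \<Rightarrow> complex \<Rightarrow> complex \<Rightarrow> complex \<Rightarrow> complex" where
  "hyp_P_val p q r a b x w =
     (let p' = of_nat p; q' = of_nat q; r' = of_nat r;
          \<alpha>1 = (\<lambda>w. (r' - p') * w - a);
          \<alpha>2 = (\<lambda>w. (r' - q') * w - b);
          \<alpha>3 = (\<lambda>w. r' * w)
      in pochhammer (r' * w) r *
         poly (fps_trunc (r - q - 1)
                 (hyp2F1_fps (\<alpha>1 w) (\<alpha>2 w) (\<alpha>3 w) *
                  hyp2F1_fps (1 - \<alpha>1 (w + 1)) (1 - \<alpha>2 (w + 1)) (1 - \<alpha>3 (w + 1)))) x)"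

end

theory Submission
  imports Defs "HOL-Real_Asymp.Real_Asymp"
begin

text \<open>
  Let \<open>w\<^sub>j = - j / r\<close>, the only possible poles of \<open>f\<close>.  The function \<open>H(w) = f(w) / \<Gamma>(r w)\<close> is
  entire, and its value at \<open>w\<^sub>j\<close> (the residue of \<open>f\<close>) is an explicit factor times a hypergeometric
  series with positive parameters.  So the rational function \<open>R\<close> can be evaluated near both ends of
  the real axis: as \<open>w \<rightarrow> + \<infinity>\<close> from \<open>f\<close> itself, and along the infinitely many \<open>w\<^sub>j\<close> that are poles
  of the non-elementary \<open>f\<close>.  In both cases the series has positive parameters of size about \<open>\<bar>w\<bar>\<close> and
  concentrates on the terms with index about \<open>\<rho> \<bar>w\<bar>\<close>, where \<open>\<rho>\<close> solves a quadratic equation of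
  discriminant \<open>\<Delta>(x)\<close>; the two ends see the two roots.  The limits of a rational function at the two
  ends agree, which says \<open>Z\<^sub>+(x) = Z\<^sub>-(x)\<close>, that is, \<open>Y(x) = 0\<close>; it also excludes \<open>p + q = r\<close>.

  By Euler's transformation \<open>f\<close> may be replaced by \<open>F(\<alpha>\<^sup>*(w))\<close>.  Ebisu's contiguity relation
  \<open>F(\<alpha>\<^sup>*(w)) = A(w) F(\<alpha>\<^sup>*(w+1)) + B(w) G(w+1)\<close>, with \<open>G(w)\<close> obtained from \<open>F(\<alpha>\<^sup>*(w))\<close> by raising the lower
  parameter by one, has coefficients given by truncated products of series; \<open>A\<close> is
  \<open>(1 - x) P(w) / (r w)\<^sub>r\<close>.  If \<open>B\<close> did not vanish identically, then \<open>r w F(\<alpha>\<^sup>*(w)) / G(w)\<close> would be a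
  rational function asymptotic to a positive multiple of \<open>w\<close> at \<open>+ \<infinity>\<close>, but it is positive at the poles
  \<open>w\<^sub>j\<close>, which tend to \<open>- \<infinity>\<close>.  Hence \<open>B = 0\<close>, which gives the formula for \<open>R\<close>.  The determinant of the
  contiguity matrix, a product of Pochhammer symbols, is then \<open>A\<close> times another polynomial up to known
  factors, and this is the divisibility.
\<close>

text \<open>\<open>R\<close> is rational, but accessible only through series. In terms of
  \<open>H\<close> its equation is an identity of entire functions, so it can be read at the poles
  of \<open>f\<close>: there the series of \<open>H\<close> starts at index \<open>j + 1\<close>,
  and after reindexing the upper parameters, about \<open>(r - p) j / r\<close> and
  \<open>(r - q) j / r\<close>, are positive. Since only ratios of series with parameters differing
  by integers occur, their limits follow from concentration alone: such a shift by one weights the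
  terms by a factor \<open>u / (u + n)\<close>, or is the inverse of such a step.

  The passage to \<open>\<alpha>\<^sup>*\<close> is forced by the contiguity argument. Its
  increments \<open>s = r - p\<close> and \<open>t = r - q\<close> satisfy \<open>s + t > r\<close>
  once \<open>p + q = r\<close> is excluded. Then the coefficients of index \<open>t\<close> to
  \<open>r\<close> in the products of series are finite differences of polynomials of too small
  degree, hence zero, which explains the truncation at \<open>r - q - 1\<close>. A relation valid up
  to order \<open>r\<close> at both exponents is exact, by counting zeros.

  Identities whose parameters depend on \<open>w\<close> are proved off the real axis, where no
  parameter is an integer, and extended by continuity.\<close>

section \<open>Coefficient recurrences and a Legendre-type relation for the formal series\<close>

lemma hyp2F1_fps_nth:
  "hyp2F1_fps a b c $ n = pochhammer a n * pochhammer b n / (pochhammer c n * fact n)"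
  by (simp add: hyp2F1_fps_def)

lemma pochhammer_ne_0:
  fixes c :: complex
  assumes "c \<notin> \<int>"
  shows "pochhammer c n \<noteq> 0"
proof
  assume "pochhammer c n = 0"
  then obtain k where "c = - of_nat k" by (auto simp: pochhammer_eq_0_iff)
  then show False using assms by auto
qed

lemma not_Ints_add_of_nat: "(c :: complex) \<notin> \<int> \<Longrightarrow> c + of_nat n \<notin> \<int>"
  by (metis Ints_diff Ints_of_nat add_diff_cancel_right')

lemma not_Ints_add_ne_0: "(c :: complex) \<notin> \<int> \<Longrightarrow> c + of_nat n \<noteq> 0"
  using not_Ints_add_of_nat Ints_0 by metis

lemma hyp2F1_fps_rec:
  assumes "c \<notin> \<int>"
  shows "of_nat (Suc n) * (c + of_nat n) * hyp2F1_fps a b c $ Suc n =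
         (a + of_nat n) * (b + of_nat n) * hyp2F1_fps a b c $ n"
  using pochhammer_ne_0[OF assms, of n] not_Ints_add_ne_0[OF assms, of n]
  by (simp add: hyp2F1_fps_nth pochhammer_Suc divide_simps del: of_nat_Suc)

lemma hyp2F1_fps_nth_plus1:
  assumes "c \<notin> \<int>"
  shows "(c + of_nat n) * hyp2F1_fps a b (c + 1) $ n = c * hyp2F1_fps a b c $ n"
proof -
  have "c \<noteq> 0" using assms by auto
  have "pochhammer c (Suc n) = c * pochhammer (c + 1) n"
    by (rule pochhammer_rec)
  moreover have "pochhammer c (Suc n) = (c + of_nat n) * pochhammer c n"
    by (simp add: pochhammer_Suc mult.commute)
  ultimately have *: "c * pochhammer (c + 1) n = (c + of_nat n) * pochhammer c n" by simp
  have ne: "pochhammer (c + 1) n \<noteq> 0"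
    using pochhammer_ne_0[OF not_Ints_add_of_nat[OF assms, of 1]] by simp
  have "(c + of_nat n) * hyp2F1_fps a b (c + 1) $ n =
     pochhammer a n * pochhammer b n * ((c + of_nat n) * pochhammer c n) /
       (pochhammer (c + 1) n * pochhammer c n * fact n)"
    using pochhammer_ne_0[OF assms, of n] by (simp add: hyp2F1_fps_nth)
  also have "\<dots> = c * hyp2F1_fps a b c $ n"
    using pochhammer_ne_0[OF assms, of n] ne unfolding *[symmetric] by (simp add: hyp2F1_fps_nth)
  finally show ?thesis .
qed

text \<open>Together with the next lemma this is the first-order linear system satisfied by the pair
  of series with lower parameters \<open>c\<close> and \<open>c + 1\<close>; the Legendre-type
  relation is derived from that system.\<close>

lemma fps_X_deriv_hyp2F1_fps:
  assumes "c \<notin> \<int>"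
  shows "fps_X * fps_deriv (hyp2F1_fps a b (c + 1)) =
         fps_const c * (hyp2F1_fps a b c - hyp2F1_fps a b (c + 1))"
proof (rule fps_ext)
  fix n
  show "(fps_X * fps_deriv (hyp2F1_fps a b (c + 1))) $ n =
        (fps_const c * (hyp2F1_fps a b c - hyp2F1_fps a b (c + 1))) $ n"
    using hyp2F1_fps_nth_plus1[OF assms, of n a b]
  proof (cases n)
    case 0
    then show ?thesis by (simp add: hyp2F1_fps_nth)
  next
    case (Suc m)
    then show ?thesis
      using hyp2F1_fps_nth_plus1[OF assms, of n a b] by (simp add: algebra_simps)
  qed
qed

lemma one_minus_X_deriv_hyp2F1_fps:
  assumes "c \<notin> \<int>"
  shows "(1 - fps_X) * fps_deriv (hyp2F1_fps a b c) =
         fps_const (a + b - c) * hyp2F1_fps a b c +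
         fps_const ((c - a) * (c - b) / c) * hyp2F1_fps a b (c + 1)"
proof (rule fps_ext)
  fix n
  define F where "F = hyp2F1_fps a b c"
  define G where "G = hyp2F1_fps a b (c + 1)"
  have c0: "c \<noteq> 0" and cn: "c + of_nat n \<noteq> 0"
    using not_Ints_add_ne_0[OF assms, of n] assms by auto
  have G: "G $ n = c * F $ n / (c + of_nat n)"
    using hyp2F1_fps_nth_plus1[OF assms, of n a b] cn by (simp add: F_def G_def field_simps)
  have S: "of_nat (Suc n) * F $ Suc n = (a + of_nat n) * (b + of_nat n) * F $ n / (c + of_nat n)"
    using hyp2F1_fps_rec[OF assms, of n a b] cn by (simp add: F_def field_simps)
  have "((1 - fps_X) * fps_deriv F) $ n = of_nat (Suc n) * F $ Suc n - of_nat n * F $ n"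
    by (cases n) (simp_all add: algebra_simps)
  also have "\<dots> = (a + b - c) * F $ n + (c - a) * (c - b) / c * G $ n"
    unfolding S G using c0 cn by (simp add: divide_simps) (simp add: algebra_simps)
  finally show "((1 - fps_X) * fps_deriv (hyp2F1_fps a b c)) $ n =
     (fps_const (a + b - c) * hyp2F1_fps a b c +
         fps_const ((c - a) * (c - b) / c) * hyp2F1_fps a b (c + 1)) $ n"
    by (simp add: F_def G_def)
qed

text \<open>A Legendre-type relation: the derivative of the left-hand side vanishes.\<close>

lemma hyp2F1_fps_wronskian:
  assumes "c \<notin> \<int>"
  shows "(1 - fps_X) * hyp2F1_fps a b c * hyp2F1_fps (1 - a) (1 - b) (1 - c) +
         fps_const ((c - a) * (c - b) / (c * (c - 1))) * fps_X *
           hyp2F1_fps a b (c + 1) * hyp2F1_fps (1 - a) (1 - b) (2 - c) = 1"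
proof -
  define F where "F = hyp2F1_fps a b c"
  define G where "G = hyp2F1_fps a b (c + 1)"
  define F1 where "F1 = hyp2F1_fps (1 - a) (1 - b) (1 - c)"
  define F2 where "F2 = hyp2F1_fps (1 - a) (1 - b) (2 - c)"
  define k where "k = (c - a) * (c - b) / c"
  define l where "l = (c - a) * (c - b) / (c * (c - 1))"
  define I where "I = (1 - fps_X) * F * F1 + fps_const l * fps_X * G * F2"
  \<comment> \<open>The pair \<open>F1\<close>, \<open>F2\<close> has lower parameters
    \<open>1 - c\<close> and \<open>(1 - c) + 1\<close>, so the same first-order system applies to
    it.\<close>
  have c': "1 - c \<notin> \<int>"
  proof
    assume "1 - c \<in> \<int>"
    then have "1 - (1 - c) \<in> \<int>" by (intro Ints_diff) auto
    with assms show False by simp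
  qed
  have c0: "c \<noteq> 0" "c - 1 \<noteq> 0" using assms by (auto simp: eq_iff_diff_eq_0[symmetric])
  have dG: "fps_X * fps_deriv G = fps_const c * (F - G)"
    unfolding F_def G_def by (rule fps_X_deriv_hyp2F1_fps[OF assms])
  have dF: "(1 - fps_X) * fps_deriv F = fps_const (a + b - c) * F + fps_const k * G"
    unfolding F_def G_def k_def by (rule one_minus_X_deriv_hyp2F1_fps[OF assms])
  have dF2: "fps_X * fps_deriv F2 = fps_const (1 - c) * (F1 - F2)"
    using fps_X_deriv_hyp2F1_fps[OF c', of "1 - a" "1 - b"] by (simp add: F1_def F2_def)
  have dF1: "(1 - fps_X) * fps_deriv F1 = fps_const (1 - a - b + c) * F1 - fps_const (c * l) * F2"
  proof -
    have *: "(1 - c - (1 - a)) * (1 - c - (1 - b)) / (1 - c) = - (c * l)"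
      unfolding l_def using c0 by (simp add: divide_simps) (simp add: algebra_simps)
    show ?thesis
      using one_minus_X_deriv_hyp2F1_fps[OF c', of "1 - a" "1 - b"]
      unfolding * by (simp add: F1_def F2_def algebra_simps flip: fps_const_neg)
  qed
  have kl: "k = (c - 1) * l" using c0 by (simp add: k_def l_def)
  have "fps_deriv I = - F * F1 + ((1 - fps_X) * fps_deriv F) * F1 + F * ((1 - fps_X) * fps_deriv F1)
          + fps_const l * (G * F2 + (fps_X * fps_deriv G) * F2 + G * (fps_X * fps_deriv F2))"
    unfolding I_def by (simp add: algebra_simps)
  also have "\<dots> = 0"
    unfolding dG dF dF1 dF2 kl
    by (simp add: algebra_simps flip: fps_const_mult fps_const_add fps_const_sub)
  finally have "fps_deriv I = 0" .
  then have "I = fps_const (I $ 0)" by (simp add: fps_deriv_eq_0_iff)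
  also have "I $ 0 = 1" by (simp add: I_def F_def F1_def hyp2F1_fps_nth)
  finally show ?thesis by (simp add: I_def F_def G_def F1_def F2_def l_def)
qed

section \<open>Euler's transformation\<close>

text \<open>The binomial series of \<open>1 - X\<close> to a complex exponent.\<close>

definition one_minus_X_powr :: "complex \<Rightarrow> complex fps" where
  "one_minus_X_powr e = Abs_fps (\<lambda>n. pochhammer (- e) n / fact n)"

lemma one_minus_X_powr_0 [simp]: "one_minus_X_powr e $ 0 = 1"
  by (simp add: one_minus_X_powr_def)

lemma fps_deriv_one_minus_X_powr:
  "(1 - fps_X) * fps_deriv (one_minus_X_powr e) = - (fps_const e * one_minus_X_powr e)"
proof (rule fps_ext)
  fix n
  have S: "of_nat (Suc n) * one_minus_X_powr e $ Suc n = (of_nat n - e) * one_minus_X_powr e $ n"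
    by (simp add: one_minus_X_powr_def pochhammer_Suc field_simps del: of_nat_Suc)
  have "((1 - fps_X) * fps_deriv (one_minus_X_powr e)) $ n
      = of_nat (Suc n) * one_minus_X_powr e $ Suc n - of_nat n * one_minus_X_powr e $ n"
    by (cases n) (simp_all add: algebra_simps)
  then show "((1 - fps_X) * fps_deriv (one_minus_X_powr e)) $ n = (- (fps_const e * one_minus_X_powr e)) $ n"
    unfolding S by (simp add: algebra_simps)
qed

lemma one_minus_X_powr_plus1: "one_minus_X_powr (e + 1) = (1 - fps_X) * one_minus_X_powr e"
proof (rule fps_ext)
  fix n
  show "one_minus_X_powr (e + 1) $ n = ((1 - fps_X) * one_minus_X_powr e) $ n"
  proof (cases n)
    case (Suc m)
    have 1: "pochhammer (- (e + 1)) (Suc m) = (- e - 1) * pochhammer (- e) m"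
      using pochhammer_rec[of "- (e + 1)" m] by simp
    have 2: "pochhammer (- e) (Suc m) = (- e + of_nat m) * pochhammer (- e) m"
      by (simp add: pochhammer_Suc)
    have "((1 - fps_X) * one_minus_X_powr e) $ n = one_minus_X_powr e $ Suc m - one_minus_X_powr e $ m"
      by (simp add: Suc algebra_simps)
    also have "\<dots> = one_minus_X_powr (e + 1) $ n"
      unfolding Suc one_minus_X_powr_def fps_nth_Abs_fps 1 2 fact_Suc of_nat_mult
      by (simp add: divide_simps del: of_nat_Suc) (simp add: algebra_simps)
    finally show ?thesis by simp
  qed (simp add: one_minus_X_powr_def)
qed

lemma one_minus_X_powr_plus: "one_minus_X_powr (e + of_nat n) = (1 - fps_X) ^ n * one_minus_X_powr e"
proof (induction n)
  case (Suc n)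
  have "one_minus_X_powr (e + of_nat (Suc n)) = one_minus_X_powr ((e + of_nat n) + 1)"
    by (simp add: add_ac)
  then show ?case using Suc one_minus_X_powr_plus1[of "e + of_nat n"] by (simp add: mult_ac)
qed simp

text \<open>Comparing coefficients in the hypergeometric differential equation leaves a two-term
  recurrence, so existence and uniqueness of solutions become statements about coefficients.\<close>

lemma hyp2F1_ode_iff:
  fixes y :: "complex fps"
  shows
  "fps_X * (1 - fps_X) * fps_deriv (fps_deriv y) +
     (fps_const c - fps_const (a + b + 1) * fps_X) * fps_deriv y - fps_const (a * b) * y = 0 \<longleftrightarrow>
   (\<forall>n. of_nat (Suc n) * (c + of_nat n) * y $ Suc n = (a + of_nat n) * (b + of_nat n) * y $ n)"
  (is "?L = 0 \<longleftrightarrow> ?R")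
proof -
  have "?L $ n = of_nat (Suc n) * (c + of_nat n) * y $ Suc n - (a + of_nat n) * (b + of_nat n) * y $ n" for n
  proof (cases n)
    case (Suc m)
    have "(fps_X * (1 - fps_X) * fps_deriv (fps_deriv y)) $ Suc m =
       (fps_deriv (fps_deriv y) - fps_X * fps_deriv (fps_deriv y)) $ m"
      by (simp add: algebra_simps)
    also have "\<dots> = of_nat (Suc m) * of_nat (Suc (Suc m)) * y $ Suc (Suc m) - of_nat m * of_nat (Suc m) * y $ Suc m"
      by (cases m) (simp_all add: algebra_simps)
    finally show ?thesis by (simp add: Suc algebra_simps)
  qed (simp add: algebra_simps)
  then show ?thesis by (auto simp: fps_eq_iff)
qed

lemma hyp2F1_fps_unique:
  fixes y :: "complex fps"
  assumes "c \<notin> \<int>" "y $ 0 = 1"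
    and "fps_X * (1 - fps_X) * fps_deriv (fps_deriv y) +
     (fps_const c - fps_const (a + b + 1) * fps_X) * fps_deriv y - fps_const (a * b) * y = 0"
  shows "y = hyp2F1_fps a b c"
proof (rule fps_ext)
  fix n show "y $ n = hyp2F1_fps a b c $ n"
  proof (induction n)
    case (Suc n)
    have "of_nat (Suc n) * (c + of_nat n) * y $ Suc n =
          of_nat (Suc n) * (c + of_nat n) * hyp2F1_fps a b c $ Suc n"
      using assms(3) hyp2F1_fps_rec[OF assms(1), of n a b] Suc
      unfolding hyp2F1_ode_iff by simp
    moreover have "of_nat (Suc n) * (c + of_nat n) \<noteq> 0"
      using not_Ints_add_ne_0[OF assms(1), of n] by (simp del: of_nat_Suc)
    ultimately show ?case by simp
  qed (use assms in \<open>simp add: hyp2F1_fps_nth\<close>)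
qed

text \<open>The right-hand side has constant term 1 and solves the hypergeometric equation of the
  left-hand side, and such a solution is unique. The equation is checked after multiplication by
  \<open>D = 1 - X\<close>, which lets every derivative of \<open>B\<close> be replaced by a
  multiple of \<open>B\<close>; \<open>D\<close> is nonzero and can be cancelled afterwards.\<close>

theorem hyp2F1_fps_euler:
  assumes "c \<notin> \<int>"
  shows "hyp2F1_fps a b c = one_minus_X_powr (c - a - b) * hyp2F1_fps (c - a) (c - b) c"
proof -
  define h where "h = hyp2F1_fps (c - a) (c - b) c"
  define e where "e = c - a - b"
  define B where "B = one_minus_X_powr e"
  define y where "y = B * h"
  define D where "D = 1 - (fps_X :: complex fps)"
  have h: "fps_X * D * fps_deriv (fps_deriv h) +
     (fps_const c - fps_const ((c - a) + (c - b) + 1) * fps_X) * fps_deriv h - fps_const ((c - a) * (c - b)) * h = 0"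
    unfolding hyp2F1_ode_iff D_def h_def using hyp2F1_fps_rec[OF assms] by blast
  have dB: "D * fps_deriv B = - (fps_const e * B)"
    unfolding B_def D_def by (rule fps_deriv_one_minus_X_powr)
  have dD: "fps_deriv D = - 1" by (simp add: D_def)
  have ddB: "D * (D * fps_deriv (fps_deriv B)) = fps_const (e * (e - 1)) * B"
  proof -
    have "fps_deriv (D * fps_deriv B) = - (fps_const e * fps_deriv B)"
      unfolding dB by simp
    then have "D * fps_deriv (fps_deriv B) = fps_const (1 - e) * fps_deriv B"
      by (simp add: dD algebra_simps flip: fps_const_sub)
    then have "D * (D * fps_deriv (fps_deriv B)) = fps_const (1 - e) * (D * fps_deriv B)"
      by (simp add: mult.left_commute)
    then show ?thesis
      unfolding dB by (simp add: algebra_simps flip: fps_const_mult fps_const_sub)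
  qed
  let ?L = "fps_X * D * fps_deriv (fps_deriv y) +
     (fps_const c - fps_const (a + b + 1) * fps_X) * fps_deriv y - fps_const (a * b) * y"
  have y1: "D * fps_deriv y = B * (D * fps_deriv h - fps_const e * h)"
  proof -
    have "D * fps_deriv y = (D * fps_deriv B) * h + B * (D * fps_deriv h)"
      by (simp add: y_def algebra_simps)
    then show ?thesis unfolding dB by (simp add: algebra_simps)
  qed
  have y2: "D * (D * fps_deriv (fps_deriv y)) =
     B * (fps_const (e * (e - 1)) * h - 2 * fps_const e * D * fps_deriv h + D * D * fps_deriv (fps_deriv h))"
  proof -
    have "D * (D * fps_deriv (fps_deriv y)) =
       (D * (D * fps_deriv (fps_deriv B))) * h + 2 * (D * fps_deriv B) * D * fps_deriv h + B * D * D * fps_deriv (fps_deriv h)"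
      by (simp add: y_def algebra_simps)
    then show ?thesis unfolding dB ddB by (simp add: algebra_simps)
  qed
  have "D * ?L = fps_X * (D * (D * fps_deriv (fps_deriv y))) +
     (fps_const c - fps_const (a + b + 1) * fps_X) * (D * fps_deriv y) - fps_const (a * b) * D * y"
    by (simp add: algebra_simps)
  also have "\<dots> = B * D * (fps_X * D * fps_deriv (fps_deriv h) +
     (fps_const c - fps_const ((c - a) + (c - b) + 1) * fps_X) * fps_deriv h - fps_const ((c - a) * (c - b)) * h)"
    unfolding y1 y2 unfolding D_def e_def y_def
    by (simp add: algebra_simps numeral_fps_const flip: fps_const_mult fps_const_sub fps_const_add)
  also have "\<dots> = 0" using h by simp
  finally have "?L = 0"
  proof -
    assume "D * ?L = 0"
    moreover have "D \<noteq> 0"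
    proof
      assume "D = 0"
      then have "D $ 0 = 0" by simp
      then show False by (simp add: D_def)
    qed
    ultimately show ?thesis by simp
  qed
  then have "y = hyp2F1_fps a b c"
    unfolding D_def by (intro hyp2F1_fps_unique[OF assms]) (simp_all add: y_def B_def h_def hyp2F1_fps_nth)
  then show ?thesis by (simp add: y_def B_def h_def e_def)
qed

section \<open>Alternating binomial sums\<close>

lemma alternating_binomial_sum_Suc:
  fixes f :: "nat \<Rightarrow> 'a :: comm_ring_1"
  shows "(\<Sum>i\<le>Suc k. (-1) ^ i * of_nat (Suc k choose i) * f i) =
         (\<Sum>i\<le>k. (-1) ^ i * of_nat (k choose i) * (f i - f (Suc i)))"
proof -
  have "(\<Sum>i\<le>Suc k. (-1) ^ i * of_nat (Suc k choose i) * f i) =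
        f 0 + (\<Sum>i\<le>k. (-1) ^ Suc i * of_nat (k choose Suc i) * f (Suc i))
          + (\<Sum>i\<le>k. (-1) ^ Suc i * of_nat (k choose i) * f (Suc i))"
    by (subst sum.atMost_Suc_shift) (simp add: ring_distribs sum.distrib sum_subtractf sum_negf)
  also have "f 0 + (\<Sum>i\<le>k. (-1) ^ Suc i * of_nat (k choose Suc i) * f (Suc i)) =
             (\<Sum>i\<le>Suc k. (-1) ^ i * of_nat (k choose i) * f i)"
    by (subst sum.atMost_Suc_shift) simp
  also have "\<dots> = (\<Sum>i\<le>k. (-1) ^ i * of_nat (k choose i) * f i)"
    by (simp add: binomial_eq_0)
  finally show ?thesis
    by (simp add: algebra_simps sum_subtractf sum_negf)
qed

text \<open>Passing to first differences lowers the degree, because the leading coefficients of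
  \<open>p\<close> and of its translate by 1 cancel.\<close>

lemma alternating_binomial_sum_poly:
  fixes p :: "'a :: {idom} poly"
  assumes "degree p < k"
  shows "(\<Sum>i\<le>k. (-1) ^ i * of_nat (k choose i) * poly p (of_nat i)) = 0"
  using assms
proof (induction k arbitrary: p)
  case (Suc k)
  define p' where "p' = p - pcompose p [:1, 1:]"
  have p': "poly p (of_nat i) - poly p (of_nat (Suc i)) = poly p' (of_nat i)" for i
    by (simp add: p'_def poly_pcompose add_ac)
  have "p' = 0 \<or> degree p' < k"
  proof (cases "degree p = 0")
    case True
    then obtain c where "p = [:c:]" by (metis degree_eq_zeroE)
    then show ?thesis by (simp add: p'_def)
  next
    case False
    have "degree p' \<le> degree p"
      unfolding p'_def by (intro degree_diff_le) (auto simp: degree_pcompose)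
    moreover have "coeff p' (degree p) = 0"
      using lead_coeff_comp[of "[:1, 1:]" p] by (simp add: p'_def degree_pcompose)
    ultimately have "p' = 0 \<or> degree p' < degree p"
      using False by (metis eq_zero_or_degree_less)
    then show ?thesis using Suc.prems by linarith
  qed
  then show ?case
    unfolding alternating_binomial_sum_Suc p' using Suc.IH[of p'] by auto
qed simp

lemma poly_pochhammer: "poly (pochhammer p n) x = pochhammer (poly p x) n"
  by (induction n) (simp_all add: pochhammer_Suc)

lemma degree_pochhammer_le: "degree (pochhammer [:c, d:] n :: 'a :: comm_ring_1 poly) \<le> n"
proof (induction n)
  case (Suc n)
  have "degree ([:c, d:] + of_nat n :: 'a poly) \<le> 1"
    by (simp add: of_nat_poly)
  then have "degree (pochhammer [:c, d:] n * ([:c, d:] + of_nat n) :: 'a poly) \<le> n + 1"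
    using Suc by (intro order.trans[OF degree_mult_le]) simp
  then show ?case by (simp add: pochhammer_Suc)
qed simp

lemma not_Ints_diff_of_nat: "(c :: complex) \<notin> \<int> \<Longrightarrow> c - of_nat n \<notin> \<int>"
  by (metis Ints_add Ints_of_nat diff_add_cancel)

lemma pochhammer_one_minus:
  "pochhammer (1 - a) l = (- 1) ^ l * pochhammer (a - of_nat l) l" for a :: complex
  using pochhammer_minus[of "a - 1" l] by simp

text \<open>The dependence on \<open>i\<close> of two numerator symbols of a convolution term is
  collected, up to a sign, in one symbol that is a polynomial in \<open>i\<close> of degree
  \<open>k - s\<close>.\<close>

lemma pochhammer_mult_shift:
  fixes a :: complex
  assumes "a \<notin> \<int>" "s \<le> k" "i \<le> k"
  shows "pochhammer (a - of_nat s) i * pochhammer (1 - a) (k - i) * pochhammer (a - of_nat k) (k - s) =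
    (- 1) ^ (k - i) * pochhammer (a - of_nat k) k * pochhammer (a - of_nat k + of_nat i) (k - s)"
proof -
  have 1: "pochhammer (a - of_nat k) k = pochhammer (a - of_nat k) i * pochhammer (a - of_nat k + of_nat i) (k - i)"
    using assms by (intro pochhammer_product) simp
  have 2: "pochhammer (1 - a) (k - i) = (- 1) ^ (k - i) * pochhammer (a - of_nat k + of_nat i) (k - i)"
    using assms by (simp add: pochhammer_one_minus of_nat_diff algebra_simps)
  have 3: "pochhammer (a - of_nat k) (k - s + i) = pochhammer (a - of_nat k) (k - s) * pochhammer (a - of_nat s) i"
    using assms by (subst pochhammer_product') (simp add: of_nat_diff)
  have 4: "pochhammer (a - of_nat k) (i + (k - s)) = pochhammer (a - of_nat k) i * pochhammer (a - of_nat k + of_nat i) (k - s)"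
    by (rule pochhammer_product')
  have 5: "pochhammer (a - of_nat k) (k - s) * pochhammer (a - of_nat s) i =
           pochhammer (a - of_nat k) i * pochhammer (a - of_nat k + of_nat i) (k - s)"
    using 3 4 by (simp add: add.commute)
  have "pochhammer (a - of_nat s) i * pochhammer (1 - a) (k - i) * pochhammer (a - of_nat k) (k - s) =
        (pochhammer (a - of_nat k) (k - s) * pochhammer (a - of_nat s) i) * pochhammer (1 - a) (k - i)"
    by simp
  also have "\<dots> = (- 1) ^ (k - i) * pochhammer (a - of_nat k) k * pochhammer (a - of_nat k + of_nat i) (k - s)"
    unfolding 5 2 1 by simp
  finally show ?thesis .
qed

text \<open>The two lower Pochhammer symbols of a convolution term divide the fixed symbol
  \<open>pochhammer g N\<close>. Dividing by them thus amounts to multiplying by the cofactor, which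
  is polynomial.\<close>

lemma pochhammer_mult_complement:
  fixes g :: complex
  assumes "i + l \<le> N"
  shows "pochhammer g N =
     (- 1) ^ l * (pochhammer g i * pochhammer (1 - (g + of_nat N)) l) * pochhammer (g + of_nat i) (N - i - l)"
proof -
  have "pochhammer g N = pochhammer g i * pochhammer (g + of_nat i) (N - i)"
    using assms by (intro pochhammer_product) simp
  also have "pochhammer (g + of_nat i) (N - i) =
     pochhammer (g + of_nat i) (N - i - l) * pochhammer (g + of_nat i + of_nat (N - i - l)) (N - i - (N - i - l))"
    by (intro pochhammer_product) simp
  also have "N - i - (N - i - l) = l" using assms by simp
  also have "g + of_nat i + of_nat (N - i - l) = g + of_nat N - of_nat l"
    using assms by (simp add: of_nat_diff)
  also have "pochhammer (g + of_nat N - of_nat l) l = (- 1) ^ l * pochhammer (1 - (g + of_nat N)) l"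
    unfolding pochhammer_one_minus by (simp flip: mult.assoc power_add)
  finally show ?thesis by (simp add: mult_ac)
qed

text \<open>
  The coefficient is a \<open>k\<close>-th finite difference of a polynomial of degree at most
  \<open>k + r - s - t\<close>.
\<close>

lemma hyp2F1_fps_mult_coeff_eq_0:
  assumes "a \<notin> \<int>" "b \<notin> \<int>" "c \<notin> \<int>" "s \<le> k" "t \<le> k" "k \<le> r" "r < s + t"
  shows "(hyp2F1_fps (a - of_nat s) (b - of_nat t) (c - of_nat r) *
          hyp2F1_fps (1 - a) (1 - b) (1 - c)) $ k = 0"
proof -
  define q where "q = pochhammer [:a - of_nat k, 1:] (k - s) * pochhammer [:b - of_nat k, 1:] (k - t) *
     pochhammer [:c - of_nat r, 1:] (r - k)"
  define A where "A = pochhammer (a - of_nat k) k / pochhammer (a - of_nat k) (k - s)"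
  define B where "B = pochhammer (b - of_nat k) k / pochhammer (b - of_nat k) (k - t)"
  define C where "C = pochhammer (c - of_nat r) r"
  have "degree q \<le> (k - s) + (k - t) + (r - k)"
    unfolding q_def by (intro order.trans[OF degree_mult_le] add_mono degree_pochhammer_le)
  then have deg: "degree q < k" using assms by linarith
  have summand: "hyp2F1_fps (a - of_nat s) (b - of_nat t) (c - of_nat r) $ i * hyp2F1_fps (1 - a) (1 - b) (1 - c) $ (k - i) =
     (- 1) ^ k * A * B / (C * fact k) * ((- 1) ^ i * of_nat (k choose i) * poly q (of_nat i))"
    if "i \<le> k" for i
  proof -
    have a: "pochhammer (a - of_nat s) i * pochhammer (1 - a) (k - i) =
       (- 1) ^ (k - i) * A * pochhammer (a - of_nat k + of_nat i) (k - s)"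
      using pochhammer_mult_shift[OF assms(1,4) that] pochhammer_ne_0[OF not_Ints_diff_of_nat[OF assms(1)]]
      by (simp add: A_def field_simps)
    have b: "pochhammer (b - of_nat t) i * pochhammer (1 - b) (k - i) =
       (- 1) ^ (k - i) * B * pochhammer (b - of_nat k + of_nat i) (k - t)"
      using pochhammer_mult_shift[OF assms(2,5) that] pochhammer_ne_0[OF not_Ints_diff_of_nat[OF assms(2)]]
      by (simp add: B_def field_simps)
    have c: "C = (- 1) ^ (k - i) * (pochhammer (c - of_nat r) i * pochhammer (1 - c) (k - i)) *
       pochhammer (c - of_nat r + of_nat i) (r - k)"
      using pochhammer_mult_complement[of i "k - i" r "c - of_nat r"] that assms by (simp add: C_def)
    have C0: "C \<noteq> 0" unfolding C_def by (rule pochhammer_ne_0[OF not_Ints_diff_of_nat[OF assms(3)]])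
    have D0: "pochhammer (c - of_nat r) i * pochhammer (1 - c) (k - i) \<noteq> 0" using C0 c by auto
    have c': "1 / (pochhammer (c - of_nat r) i * pochhammer (1 - c) (k - i)) =
        (- 1) ^ (k - i) * pochhammer (c - of_nat r + of_nat i) (r - k) / C"
      using C0 D0 c by (simp add: divide_simps)
    have ch: "of_nat (k choose i) / fact k = (1 :: complex) / (fact i * fact (k - i))"
      using that by (simp add: binomial_fact)
    have "hyp2F1_fps (a - of_nat s) (b - of_nat t) (c - of_nat r) $ i * hyp2F1_fps (1 - a) (1 - b) (1 - c) $ (k - i) =
      (pochhammer (a - of_nat s) i * pochhammer (1 - a) (k - i)) * (pochhammer (b - of_nat t) i * pochhammer (1 - b) (k - i))
      * (1 / (pochhammer (c - of_nat r) i * pochhammer (1 - c) (k - i))) * (1 / (fact i * fact (k - i)))"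
      by (simp add: hyp2F1_fps_nth mult_ac)
    also have "\<dots> = (- 1) ^ (k - i) * ((- 1) ^ (k - i) * (- 1) ^ (k - i)) * A * B / (C * fact k) *
       (of_nat (k choose i) * poly q (of_nat i))"
      unfolding a b c' ch[symmetric] q_def poly_mult poly_pochhammer by (simp add: add_ac)
    also have "(- 1) ^ (k - i) * ((- 1) ^ (k - i) * (- 1) ^ (k - i)) = (- 1 :: complex) ^ (k - i)"
      by (simp flip: power_mult_distrib)
    also have "(- 1 :: complex) ^ (k - i) = (- 1) ^ k * (- 1) ^ i"
    proof -
      have "(- 1 :: complex) ^ k = (- 1) ^ (k - i) * (- 1) ^ i" using that by (simp flip: power_add)
      then show ?thesis by (simp add: mult.assoc flip: power_mult_distrib)
    qed
    finally show ?thesis by (simp add: mult_ac)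
  qed
  have "(hyp2F1_fps (a - of_nat s) (b - of_nat t) (c - of_nat r) *
          hyp2F1_fps (1 - a) (1 - b) (1 - c)) $ k =
     (\<Sum>i\<le>k. (- 1) ^ k * A * B / (C * fact k) * ((- 1) ^ i * of_nat (k choose i) * poly q (of_nat i)))"
    unfolding fps_mult_nth atLeast0AtMost using summand by (intro sum.cong) auto
  also have "\<dots> = 0"
    unfolding sum_distrib_left[symmetric] alternating_binomial_sum_poly[OF deg] by simp
  finally show ?thesis .
qed

section \<open>Contiguity relations\<close>

text \<open>
  Up to the factor \<open>X powr (- c)\<close>, \<open>sndF a b c\<close> and \<open>sndG a b c\<close> are the second solutions at the
  origin accompanying \<open>hyp2F1_fps a b c\<close> and \<open>hyp2F1_fps a b (c + 1)\<close>; the normalisation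
  makes both pairs satisfy the same contiguity relations.
\<close>

definition wconst :: "complex \<Rightarrow> complex \<Rightarrow> complex \<Rightarrow> complex" where
  "wconst a b c = (c - a) * (c - b) / (c * (c - 1))"

definition sndG :: "complex \<Rightarrow> complex \<Rightarrow> complex \<Rightarrow> complex fps" where
  "sndG a b c = hyp2F1_fps (a - c) (b - c) (1 - c)"

definition sndF :: "complex \<Rightarrow> complex \<Rightarrow> complex \<Rightarrow> complex fps" where
  "sndF a b c = fps_const (- wconst a b c) * fps_X * hyp2F1_fps (a + 1 - c) (b + 1 - c) (2 - c)"

text \<open>The factor that turns the coefficient of \<open>hyp2F1_fps a b (c + 1)\<close> at
  exponent \<open>n\<close> into that of the series with parameters lowered by \<open>s\<close>,
  \<open>t\<close>, \<open>r\<close>. Being rational in \<open>n\<close>, it also makes sense at the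
  exponents \<open>m - c\<close> of the second solution.\<close>

definition contig_ratio ::
  "complex \<Rightarrow> complex \<Rightarrow> complex \<Rightarrow> nat \<Rightarrow> nat \<Rightarrow> nat \<Rightarrow> complex \<Rightarrow> complex" where
  "contig_ratio a b c s t r n =
     pochhammer (a - of_nat s) s * pochhammer (b - of_nat t) t * pochhammer (c - of_nat r + n) (Suc r) /
     (pochhammer (a + n - of_nat s) s * pochhammer (b + n - of_nat t) t * pochhammer (c - of_nat r) (Suc r))"

text \<open>The second solution that accompanies the shifted series. It will turn out to be a
  constant times a power of \<open>X\<close> times the second solution of the shifted
  parameters.\<close>

definition snd_shift :: "complex \<Rightarrow> complex \<Rightarrow> complex \<Rightarrow> nat \<Rightarrow> nat \<Rightarrow> nat \<Rightarrow> complex fps" where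
  "snd_shift a b c s t r = Abs_fps (\<lambda>m. contig_ratio a b c s t r (of_nat m - c) * sndG a b c $ m)"

text \<open>With the parameters belonging to \<open>w + 1\<close> and evaluated at \<open>x\<close>,
  this is \<open>P(w)\<close> without its prefactor; \<open>t - 1\<close> is then the order
  \<open>r - q - 1\<close>.\<close>

definition truncF :: "complex \<Rightarrow> complex \<Rightarrow> complex \<Rightarrow> nat \<Rightarrow> nat \<Rightarrow> nat \<Rightarrow> complex poly" where
  "truncF a b c s t r = fps_trunc (t - 1)
     (hyp2F1_fps (a - of_nat s) (b - of_nat t) (c - of_nat r) * hyp2F1_fps (1 - a) (1 - b) (1 - c))"

definition truncG :: "complex \<Rightarrow> complex \<Rightarrow> complex \<Rightarrow> nat \<Rightarrow> nat \<Rightarrow> nat \<Rightarrow> complex poly" where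
  "truncG a b c s t r = fps_trunc (t - 1)
     (hyp2F1_fps (a - of_nat s) (b - of_nat t) (c - of_nat r) * hyp2F1_fps (1 - a) (1 - b) (2 - c))"

lemma one_minus_not_Ints: "(c :: complex) \<notin> \<int> \<Longrightarrow> 1 - c \<notin> \<int>"
  by (metis Ints_1 Ints_diff diff_diff_eq2 add_diff_cancel_left')

lemma sndF_nth:
  assumes "c \<notin> \<int>"
  shows "c * sndF a b c $ m = of_nat m * sndG a b c $ m"
proof (cases m)
  case (Suc l)
  have c0: "c \<noteq> 0" "c - 1 \<noteq> 0" "1 - c \<noteq> 0" using assms by (auto simp: eq_iff_diff_eq_0[symmetric])
  have p: "pochhammer (a - c) (Suc l) = (a - c) * pochhammer (a + 1 - c) l" for a
    by (simp add: pochhammer_rec algebra_simps)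
  have q: "pochhammer (1 - c) (Suc l) = (1 - c) * pochhammer (2 - c) l"
    by (simp add: pochhammer_rec algebra_simps)
  have "2 - c \<notin> \<int>" using not_Ints_add_of_nat[OF one_minus_not_Ints[OF assms], of 1] by (simp add: add.commute)
  then have ne: "pochhammer (2 - c) l \<noteq> 0" by (rule pochhammer_ne_0)
  have "of_nat m * sndG a b c $ m = (a - c) * (b - c) / (1 - c) * hyp2F1_fps (a + 1 - c) (b + 1 - c) (2 - c) $ l"
    unfolding Suc sndG_def hyp2F1_fps_nth p q fact_Suc of_nat_mult using ne c0
    by (simp add: divide_simps del: of_nat_Suc)
  also have "(a - c) * (b - c) / (1 - c) = c * (- wconst a b c)"
    unfolding wconst_def using c0 by (simp add: divide_simps) (simp add: algebra_simps)
  also have "c * (- wconst a b c) * hyp2F1_fps (a + 1 - c) (b + 1 - c) (2 - c) $ l = c * sndF a b c $ m"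
    by (simp add: sndF_def Suc mult.assoc)
  finally show ?thesis by simp
qed (simp add: sndF_def)

text \<open>Euler's transformation brings the second solution to the upper parameters
  \<open>1 - a\<close> and \<open>1 - b\<close>, which are those of the Legendre-type relation and
  of the truncated products.\<close>

lemma sndG_euler:
  assumes "c \<notin> \<int>"
  shows "sndG a b c = (1 - fps_X) * one_minus_X_powr (c - a - b) * hyp2F1_fps (1 - a) (1 - b) (1 - c)"
proof -
  have eqs: "1 - c - (a - c) = 1 - a" "1 - c - (b - c) = 1 - b" "1 - a - (b - c) = (c - a - b) + 1"
    by simp_all
  have "sndG a b c = one_minus_X_powr ((c - a - b) + 1) * hyp2F1_fps (1 - a) (1 - b) (1 - c)"
    using hyp2F1_fps_euler[OF one_minus_not_Ints[OF assms], of "a - c" "b - c"]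
    unfolding eqs by (simp add: sndG_def)
  then show ?thesis by (simp add: one_minus_X_powr_plus1)
qed

lemma sndF_euler:
  assumes "c \<notin> \<int>"
  shows "sndF a b c = - fps_const (wconst a b c) * fps_X * one_minus_X_powr (c - a - b) *
            hyp2F1_fps (1 - a) (1 - b) (2 - c)"
proof -
  have c: "2 - c \<notin> \<int>"
    using not_Ints_add_of_nat[OF one_minus_not_Ints[OF assms], of 1] by (simp add: add.commute)
  have eqs: "2 - c - (a + 1 - c) = 1 - a" "2 - c - (b + 1 - c) = 1 - b"
    "1 - a - (b + 1 - c) = c - a - b" by simp_all
  show ?thesis
    using hyp2F1_fps_euler[OF c, of "a + 1 - c" "b + 1 - c"]
    unfolding eqs by (simp add: sndF_def mult_ac)
qed

text \<open>The determinant of the fundamental matrix: the Legendre-type relation after Euler's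
  transformation of both second solutions.\<close>

lemma wronskian:
  assumes "c \<notin> \<int>"
  shows "hyp2F1_fps a b c * sndG a b c - sndF a b c * hyp2F1_fps a b (c + 1) =
         one_minus_X_powr (c - a - b)"
proof -
  have "hyp2F1_fps a b c * sndG a b c - sndF a b c * hyp2F1_fps a b (c + 1) =
    one_minus_X_powr (c - a - b) * ((1 - fps_X) * hyp2F1_fps a b c * hyp2F1_fps (1 - a) (1 - b) (1 - c) +
         fps_const (wconst a b c) * fps_X * hyp2F1_fps a b (c + 1) * hyp2F1_fps (1 - a) (1 - b) (2 - c))"
    unfolding sndG_euler[OF assms] sndF_euler[OF assms] by (simp add: algebra_simps del: fps_const_neg)
  also have "\<dots> = one_minus_X_powr (c - a - b)"
    unfolding wconst_def hyp2F1_fps_wronskian[OF assms] by simp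
  finally show ?thesis .
qed

text \<open>
  The numbers \<open>sol_coeff a b c v m\<close> are the coefficients of \<open>hyp2F1_fps a b (c + 1)\<close> for \<open>v = 0\<close> and
  of \<open>sndG a b c\<close> for \<open>v = - c\<close>, the two exponents at the origin.  The coefficients of all contiguous
  functions are these times a rational function of \<open>v + m\<close>, with a common numerator \<open>contig_poly\<close>
  for the whole contiguity relation.
\<close>

definition sol_coeff :: "complex \<Rightarrow> complex \<Rightarrow> complex \<Rightarrow> complex \<Rightarrow> nat \<Rightarrow> complex" where
  "sol_coeff a b c v m = pochhammer (a + v) m * pochhammer (b + v) m /
      (pochhammer (c + 1 + v) m * pochhammer (1 + v) m)"

text \<open>What remains when the coefficient \<open>j\<close> places earlier is expressed through
  the current one and multiplied by the common denominator
  \<open>(a + n - t)_t (b + n - t)_t\<close>. The last two factors come from the lower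
  parameters.\<close>

definition shift_poly :: "complex \<Rightarrow> complex \<Rightarrow> complex \<Rightarrow> nat \<Rightarrow> nat \<Rightarrow> complex poly" where
  "shift_poly a b c t j = pochhammer [:a - of_nat t, 1:] (t - j) * pochhammer [:b - of_nat t, 1:] (t - j) *
      pochhammer [:c - of_nat j + 1, 1:] j * pochhammer [:1 - of_nat j, 1:] j"

lemma pochhammer_shift_split:
  fixes a :: complex
  assumes "j \<le> t"
  shows "pochhammer (a + n - of_nat t) t = pochhammer (a - of_nat t + n) (t - j) * pochhammer (a + n - of_nat j) j"
proof -
  have "pochhammer (a + n - of_nat t) t = pochhammer (a + n - of_nat t) (t - j) *
     pochhammer (a + n - of_nat t + of_nat (t - j)) (t - (t - j))"
    by (intro pochhammer_product) simp
  then show ?thesis using assms by (simp add: of_nat_diff algebra_simps)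
qed

lemma pochhammer_diff_of_nat_eq_0:
  assumes "m < j"
  shows "pochhammer (1 - of_nat j + of_nat m :: complex) j = 0"
proof -
  have "1 - of_nat j + of_nat m = (- of_nat (j - 1 - m) :: complex)"
    using assms by (simp add: of_nat_diff)
  then show ?thesis using assms by (auto simp: pochhammer_eq_0_iff intro!: exI[of _ "j - 1 - m"])
qed

context
  fixes a b c v :: complex
  assumes v: "v = 0 \<or> v = - c"
    and ints: "a \<notin> \<int>" "b \<notin> \<int>" "c \<notin> \<int>" "a - c \<notin> \<int>" "b - c \<notin> \<int>"
begin

lemma numerator_not_Ints: "a + v \<notin> \<int>" "b + v \<notin> \<int>"
  using v ints by auto

lemma denominator_ne_0: "pochhammer (c + 1 + v) m \<noteq> 0" "pochhammer (1 + v) m \<noteq> 0"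
proof -
  have 1: "pochhammer (1 :: complex) m \<noteq> 0" by (simp add: pochhammer_fact[symmetric])
  have 2: "pochhammer (c + 1) m \<noteq> 0"
    using pochhammer_ne_0[OF not_Ints_add_of_nat[OF ints(3), of 1]] by simp
  have 3: "pochhammer (1 - c) m \<noteq> 0"
    using pochhammer_ne_0[OF one_minus_not_Ints[OF ints(3)]] by simp
  show "pochhammer (c + 1 + v) m \<noteq> 0" "pochhammer (1 + v) m \<noteq> 0"
    using v 1 2 3 by auto
qed

lemma sol_coeff_ne_0: "sol_coeff a b c v m \<noteq> 0"
  unfolding sol_coeff_def using denominator_ne_0 pochhammer_ne_0 numerator_not_Ints by simp

lemma sol_coeff_shift:
  assumes "j \<le> t"
  shows "pochhammer (a + (v + of_nat m) - of_nat t) t * pochhammer (b + (v + of_nat m) - of_nat t) t *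
     (if j \<le> m then sol_coeff a b c v (m - j) else 0) =
     poly (shift_poly a b c t j) (v + of_nat m) * sol_coeff a b c v m"
proof (cases "j \<le> m")
  case True
  define n where "n = v + of_nat m"
  have sp: "pochhammer (z + v) m = pochhammer (z + v) (m - j) * pochhammer (z + n - of_nat j) j" for z
    using pochhammer_product[of "m - j" m "z + v"] True by (simp add: n_def of_nat_diff algebra_simps)
  have sol: "sol_coeff a b c v m = sol_coeff a b c v (m - j) *
     (pochhammer (a + n - of_nat j) j * pochhammer (b + n - of_nat j) j /
      (pochhammer (c + 1 + n - of_nat j) j * pochhammer (1 + n - of_nat j) j))"
    unfolding sol_coeff_def using sp[of a] sp[of b] sp[of "c + 1"] sp[of 1] by (simp add: mult_ac)
  have ne: "pochhammer (c + 1 + n - of_nat j) j \<noteq> 0" "pochhammer (1 + n - of_nat j) j \<noteq> 0"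
    using denominator_ne_0[of m] sp[of "c + 1"] sp[of 1] by auto
  have "poly (shift_poly a b c t j) n = pochhammer (a - of_nat t + n) (t - j) * pochhammer (b - of_nat t + n) (t - j) *
      pochhammer (c + 1 + n - of_nat j) j * pochhammer (1 + n - of_nat j) j"
    unfolding shift_poly_def poly_mult poly_pochhammer by (simp add: algebra_simps)
  then show ?thesis
    unfolding n_def[symmetric] sol pochhammer_shift_split[OF assms] using True ne by simp
next
  \<comment> \<open>Here the earlier coefficient is 0 by convention, and the numerator vanishes as
    well: through its last factor if \<open>v = 0\<close>, through the one before it if
    \<open>v = - c\<close>.\<close>
  case False
  have "poly (shift_poly a b c t j) (v + of_nat m) = 0"
  proof -
    have "pochhammer (c - of_nat j + 1 + (v + of_nat m)) j = 0 \<or> pochhammer (1 - of_nat j + (v + of_nat m)) j = 0"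
      using v pochhammer_diff_of_nat_eq_0[of m j] False by (auto simp: algebra_simps)
    then show ?thesis unfolding shift_poly_def poly_mult poly_pochhammer by (auto simp: algebra_simps)
  qed
  then show ?thesis using False by simp
qed

end

definition contig_poly ::
  "complex \<Rightarrow> complex \<Rightarrow> complex \<Rightarrow> nat \<Rightarrow> nat \<Rightarrow> nat \<Rightarrow> complex poly \<Rightarrow> complex poly \<Rightarrow> complex poly" where
  "contig_poly a b c s t r T U =
     smult (pochhammer (a - of_nat s) s * pochhammer (b - of_nat t) t / pochhammer (c - of_nat r) (Suc r))
       (pochhammer [:a - of_nat t, 1:] (t - s) * pochhammer [:c - of_nat r, 1:] (Suc r)) -
     (\<Sum>j\<le>t. smult (coeff T j / c) ([:c - of_nat j, 1:] * shift_poly a b c t j) +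
             smult (coeff U j) (shift_poly a b c t j))"

lemma fps_of_poly_mult_nth:
  fixes T :: "complex poly"
  assumes "degree T \<le> t"
  shows "(fps_of_poly T * y) $ m = (\<Sum>j\<le>t. coeff T j * (if j \<le> m then y $ (m - j) else 0))"
proof -
  have "(fps_of_poly T * y) $ m = (\<Sum>j\<le>m. coeff T j * y $ (m - j))"
    by (simp add: fps_mult_nth atLeast0AtMost)
  also have "\<dots> = (\<Sum>j\<in>{..m} \<inter> {..t}. coeff T j * y $ (m - j))"
  proof (intro sum.mono_neutral_right ballI)
    fix i assume "i \<in> {..m} - {..m} \<inter> {..t}"
    then have "degree T < i" using assms by auto
    then show "coeff T i * y $ (m - i) = 0" by (simp add: coeff_eq_0)
  qed auto
  also have "\<dots> = (\<Sum>j\<in>{..m} \<inter> {..t}. coeff T j * (if j \<le> m then y $ (m - j) else 0))"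
    by (intro sum.cong) auto
  also have "\<dots> = (\<Sum>j\<le>t. coeff T j * (if j \<le> m then y $ (m - j) else 0))"
    by (intro sum.mono_neutral_left) auto
  finally show ?thesis .
qed

text \<open>After multiplication by the common denominator each term of the relation is a polynomial
  in the exponent \<open>v + m\<close> times the coefficient of \<open>G\<close>. The polynomial is
  the same for both values of \<open>v\<close>, so zeros found at the two exponents can be added
  up.\<close>

lemma contig_poly_eq:
  assumes "v = 0 \<or> v = - c" "a \<notin> \<int>" "b \<notin> \<int>" "c \<notin> \<int>" "a - c \<notin> \<int>" "b - c \<notin> \<int>"
    and st: "s \<le> t" "degree T \<le> t" "degree U \<le> t"
    and G: "\<And>m. G $ m = sol_coeff a b c v m"
    and F: "\<And>m. c * F $ m = (c + (v + of_nat m)) * G $ m"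
    and Y: "\<And>m. Y $ m = contig_ratio a b c s t r (v + of_nat m) * G $ m"
  shows "pochhammer (a + (v + of_nat m) - of_nat t) t * pochhammer (b + (v + of_nat m) - of_nat t) t *
           (Y - fps_of_poly T * F - fps_of_poly U * G) $ m =
         poly (contig_poly a b c s t r T U) (v + of_nat m) * G $ m"
proof -
  note ass = assms(1-6)
  define n where "n = v + of_nat m"
  define d where "d = pochhammer (a + n - of_nat t) t * pochhammer (b + n - of_nat t) t"
  have c0: "c \<noteq> 0" using ass by auto
  have cr: "pochhammer (c - of_nat r) (Suc r) \<noteq> 0"
    by (rule pochhammer_ne_0[OF not_Ints_diff_of_nat]) fact
  have an: "pochhammer (z + n - of_nat j) i \<noteq> 0" if "z \<in> {a, b}" for z j i
  proof -
    have "z + v \<notin> \<int>" using that numerator_not_Ints[OF ass] by auto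
    then have "z + v + of_nat m - of_nat j \<notin> \<int>"
      by (intro not_Ints_diff_of_nat not_Ints_add_of_nat)
    then have "z + n - of_nat j \<notin> \<int>" by (simp add: n_def add_ac)
    then show ?thesis by (rule pochhammer_ne_0)
  qed
  have split: "pochhammer (a + n - of_nat t) t = pochhammer (a - of_nat t + n) (t - s) * pochhammer (a + n - of_nat s) s"
    by (rule pochhammer_shift_split[OF st(1)])
  have "d * Y $ m = poly (smult (pochhammer (a - of_nat s) s * pochhammer (b - of_nat t) t / pochhammer (c - of_nat r) (Suc r))
       (pochhammer [:a - of_nat t, 1:] (t - s) * pochhammer [:c - of_nat r, 1:] (Suc r))) n * G $ m"
    unfolding d_def Y n_def[symmetric] contig_ratio_def split poly_smult poly_mult poly_pochhammer
    using cr an[of a s s] an[of b t t] by (simp add: del: pochhammer_Suc)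
  moreover have "d * (if j \<le> m then G $ (m - j) else 0) = poly (shift_poly a b c t j) n * G $ m"
    if "j \<le> t" for j
    using sol_coeff_shift[OF ass that, of m] by (simp add: G d_def n_def cong: if_cong)
  moreover have "d * (if j \<le> m then F $ (m - j) else 0) =
      poly ([:c - of_nat j, 1:] * shift_poly a b c t j) n / c * G $ m" if "j \<le> t" for j
  proof (cases "j \<le> m")
    case True
    have "F $ (m - j) = (c + n - of_nat j) / c * G $ (m - j)"
      using F[of "m - j"] c0 True by (simp add: n_def of_nat_diff field_simps)
    moreover have "d * G $ (m - j) = poly (shift_poly a b c t j) n * G $ m"
      using sol_coeff_shift[OF ass that, of m] True by (simp add: G d_def n_def)
    ultimately have "d * F $ (m - j) = (c + n - of_nat j) / c * (poly (shift_poly a b c t j) n * G $ m)"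
      by (metis mult.left_commute)
    then show ?thesis using True by (simp add: algebra_simps)
  next
    case False
    have "poly (shift_poly a b c t j) n * G $ m = 0"
      using sol_coeff_shift[OF ass that, of m] False by (simp add: G d_def n_def)
    then show ?thesis using False by auto
  qed
  ultimately have "d * (Y - fps_of_poly T * F - fps_of_poly U * G) $ m =
     poly (contig_poly a b c s t r T U) n * G $ m"
    unfolding contig_poly_def fps_sub_nth fps_of_poly_mult_nth[OF st(2)] fps_of_poly_mult_nth[OF st(3)]
      poly_diff poly_sum right_diff_distrib left_diff_distrib sum_distrib_left sum_distrib_right
    apply (simp only: mult.left_commute[of d] poly_add poly_smult sum.distrib distrib_right)
    apply (simp add: mult_ac)
    done
  then show ?thesis by (simp add: d_def n_def)
qed

lemma degree_pochhammer_mult_le: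
  fixes p :: "complex poly"
  shows "degree p \<le> n \<Longrightarrow> degree (p * pochhammer [:c, 1:] m) \<le> n + m"
  by (intro order.trans[OF degree_mult_le] add_mono degree_pochhammer_le)

lemma degree_shift_poly:
  assumes "j \<le> t"
  shows "degree (shift_poly a b c t j) \<le> 2 * t"
proof -
  have "degree (shift_poly a b c t j) \<le> (t - j) + (t - j) + j + j"
    unfolding shift_poly_def by (intro degree_pochhammer_mult_le degree_pochhammer_le)
  then show ?thesis using assms by simp
qed

lemma degree_contig_poly:
  assumes "s \<le> t" "r < s + t"
  shows "degree (contig_poly a b c s t r T U) \<le> 2 * t + 1"
proof -
  have "degree (pochhammer [:a - of_nat t, 1:] (t - s) * pochhammer [:c - of_nat r, 1:] (Suc r)) \<le> (t - s) + Suc r"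
    by (intro degree_pochhammer_mult_le degree_pochhammer_le)
  also have "\<dots> \<le> 2 * t + 1" using assms by simp
  finally have 1: "degree (pochhammer [:a - of_nat t, 1:] (t - s) * pochhammer [:c - of_nat r, 1:] (Suc r)) \<le> 2 * t + 1" .
  have 2: "degree ([:c - of_nat j, 1:] * shift_poly a b c t j) \<le> 2 * t + 1" if "j \<le> t" for j
  proof -
    have "degree ([:c - of_nat j, 1:] * shift_poly a b c t j) \<le> 1 + 2 * t"
      using degree_shift_poly[OF that, of a b c] by (intro order.trans[OF degree_mult_le] add_mono) auto
    then show ?thesis by simp
  qed
  have 3: "degree (shift_poly a b c t j) \<le> 2 * t + 1" if "j \<le> t" for j
    using degree_shift_poly[OF that, of a b c] by simp
  show ?thesis
    unfolding contig_poly_def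
    by (intro degree_diff_le degree_sum_le degree_add_le order.trans[OF degree_smult_le] 1 2 3) auto
qed

text \<open>
  The numerator has degree at most \<open>2 t + 1\<close>, but \<open>2 (r + 1)\<close> zeros as soon as the relation holds up
  to order \<open>r\<close> at both exponents.
\<close>

lemma contig_eqI:
  assumes ints: "a \<notin> \<int>" "b \<notin> \<int>" "c \<notin> \<int>" "a - c \<notin> \<int>" "b - c \<notin> \<int>"
    and st: "s \<le> t" "t \<le> r" "r < s + t" "degree T \<le> t" "degree U \<le> t"
    and G: "\<And>v m. v \<in> {0, - c} \<Longrightarrow> G v $ m = sol_coeff a b c v m"
    and F: "\<And>v m. v \<in> {0, - c} \<Longrightarrow> c * F v $ m = (c + (v + of_nat m)) * G v $ m"
    and Y: "\<And>v m. v \<in> {0, - c} \<Longrightarrow> Y v $ m = contig_ratio a b c s t r (v + of_nat m) * G v $ m"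
    and low: "\<And>v m. v \<in> {0, - c} \<Longrightarrow> m \<le> r \<Longrightarrow> (Y v - fps_of_poly T * F v - fps_of_poly U * G v) $ m = 0"
    and v: "v \<in> {0, - c}"
  shows "Y v = fps_of_poly T * F v + fps_of_poly U * G v"
proof -
  define \<Phi> where "\<Phi> = contig_poly a b c s t r T U"
  define D where "D v m = pochhammer (a + (v + of_nat m) - of_nat t) t * pochhammer (b + (v + of_nat m) - of_nat t) t" for v m
  have eq: "D v m * (Y v - fps_of_poly T * F v - fps_of_poly U * G v) $ m = poly \<Phi> (v + of_nat m) * G v $ m"
    if "v \<in> {0, - c}" for v m
    unfolding \<Phi>_def D_def using that by (intro contig_poly_eq ints st G F Y) auto
  have zero: "poly \<Phi> (v + of_nat m) = 0" if "v \<in> {0, - c}" "m \<le> r" for v m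
  proof -
    have "sol_coeff a b c v m \<noteq> 0" using that by (intro sol_coeff_ne_0 ints) auto
    then show ?thesis using eq[of v m] low[of v m] that G[of v m] by auto
  qed
  have "\<Phi> = 0"
  proof (rule ccontr)
    assume "\<Phi> \<noteq> 0"
    define Z where "Z = (of_nat ` {..r}) \<union> (\<lambda>m. - c + of_nat m) ` {..r}"
    have "Z \<subseteq> {x. poly \<Phi> x = 0}"
      unfolding Z_def using zero[of 0] zero[of "- c"] by auto
    then have "card Z \<le> card {x. poly \<Phi> x = 0}"
      using \<open>\<Phi> \<noteq> 0\<close> by (intro card_mono poly_roots_finite)
    also have "\<dots> \<le> degree \<Phi>" using \<open>\<Phi> \<noteq> 0\<close> by (rule card_poly_roots_bound)
    also have "\<dots> \<le> 2 * t + 1" unfolding \<Phi>_def using st by (intro degree_contig_poly)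
    finally have "card Z \<le> 2 * t + 1" .
    \<comment> \<open>The two progressions of zeros are disjoint because \<open>c\<close> is not an
      integer, and \<open>t \<le> r\<close> makes their number exceed the degree bound.\<close>
    moreover have "card Z = Suc r + Suc r"
    proof -
      have "x \<notin> (\<lambda>m. - c + of_nat m) ` {..r}" if "x \<in> of_nat ` {..r}" for x :: complex
      proof
        assume "x \<in> (\<lambda>m. - c + of_nat m) ` {..r}"
        then obtain l where "x = - c + of_nat l" by blast
        moreover from \<open>x \<in> of_nat ` {..r}\<close> obtain k where "x = of_nat k" by blast
        ultimately have "of_nat k = - c + of_nat l" by simp
        then have "c = of_nat l - of_nat k" by (simp add: algebra_simps)
        then have "c \<in> \<int>" by simp
        with ints show False by simp
      qed
      then have "(of_nat ` {..r}) \<inter> (\<lambda>m. - c + of_nat m) ` {..r} = {}" by blast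
      moreover have "inj_on (\<lambda>m. - c + of_nat m) {..r}" "inj_on (of_nat :: nat \<Rightarrow> complex) {..r}"
        by (auto simp: inj_on_def)
      ultimately show ?thesis unfolding Z_def
        by (subst card_Un_disjoint) (auto simp: card_image)
    qed
    ultimately show False using st by simp
  qed
  have "(Y v - fps_of_poly T * F v - fps_of_poly U * G v) $ m = 0" for m
  proof -
    have "pochhammer (z + (v + of_nat m) - of_nat t) t \<noteq> 0" if "z \<in> {a, b}" for z
    proof -
      have "z + v \<notin> \<int>" using that numerator_not_Ints[of v c a b] v ints by auto
      then have "z + v + of_nat m - of_nat t \<notin> \<int>"
        by (intro not_Ints_diff_of_nat not_Ints_add_of_nat)
      then have "z + (v + of_nat m) - of_nat t \<notin> \<int>" by (simp add: add_ac)
      then show ?thesis by (rule pochhammer_ne_0)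
    qed
    then have "D v m \<noteq> 0" unfolding D_def by simp
    then show ?thesis using eq[OF v, of m] \<open>\<Phi> = 0\<close> by simp
  qed
  then have "Y v - fps_of_poly T * F v - fps_of_poly U * G v = 0" by (intro fps_ext) simp
  then show ?thesis by (simp add: algebra_simps)
qed

lemma fps_mult_low_coeffs_eq_0:
  fixes A B :: "complex fps"
  assumes "\<And>k. k \<le> n \<Longrightarrow> A $ k = 0" "m \<le> n"
  shows "(B * A) $ m = 0"
  unfolding fps_mult_nth using assms by (intro sum.neutral) auto

lemma fps_trunc_nth_eq:
  fixes \<phi> :: "complex fps"
  assumes "\<And>k. d < k \<Longrightarrow> k \<le> n \<Longrightarrow> \<phi> $ k = 0" "k \<le> n"
  shows "(\<phi> - fps_of_poly (fps_trunc d \<phi>)) $ k = 0"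
  using assms by (cases "k \<le> d") (auto simp: fps_trunc_def coeff_truncate_fps)

lemma degree_fps_trunc: "degree (fps_trunc d \<phi>) \<le> d"
  using degree_truncate_fps[of "Suc d" \<phi>] by (simp add: fps_trunc_def)

text \<open>Solving for the coefficients by Cramer's rule gives products of the shifted series with
  \<open>F1\<close> and \<open>F2\<close>. Their coefficients from index \<open>t\<close> on vanish
  up to order \<open>r\<close> and \<open>r - 1\<close> respectively, so truncating them at
  \<open>t - 1\<close> leaves a relation valid up to order \<open>r\<close>; counting zeros makes it
  exact.\<close>

lemma hyp2F1_contiguity:
  assumes ints: "a \<notin> \<int>" "b \<notin> \<int>" "c \<notin> \<int>" "a - c \<notin> \<int>" "b - c \<notin> \<int>"
    and st: "s \<le> t" "t \<le> r" "r < s + t"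
  defines "T \<equiv> fps_of_poly ([:1, -1:] * truncF a b c s t r)"
    and "U \<equiv> fps_of_poly ([:0, wconst a b c:] * truncG a b c s t r)"
  shows "hyp2F1_fps (a - of_nat s) (b - of_nat t) (c - of_nat r) =
           T * hyp2F1_fps a b c + U * hyp2F1_fps a b (c + 1)"
    and "snd_shift a b c s t r = T * sndF a b c + U * sndG a b c"
proof -
  define Y where "Y v = (if v = 0 then hyp2F1_fps (a - of_nat s) (b - of_nat t) (c - of_nat r)
     else snd_shift a b c s t r)" for v :: complex
  define F where "F v = (if v = 0 then hyp2F1_fps a b c else sndF a b c)" for v :: complex
  define G where "G v = (if v = 0 then hyp2F1_fps a b (c + 1) else sndG a b c)" for v :: complex
  define F1 where "F1 = hyp2F1_fps (1 - a) (1 - b) (1 - c)"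
  define F2 where "F2 = hyp2F1_fps (1 - a) (1 - b) (2 - c)"
  define \<kappa> where "\<kappa> = fps_const (wconst a b c)"
  define D where "D = 1 - (fps_X :: complex fps)"
  define t' where "t' = fps_of_poly (truncF a b c s t r)"
  define u' where "u' = fps_of_poly (truncG a b c s t r)"
  have c0: "c \<noteq> 0" using ints by auto
  have t0: "t > 0" using st by simp
  have v0: "v = 0 \<or> v = - c" if "v \<in> {0, - c}" for v using that by auto
  have T: "T = D * t'"
    unfolding T_def t'_def D_def fps_of_poly_mult by (simp add: fps_of_poly_pCons)
  have U: "U = \<kappa> * fps_X * u'"
    unfolding U_def u'_def \<kappa>_def fps_of_poly_mult by (simp add: fps_of_poly_pCons mult_ac)
  have cr: "pochhammer (c - of_nat r) (Suc r) \<noteq> 0"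
    by (rule pochhammer_ne_0[OF not_Ints_diff_of_nat]) fact
  have lowT: "(Y 0 * F1 - t') $ k = 0" if "k \<le> r" for k
    unfolding t'_def truncF_def F1_def Y_def if_P[OF refl] using that t0 st
    by (intro fps_trunc_nth_eq[where n = r]) (auto intro!: hyp2F1_fps_mult_coeff_eq_0 ints)
  have lowU: "(Y 0 * F2 - u') $ k = 0" if "k < r" for k
  proof -
    have c': "c - 1 \<notin> \<int>" using not_Ints_diff_of_nat[OF ints(3), of 1] by simp
    have e: "c - of_nat r = (c - 1) - of_nat (r - 1)" "2 - c = 1 - (c - 1)"
      using st t0 by (auto simp: of_nat_diff)
    show ?thesis
      unfolding u'_def truncG_def F2_def Y_def if_P[OF refl]
    proof (rule fps_trunc_nth_eq[where n = "r - 1"])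
      fix k assume "t - 1 < k" "k \<le> r - 1"
      then show "(hyp2F1_fps (a - of_nat s) (b - of_nat t) (c - of_nat r) * hyp2F1_fps (1 - a) (1 - b) (2 - c)) $ k = 0"
        unfolding e using st by (intro hyp2F1_fps_mult_coeff_eq_0 ints c') auto
    qed (use that in auto)
  qed
  \<comment> \<open>The product with \<open>F2\<close> is controlled one order less far; the factor
    \<open>fps_X\<close> in \<open>U\<close> makes up for it.\<close>
  have lowXU: "(fps_X * (Y 0 * F2 - u')) $ k = 0" if "k \<le> r" for k
    using lowU[of "k - 1"] that by (cases k) auto
  have res: "Y v = T * F v + U * G v" if "v \<in> {0, - c}" for v
    unfolding T_def U_def
  proof (rule contig_eqI[OF ints st])
    show "v \<in> {0, - c}" by fact
    show "degree ([:1, - 1:] * truncF a b c s t r) \<le> t"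
    proof -
      have "degree [:1, - 1 :: complex:] + degree (truncF a b c s t r) \<le> 1 + (t - 1)"
        unfolding truncF_def by (intro add_mono degree_fps_trunc) simp
      then show ?thesis using t0 by (intro order.trans[OF degree_mult_le]) simp
    qed
    show "degree ([:0, wconst a b c:] * truncG a b c s t r) \<le> t"
    proof -
      have "degree ([:0, wconst a b c:]) \<le> 1" by simp
      then have "degree ([:0, wconst a b c:]) + degree (truncG a b c s t r) \<le> 1 + (t - 1)"
        unfolding truncG_def by (intro add_mono degree_fps_trunc)
      then show ?thesis using t0 by (intro order.trans[OF degree_mult_le]) simp
    qed
    show "G v $ m = sol_coeff a b c v m" if "v \<in> {0, - c}" for v m
      using v0[OF that] c0 by (auto simp: G_def sol_coeff_def hyp2F1_fps_nth sndG_def pochhammer_fact)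
    show "c * F v $ m = (c + (v + of_nat m)) * G v $ m" if "v \<in> {0, - c}" for v m
      using v0[OF that] c0 hyp2F1_fps_nth_plus1[OF ints(3), of m a b] sndF_nth[OF ints(3), of a b m]
      by (auto simp: F_def G_def)
    show "Y v $ m = contig_ratio a b c s t r (v + of_nat m) * G v $ m" if "v \<in> {0, - c}" for v m
    proof (cases "v = 0")
      case True
      have p: "pochhammer z (k + m) = pochhammer z k * pochhammer (z + of_nat k) m"
              "pochhammer z (m + k) = pochhammer z m * pochhammer (z + of_nat m) k" for z :: complex and k
        by (rule pochhammer_product')+
      have sh: "pochhammer (z - of_nat k) m = pochhammer (z - of_nat k) k * pochhammer z m / pochhammer (z + of_nat m - of_nat k) k"
        if "z \<notin> \<int>" for z :: complex and k
      proof -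
        have "pochhammer (z - of_nat k) m * pochhammer (z + of_nat m - of_nat k) k = pochhammer (z - of_nat k) k * pochhammer z m"
          using p[where z = "z - of_nat k" and k = k] by (simp only: add.commute[of k m] diff_add_eq[of z] diff_add_cancel)
        moreover have "pochhammer (z + of_nat m - of_nat k) k \<noteq> 0"
          by (intro pochhammer_ne_0 not_Ints_diff_of_nat not_Ints_add_of_nat that)
        ultimately show ?thesis by (simp add: field_simps)
      qed
      have c1: "c + 1 \<notin> \<int>" using not_Ints_add_of_nat[OF ints(3), of 1] by simp
      have "pochhammer (c - of_nat r) m * pochhammer (c - of_nat r + of_nat m) (Suc r) =
            pochhammer (c - of_nat r) (Suc r) * pochhammer (c + 1) m"
        using p[where z = "c - of_nat r" and k = "Suc r"]
        by (simp only: add.commute[of "Suc r" m]) (simp add: algebra_simps del: pochhammer_Suc)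
      moreover have "pochhammer (c - of_nat r) m \<noteq> 0" "pochhammer (c + 1) m \<noteq> 0"
        by (intro pochhammer_ne_0 not_Ints_diff_of_nat c1 ints)+
      ultimately have gam: "1 / pochhammer (c - of_nat r) m =
          pochhammer (c - of_nat r + of_nat m) (Suc r) / (pochhammer (c - of_nat r) (Suc r) * pochhammer (c + 1) m)"
        using cr by (simp add: field_simps del: pochhammer_Suc)
      have "Y v $ m = pochhammer (a - of_nat s) m * pochhammer (b - of_nat t) m * (1 / pochhammer (c - of_nat r) m) / fact m"
        using True by (simp add: Y_def hyp2F1_fps_nth)
      also have "\<dots> = contig_ratio a b c s t r (of_nat m) * G v $ m"
        unfolding gam sh[OF ints(1)] sh[OF ints(2)] contig_ratio_def
        using True by (simp add: G_def hyp2F1_fps_nth mult_ac del: pochhammer_Suc)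
      finally show ?thesis using True by simp
    next
      case False
      then show ?thesis using v0[OF that] by (simp add: Y_def G_def snd_shift_def)
    qed
    show "(Y v - fps_of_poly ([:1, - 1:] * truncF a b c s t r) * F v -
            fps_of_poly ([:0, wconst a b c:] * truncG a b c s t r) * G v) $ m = 0"
      if "v \<in> {0, - c}" "m \<le> r" for v m
      unfolding T_def[symmetric] U_def[symmetric]
    proof (cases "v = 0")
      case True
      \<comment> \<open>Multiplying \<open>Y 0\<close> by this expression for 1 splits the
        difference into multiples of the two remainders, both of which vanish up to order
        \<open>r\<close>.\<close>
      have W: "D * F 0 * F1 + \<kappa> * fps_X * G 0 * F2 = 1"
        using hyp2F1_fps_wronskian[OF ints(3), of a b]
        by (simp add: D_def F_def F1_def F2_def G_def \<kappa>_def wconst_def)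
      have "Y 0 - T * F 0 - U * G 0 = Y 0 * (D * F 0 * F1 + \<kappa> * fps_X * G 0 * F2) - T * F 0 - U * G 0"
        unfolding W by simp
      also have "\<dots> = D * F 0 * (Y 0 * F1 - t') + \<kappa> * G 0 * (fps_X * (Y 0 * F2 - u'))"
        unfolding T U by (simp add: algebra_simps)
      finally show "(Y v - T * F v - U * G v) $ m = 0"
        using fps_mult_low_coeffs_eq_0[OF lowT \<open>m \<le> r\<close>, of "D * F 0"]
              fps_mult_low_coeffs_eq_0[OF lowXU \<open>m \<le> r\<close>, of "\<kappa> * G 0"] True by simp
    next
      case False
      define B where "B = one_minus_X_powr (c - a - b)"
      have v: "F v = - \<kappa> * fps_X * B * F2" "G v = D * B * F1"
        using False sndF_euler[OF ints(3), of a b] sndG_euler[OF ints(3), of a b]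
        by (simp_all add: F_def G_def \<kappa>_def B_def F1_def F2_def D_def)
      \<comment> \<open>The terms with \<open>Y 0 * F1 * F2\<close> added on the right cancel, so
        that again only the two remainders are left.\<close>
      have "T * F v + U * G v =
         \<kappa> * D * B * F2 * fps_X * (Y 0 * F1 - t') - \<kappa> * D * B * F1 * (fps_X * (Y 0 * F2 - u'))"
        unfolding T U v by (simp add: algebra_simps)
      then have "(T * F v + U * G v) $ m = 0"
        using fps_mult_low_coeffs_eq_0[OF lowT \<open>m \<le> r\<close>, of "\<kappa> * D * B * F2 * fps_X"]
              fps_mult_low_coeffs_eq_0[OF lowXU \<open>m \<le> r\<close>, of "\<kappa> * D * B * F1"] by simp
      moreover have "Y v $ m = 0"
      proof -
        have "pochhammer (of_nat m - of_nat r :: complex) (Suc r) = 0"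
          using that by (auto simp: pochhammer_eq_0_iff of_nat_diff intro!: exI[of _ "r - m"])
        then show ?thesis
          using False by (simp add: Y_def snd_shift_def contig_ratio_def algebra_simps del: pochhammer_Suc)
      qed
      ultimately show "(Y v - T * F v - U * G v) $ m = 0" by (simp add: algebra_simps)
    qed
  qed
  show "hyp2F1_fps (a - of_nat s) (b - of_nat t) (c - of_nat r) =
           T * hyp2F1_fps a b c + U * hyp2F1_fps a b (c + 1)"
    using res[of 0] by (simp add: Y_def F_def G_def)
  show "snd_shift a b c s t r = T * sndF a b c + U * sndG a b c"
    using res[of "- c"] c0 by (simp add: Y_def F_def G_def)
qed

section \<open>The determinant of the contiguity matrix\<close>

text \<open>The constant in the action of the shift on the second solution. Its numerator is where
  the factors of the divisibility statement for \<open>P\<close> originate.\<close>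

definition contig_det_const ::
  "complex \<Rightarrow> complex \<Rightarrow> complex \<Rightarrow> nat \<Rightarrow> nat \<Rightarrow> nat \<Rightarrow> complex" where
  "contig_det_const a b c s t r =
     pochhammer (a - of_nat s) s * pochhammer (b - of_nat t) t *
     pochhammer (a - c) (r - s) * pochhammer (b - c) (r - t) /
     (pochhammer (c - of_nat r + 1) r * pochhammer (1 - c) r)"

text \<open>The shift is by \<open>r - 1\<close> because the lower parameter
  \<open>(c - r) + 1\<close> is the one that \<open>sndG\<close> accompanies. The power
  \<open>fps_X ^ r\<close> accounts for the change of exponent from \<open>- c\<close> to
  \<open>- (c - r)\<close>.\<close>

lemma snd_shift_eq_sndG:
  assumes ints: "a \<notin> \<int>" "b \<notin> \<int>" "c \<notin> \<int>" "a - c \<notin> \<int>" "b - c \<notin> \<int>"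
    and st: "s \<le> r" "t \<le> r" "0 < r"
  shows "snd_shift a b c s t (r - 1) =
    fps_const (contig_det_const a b c s t r) * fps_X ^ r * sndG (a - of_nat s) (b - of_nat t) (c - of_nat r)"
proof (rule fps_ext)
  fix m
  have r: "Suc (r - 1) = r" "c - of_nat (r - 1) = c - of_nat r + 1" using st by (simp_all add: of_nat_diff)
  show "snd_shift a b c s t (r - 1) $ m =
    (fps_const (contig_det_const a b c s t r) * fps_X ^ r * sndG (a - of_nat s) (b - of_nat t) (c - of_nat r)) $ m"
  proof (cases "m < r")
    case True
    have "pochhammer (c - of_nat r + 1 + (of_nat m - c)) r = 0"
      using pochhammer_diff_of_nat_eq_0[OF True] by (simp add: algebra_simps)
    then show ?thesis
      using True by (simp add: snd_shift_def contig_ratio_def r mult.assoc fps_X_power_mult_nth del: pochhammer_Suc)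
  next
    case False
    then obtain l where m: "m = r + l" by (metis le_iff_add not_less)
    have split: "pochhammer (z - c) (r + l) =
        pochhammer (z - c) (r - k) * pochhammer (z - of_nat k - (c - of_nat r)) l * pochhammer (z + (of_nat m - c) - of_nat k) k"
      if "k \<le> r" for z k
    proof -
      have "pochhammer (z - c) (r + l) = pochhammer (z - c) (r - k + (l + k))" using that by simp
      also have "\<dots> = pochhammer (z - c) (r - k) * pochhammer (z - c + of_nat (r - k)) (l + k)"
        by (rule pochhammer_product')
      also have "pochhammer (z - c + of_nat (r - k)) (l + k) =
         pochhammer (z - c + of_nat (r - k)) l * pochhammer (z - c + of_nat (r - k) + of_nat l) k"
        by (rule pochhammer_product')
      finally show ?thesis using that by (simp add: m of_nat_diff algebra_simps)
    qed
    have c': "pochhammer (1 - c) (r + l) = pochhammer (1 - c) r * pochhammer (1 - (c - of_nat r)) l"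
      by (subst pochhammer_product') (simp add: algebra_simps)
    have f: "pochhammer (1 + of_nat l :: complex) r = fact (r + l) / fact l"
    proof -
      have "pochhammer (1 :: complex) (l + r) = pochhammer 1 l * pochhammer (1 + of_nat l) r"
        by (rule pochhammer_product')
      then show ?thesis by (simp add: pochhammer_fact[symmetric] add.commute field_simps)
    qed
    have z: "pochhammer (z + (of_nat m - c) - of_nat k) k \<noteq> 0" if "z - c \<notin> \<int>" for z k
    proof -
      have "(z - c) + of_nat m - of_nat k \<notin> \<int>"
        by (intro not_Ints_diff_of_nat not_Ints_add_of_nat that)
      then show ?thesis by (intro pochhammer_ne_0) (simp add: algebra_simps)
    qed
    have e: "c - of_nat r + 1 + (of_nat m - c) = 1 + of_nat l" by (simp add: m)
    have "snd_shift a b c s t (r - 1) $ m =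
       pochhammer (a - of_nat s) s * pochhammer (b - of_nat t) t * (fact (r + l) / fact l) /
       (pochhammer (a + (of_nat m - c) - of_nat s) s * pochhammer (b + (of_nat m - c) - of_nat t) t * pochhammer (c - of_nat r + 1) r) *
       (pochhammer (a - c) (r + l) * pochhammer (b - c) (r + l) / (pochhammer (1 - c) (r + l) * fact (r + l)))"
      unfolding snd_shift_def fps_nth_Abs_fps contig_ratio_def r e f sndG_def hyp2F1_fps_nth m[symmetric] by simp
    also have "\<dots> = contig_det_const a b c s t r * sndG (a - of_nat s) (b - of_nat t) (c - of_nat r) $ l"
      unfolding split[OF st(1), of a] split[OF st(2), of b] c' contig_det_const_def sndG_def hyp2F1_fps_nth
      using z[OF ints(4)] z[OF ints(5)] by (simp add: mult_ac)
    also have "\<dots> = (fps_const (contig_det_const a b c s t r) * fps_X ^ r * sndG (a - of_nat s) (b - of_nat t) (c - of_nat r)) $ m"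
      by (simp add: m mult.assoc fps_X_power_mult_nth)
    finally show ?thesis .
  qed
qed

lemma snd_shift_eq_sndF:
  assumes ints: "a \<notin> \<int>" "b \<notin> \<int>" "c \<notin> \<int>" "a - c \<notin> \<int>" "b - c \<notin> \<int>"
    and st: "s \<le> r" "t \<le> r" "0 < r"
  shows "snd_shift a b c s t r =
    fps_const (contig_det_const a b c s t r) * fps_X ^ r * sndF (a - of_nat s) (b - of_nat t) (c - of_nat r)"
proof (rule fps_ext)
  fix m
  define c' where "c' = c - of_nat r"
  have c': "c' \<notin> \<int>" unfolding c'_def by (rule not_Ints_diff_of_nat) fact
  then have c0: "c' \<noteq> 0" by auto
  have p: "pochhammer (c' + z) (Suc r) = (c' + z) * pochhammer (c - of_nat (r - 1) + z) (Suc (r - 1))" for z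
    unfolding pochhammer_rec[of _ r] using st by (simp add: c'_def of_nat_diff algebra_simps del: pochhammer_Suc)
  have "snd_shift a b c s t r $ m = (c' + (of_nat m - c)) / c' * snd_shift a b c s t (r - 1) $ m"
    using p[of "of_nat m - c"] p[of 0] unfolding snd_shift_def fps_nth_Abs_fps contig_ratio_def c'_def[symmetric]
    by (simp add: mult_ac del: pochhammer_Suc)
  also have "c' + (of_nat m - c) = of_nat m - of_nat r" by (simp add: c'_def)
  also have "(of_nat m - of_nat r) / c' * snd_shift a b c s t (r - 1) $ m =
     (fps_const (contig_det_const a b c s t r) * fps_X ^ r * sndF (a - of_nat s) (b - of_nat t) c') $ m"
  proof (cases "m < r")
    case True
    then show ?thesis unfolding snd_shift_eq_sndG[OF assms] by (simp add: mult.assoc fps_X_power_mult_nth)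
  next
    case False
    then obtain l where m: "m = r + l" by (metis le_iff_add not_less)
    show ?thesis
      unfolding snd_shift_eq_sndG[OF assms] c'_def[symmetric] m
      using sndF_nth[OF c', of "a - of_nat s" "b - of_nat t" l] c0
      by (simp add: mult.assoc fps_X_power_mult_nth field_simps)
  qed
  finally show "snd_shift a b c s t r $ m =
    (fps_const (contig_det_const a b c s t r) * fps_X ^ r * sndF (a - of_nat s) (b - of_nat t) (c - of_nat r)) $ m"
    by (simp add: c'_def)
qed

text \<open>The relations for the shifts \<open>r\<close> and \<open>r - 1\<close> form a matrix
  that maps one fundamental matrix to another. Its determinant is therefore a quotient of two
  Wronskians, both powers of \<open>1 - X\<close>, whose exponents differ by
  \<open>s + t - r\<close>.\<close>

theorem hyp2F1_contiguity_det:
  assumes ints: "a \<notin> \<int>" "b \<notin> \<int>" "c \<notin> \<int>" "a - c \<notin> \<int>" "b - c \<notin> \<int>"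
    and st: "s \<le> t" "t < r" "r < s + t"
  defines "X1 \<equiv> [:0, 1:] :: complex poly"
  shows "([:1, -1:] * truncF a b c s t r) * ([:0, wconst a b c:] * truncG a b c s t (r - 1)) -
         ([:0, wconst a b c:] * truncG a b c s t r) * ([:1, -1:] * truncF a b c s t (r - 1)) =
         smult (contig_det_const a b c s t r) (X1 ^ r * [:1, -1:] ^ (s + t - r))"
proof -
  define A where "A = [:1, -1:] * truncF a b c s t r"
  define B where "B = [:0, wconst a b c:] * truncG a b c s t r"
  define C where "C = [:1, -1:] * truncF a b c s t (r - 1)"
  define D where "D = [:0, wconst a b c:] * truncG a b c s t (r - 1)"
  define a' where "a' = a - of_nat s"
  define b' where "b' = b - of_nat t"
  define c' where "c' = c - of_nat r"
  define K where "K = fps_const (contig_det_const a b c s t r)"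
  have c': "c' \<notin> \<int>" unfolding c'_def by (rule not_Ints_diff_of_nat) fact
  have st': "t \<le> r" "s \<le> t" "t \<le> r - 1" "r - 1 < s + t" "s \<le> r" "0 < r" using st by auto
  have r1: "c - of_nat (r - 1) = c' + 1" using st' by (simp add: c'_def of_nat_diff)
  have 1: "hyp2F1_fps a' b' c' = fps_of_poly A * hyp2F1_fps a b c + fps_of_poly B * hyp2F1_fps a b (c + 1)"
    unfolding A_def B_def a'_def b'_def c'_def by (rule hyp2F1_contiguity[OF ints st'(2,1) st(3)])
  have 2: "K * fps_X ^ r * sndF a' b' c' = fps_of_poly A * sndF a b c + fps_of_poly B * sndG a b c"
    unfolding A_def B_def a'_def b'_def c'_def K_def snd_shift_eq_sndF[OF ints st'(5,1,6), symmetric]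
    by (rule hyp2F1_contiguity[OF ints st'(2,1) st(3)])
  have 3: "hyp2F1_fps a' b' (c' + 1) = fps_of_poly C * hyp2F1_fps a b c + fps_of_poly D * hyp2F1_fps a b (c + 1)"
    unfolding C_def D_def a'_def b'_def r1[symmetric] by (rule hyp2F1_contiguity[OF ints st'(2,3,4)])
  have 4: "K * fps_X ^ r * sndG a' b' c' = fps_of_poly C * sndF a b c + fps_of_poly D * sndG a b c"
    unfolding C_def D_def a'_def b'_def c'_def K_def snd_shift_eq_sndG[OF ints st'(5,1,6), symmetric]
    by (rule hyp2F1_contiguity[OF ints st'(2,3,4)])
  define P where "P = one_minus_X_powr (c - a - b)"
  have e: "c' - a' - b' = (c - a - b) + of_nat (s + t - r)"
    using st by (simp add: a'_def b'_def c'_def of_nat_diff)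
  have "(fps_of_poly A * fps_of_poly D - fps_of_poly B * fps_of_poly C) * P =
     (fps_of_poly A * fps_of_poly D - fps_of_poly B * fps_of_poly C) *
     (hyp2F1_fps a b c * sndG a b c - sndF a b c * hyp2F1_fps a b (c + 1))"
    unfolding P_def wronskian[OF ints(3)] ..
  also have "\<dots> = (fps_of_poly A * hyp2F1_fps a b c + fps_of_poly B * hyp2F1_fps a b (c + 1)) *
       (fps_of_poly C * sndF a b c + fps_of_poly D * sndG a b c) -
     (fps_of_poly A * sndF a b c + fps_of_poly B * sndG a b c) *
       (fps_of_poly C * hyp2F1_fps a b c + fps_of_poly D * hyp2F1_fps a b (c + 1))"
    by (simp add: algebra_simps)
  also have "\<dots> = K * fps_X ^ r * (hyp2F1_fps a' b' c' * sndG a' b' c' - sndF a' b' c' * hyp2F1_fps a' b' (c' + 1))"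
    unfolding 1[symmetric] 2[symmetric] 3[symmetric] 4[symmetric] by (simp add: algebra_simps)
  also have "\<dots> = K * fps_X ^ r * (1 - fps_X) ^ (s + t - r) * P"
    unfolding wronskian[OF c'] e one_minus_X_powr_plus P_def by (simp add: mult_ac)
  finally have "fps_of_poly A * fps_of_poly D - fps_of_poly B * fps_of_poly C = K * fps_X ^ r * (1 - fps_X) ^ (s + t - r)"
  proof -
    assume *: "(fps_of_poly A * fps_of_poly D - fps_of_poly B * fps_of_poly C) * P =
       K * fps_X ^ r * (1 - fps_X) ^ (s + t - r) * P"
    have "P \<noteq> 0" unfolding P_def by (metis fps_zero_nth one_minus_X_powr_0 zero_neq_one)
    with * show ?thesis by simp
  qed
  also have "\<dots> = fps_of_poly (smult (contig_det_const a b c s t r) (X1 ^ r * [:1, -1:] ^ (s + t - r)))"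
    by (simp add: K_def X1_def fps_of_poly_smult fps_of_poly_mult fps_of_poly_power fps_of_poly_pCons mult.assoc)
  finally have "fps_of_poly (A * D - B * C) = fps_of_poly (smult (contig_det_const a b c s t r) (X1 ^ r * [:1, -1:] ^ (s + t - r)))"
    by (simp add: fps_of_poly_diff fps_of_poly_mult)
  then show ?thesis unfolding fps_of_poly_eq_iff A_def B_def C_def D_def .
qed

section \<open>The regularised hypergeometric function\<close>

text \<open>Terms of Olver's regularised hypergeometric series. Writing
  \<open>rGamma (c + n)\<close> instead of dividing by \<open>pochhammer c n\<close> makes each of
  them entire in all three parameters.\<close>

definition hreg_term :: "complex \<Rightarrow> complex \<Rightarrow> complex \<Rightarrow> complex \<Rightarrow> nat \<Rightarrow> complex" where
  "hreg_term x a b c n = pochhammer a n * pochhammer b n * rGamma (c + of_nat n) / fact n * x ^ n"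

definition hreg :: "complex \<Rightarrow> complex \<Rightarrow> complex \<Rightarrow> complex \<Rightarrow> complex" where
  "hreg x a b c = (\<Sum>n. hreg_term x a b c n)"

lemma hreg_term_Suc:
  "hreg_term x a b c (Suc n) * ((c + of_nat n) * of_nat (Suc n)) =
   hreg_term x a b c n * ((a + of_nat n) * (b + of_nat n) * x)"
proof -
  have "rGamma (c + of_nat n) = (c + of_nat n) * rGamma (c + of_nat (Suc n))"
    using rGamma_plus1[of "c + of_nat n"] by (simp add: add_ac)
  then show ?thesis
    by (simp add: hreg_term_def pochhammer_Suc divide_simps del: of_nat_Suc)
qed

text \<open>The threshold depends on the parameters only through their bound \<open>K\<close>; the
  Weierstrass test behind \<open>hreg_holomorphic\<close> requires this uniformity.\<close>

lemma hreg_term_ratio_bound: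
  assumes "norm x < \<theta>" "\<theta> < 1" "0 \<le> K"
  obtains N where "\<And>n a b c. n \<ge> N \<Longrightarrow> norm a \<le> K \<Longrightarrow> norm b \<le> K \<Longrightarrow> norm c \<le> K \<Longrightarrow>
    norm (hreg_term x a b c (Suc n)) \<le> \<theta> * norm (hreg_term x a b c n)"
proof -
  define y where "y = norm x"
  have "((\<lambda>n. y * (real n + K) ^ 2 / ((real n - K) * (real n + 1))) \<longlongrightarrow> y) at_top"
    by real_asymp
  moreover have "y < \<theta>" using assms by (simp add: y_def)
  ultimately have "\<forall>\<^sub>F n in at_top. y * (real n + K) ^ 2 / ((real n - K) * (real n + 1)) < \<theta>"
    by (rule order_tendstoD)
  moreover have "\<forall>\<^sub>F n in at_top. real n > K" by real_asymp
  ultimately have "\<forall>\<^sub>F n in at_top. real n > K \<and> y * (real n + K) ^ 2 / ((real n - K) * (real n + 1)) < \<theta>"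
    by eventually_elim simp
  then obtain N where N: "\<And>n. n \<ge> N \<Longrightarrow> real n > K \<and> y * (real n + K) ^ 2 / ((real n - K) * (real n + 1)) < \<theta>"
    by (auto simp: eventually_at_top_linorder)
  have "norm (hreg_term x a b c (Suc n)) \<le> \<theta> * norm (hreg_term x a b c n)"
    if n: "n \<ge> N" and bd: "norm a \<le> K" "norm b \<le> K" "norm c \<le> K" for n a b c
  proof -
    have nK: "real n > K" using N[OF n] by simp
    have "y * (real n + K) ^ 2 / ((real n - K) * (real n + 1)) < \<theta>" using N[OF n] by blast
    then have y: "y * (real n + K) ^ 2 \<le> \<theta> * ((real n - K) * (real n + 1))"
      using nK assms(3) by (simp add: divide_less_eq)
    have 1: "norm (a + of_nat n) \<le> real n + K" "norm (b + of_nat n) \<le> real n + K"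
      using norm_triangle_ineq[of a "of_nat n"] norm_triangle_ineq[of b "of_nat n"] bd by simp_all
    have 2: "norm (c + of_nat n) \<ge> real n - K"
      using norm_triangle_ineq4[of "c + of_nat n" c] bd by simp
    have "norm (hreg_term x a b c (Suc n)) * ((real n - K) * (real n + 1)) \<le>
          norm (hreg_term x a b c (Suc n)) * (norm (c + of_nat n) * (real n + 1))"
      using 2 nK by (intro mult_left_mono mult_right_mono) auto
    also have "\<dots> = norm (hreg_term x a b c (Suc n) * ((c + of_nat n) * of_nat (Suc n)))"
      unfolding norm_mult norm_of_nat by simp
    also have "\<dots> = norm (hreg_term x a b c n) * (norm (a + of_nat n) * norm (b + of_nat n) * y)"
      unfolding hreg_term_Suc norm_mult y_def ..
    also have "\<dots> \<le> norm (hreg_term x a b c n) * ((real n + K) * (real n + K) * y)"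
      using 1 nK assms(3) by (intro mult_left_mono mult_right_mono mult_mono) (auto simp: y_def)
    also have "\<dots> = norm (hreg_term x a b c n) * (y * (real n + K) ^ 2)"
      by (simp add: power2_eq_square mult_ac)
    also have "\<dots> \<le> norm (hreg_term x a b c n) * (\<theta> * ((real n - K) * (real n + 1)))"
      using y by (intro mult_left_mono) auto
    finally have "norm (hreg_term x a b c (Suc n)) * ((real n - K) * (real n + 1)) \<le>
       (\<theta> * norm (hreg_term x a b c n)) * ((real n - K) * (real n + 1))" by (simp add: mult_ac)
    then show ?thesis using nK assms(3) by (simp add: mult_le_cancel_right)
  qed
  then show ?thesis by (rule that)
qed

lemma hreg_term_geometric_bound:
  assumes "norm x < \<theta>" "\<theta> < 1" "0 \<le> K"
  obtains N where "\<And>n a b c. n \<ge> N \<Longrightarrow> norm a \<le> K \<Longrightarrow> norm b \<le> K \<Longrightarrow> norm c \<le> K \<Longrightarrow>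
    norm (hreg_term x a b c n) \<le> norm (hreg_term x a b c N) * \<theta> ^ (n - N)"
proof -
  have th: "\<theta> > 0" using assms(1) norm_ge_zero[of x] by linarith
  obtain N where N: "\<And>n a b c. n \<ge> N \<Longrightarrow> norm a \<le> K \<Longrightarrow> norm b \<le> K \<Longrightarrow> norm c \<le> K \<Longrightarrow>
    norm (hreg_term x a b c (Suc n)) \<le> \<theta> * norm (hreg_term x a b c n)"
    using hreg_term_ratio_bound[OF assms] by blast
  have "norm (hreg_term x a b c n) \<le> norm (hreg_term x a b c N) * \<theta> ^ (n - N)"
    if "n \<ge> N" and bd: "norm a \<le> K" "norm b \<le> K" "norm c \<le> K" for n a b c
    using that(1)
  proof (induction n rule: dec_induct)
    case (step n)
    have "norm (hreg_term x a b c (Suc n)) \<le> \<theta> * norm (hreg_term x a b c n)"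
      using step(1) bd by (intro N) auto
    also have "\<dots> \<le> \<theta> * (norm (hreg_term x a b c N) * \<theta> ^ (n - N))"
      using step th by (intro mult_left_mono) auto
    also have "\<dots> = norm (hreg_term x a b c N) * \<theta> ^ (Suc n - N)"
      using step by (simp add: Suc_diff_le)
    finally show ?case .
  qed simp
  then show ?thesis by (rule that)
qed

lemma summable_hreg_term:
  assumes "norm x < 1"
  shows "summable (hreg_term x a b c)"
proof -
  obtain \<theta> where \<theta>: "norm x < \<theta>" "\<theta> < 1" using assms dense by blast
  then have \<theta>0: "0 < \<theta>" using norm_ge_zero[of x] by linarith
  define K where "K = max (norm a) (max (norm b) (norm c))"
  have "0 \<le> K" by (simp add: K_def le_max_iff_disj)
  then obtain N where N: "\<And>n a b c. n \<ge> N \<Longrightarrow> norm a \<le> K \<Longrightarrow> norm b \<le> K \<Longrightarrow> norm c \<le> K \<Longrightarrow>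
    norm (hreg_term x a b c n) \<le> norm (hreg_term x a b c N) * \<theta> ^ (n - N)"
    using hreg_term_geometric_bound[OF \<theta>] by blast
  have sm: "summable (\<lambda>n. norm (hreg_term x a b c N) / \<theta> ^ N * \<theta> ^ n)"
    using \<theta> \<theta>0 by (intro summable_mult summable_geometric) auto
  have le: "norm (hreg_term x a b c n) \<le> norm (hreg_term x a b c N) / \<theta> ^ N * \<theta> ^ n" if "n \<ge> N" for n
    using N[OF that, of a b c] that \<theta>0 by (simp add: K_def le_max_iff_disj power_diff)
  show ?thesis
    by (rule summable_comparison_test[OF _ sm]) (use le in blast)
qed

lemma hreg_holomorphic:
  assumes x: "norm x < 1"
    and hol: "A holomorphic_on UNIV" "B holomorphic_on UNIV" "C holomorphic_on UNIV"
  shows "(\<lambda>w. hreg x (A w) (B w) (C w)) holomorphic_on UNIV"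
proof (rule holomorphic_uniform_sequence[where f = "\<lambda>N w. \<Sum>n<N. hreg_term x (A w) (B w) (C w) n"])
  have term_hol: "(\<lambda>w. hreg_term x (A w) (B w) (C w) n) holomorphic_on UNIV" for n
    unfolding hreg_term_def pochhammer_prod
    by (intro holomorphic_intros hol) auto
  then show "(\<lambda>w. \<Sum>n<N. hreg_term x (A w) (B w) (C w) n) holomorphic_on UNIV" for N
    by (intro holomorphic_intros)
  fix z :: complex
  obtain \<theta> where \<theta>: "norm x < \<theta>" "\<theta> < 1" using assms dense by blast
  then have \<theta>0: "0 < \<theta>" using norm_ge_zero[of x] by linarith
  have bd: "\<exists>K. \<forall>w\<in>cball z 1. norm (g w) \<le> K" if "g holomorphic_on UNIV" for g :: "complex \<Rightarrow> complex"
  proof -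
    have "continuous_on (cball z 1) g"
      using that by (meson holomorphic_on_imp_continuous_on holomorphic_on_subset subset_UNIV)
    then have "compact (g ` cball z 1)" by (intro compact_continuous_image) auto
    then have "bounded (g ` cball z 1)" by (rule compact_imp_bounded)
    then show ?thesis by (auto simp: bounded_iff)
  qed
  obtain KA KB KC where K: "\<forall>w\<in>cball z 1. norm (A w) \<le> KA" "\<forall>w\<in>cball z 1. norm (B w) \<le> KB"
      "\<forall>w\<in>cball z 1. norm (C w) \<le> KC"
    using bd[OF hol(1)] bd[OF hol(2)] bd[OF hol(3)] by blast
  define K where "K = max 0 (max KA (max KB KC))"
  have K': "norm (A w) \<le> K" "norm (B w) \<le> K" "norm (C w) \<le> K" if "w \<in> cball z 1" for w
    using K that by (auto simp: K_def le_max_iff_disj)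
  have "0 \<le> K" by (simp add: K_def)
  then obtain N where N: "\<And>n a b c. n \<ge> N \<Longrightarrow> norm a \<le> K \<Longrightarrow> norm b \<le> K \<Longrightarrow> norm c \<le> K \<Longrightarrow>
    norm (hreg_term x a b c n) \<le> norm (hreg_term x a b c N) * \<theta> ^ (n - N)"
    using hreg_term_geometric_bound[OF \<theta>] by blast
  obtain M where M: "\<forall>w\<in>cball z 1. norm (hreg_term x (A w) (B w) (C w) N) \<le> M"
    using bd[OF term_hol] by blast
  have "uniform_limit (cball z 1) (\<lambda>N w. \<Sum>n<N. hreg_term x (A w) (B w) (C w) n)
          (\<lambda>w. \<Sum>n. hreg_term x (A w) (B w) (C w) n) sequentially"
  proof (rule Weierstrass_m_test_ev)
    show "summable (\<lambda>n. M / \<theta> ^ N * \<theta> ^ n)"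
      using \<theta> \<theta>0 by (intro summable_mult summable_geometric) auto
    show "\<forall>\<^sub>F n in sequentially. \<forall>w\<in>cball z 1. norm (hreg_term x (A w) (B w) (C w) n) \<le> M / \<theta> ^ N * \<theta> ^ n"
      using eventually_ge_at_top[of N]
    proof (eventually_elim, intro ballI)
      fix n w assume n: "N \<le> n" and w: "w \<in> cball z 1"
      have "norm (hreg_term x (A w) (B w) (C w) n) \<le> norm (hreg_term x (A w) (B w) (C w) N) * \<theta> ^ (n - N)"
        by (intro N n K' w)
      also have "\<dots> \<le> M * \<theta> ^ (n - N)"
        using M w \<theta>0 by (intro mult_right_mono) auto
      also have "\<dots> = M / \<theta> ^ N * \<theta> ^ n" using n \<theta>0 by (simp add: power_diff)
      finally show "norm (hreg_term x (A w) (B w) (C w) n) \<le> M / \<theta> ^ N * \<theta> ^ n" .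
    qed
  qed
  then show "\<exists>d>0. cball z d \<subseteq> UNIV \<and> uniform_limit (cball z d)
      (\<lambda>N w. \<Sum>n<N. hreg_term x (A w) (B w) (C w) n) (\<lambda>w. hreg x (A w) (B w) (C w)) sequentially"
    unfolding hreg_def by (intro exI[of _ 1]) auto
qed auto

lemma hreg_eq_hyp2F1:
  assumes "norm x < 1" "c \<notin> \<int>\<^sub>\<le>\<^sub>0"
  shows "hreg x a b c = rGamma c * hyp2F1 a b c x"
    and "summable (\<lambda>n. hyp2F1_fps a b c $ n * x ^ n)"
proof -
  have rG: "rGamma c \<noteq> 0" using assms by (simp add: rGamma_eq_zero_iff)
  have eq: "hreg_term x a b c n = rGamma c * (hyp2F1_fps a b c $ n * x ^ n)" for n
  proof -
    have "pochhammer c n \<noteq> 0"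
      using assms(2) by (auto simp: pochhammer_eq_0_iff)
    then show ?thesis
      using pochhammer_rGamma[of c n] by (simp add: hreg_term_def hyp2F1_fps_nth)
  qed
  have "summable (\<lambda>n. rGamma c * (hyp2F1_fps a b c $ n * x ^ n))"
    using summable_hreg_term[OF assms(1), of a b c] unfolding eq .
  then show sm: "summable (\<lambda>n. hyp2F1_fps a b c $ n * x ^ n)"
    using rG by (simp add: summable_cmult_iff)
  show "hreg x a b c = rGamma c * hyp2F1 a b c x"
    unfolding hreg_def eq hyp2F1_def eval_fps_def using sm by (rule suminf_mult)
qed

lemma fps_conv_radius_hyp2F1_fps:
  assumes "c \<notin> \<int>\<^sub>\<le>\<^sub>0"
  shows "fps_conv_radius (hyp2F1_fps a b c) \<ge> 1"
  unfolding fps_conv_radius_def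
proof (rule conv_radius_geI_ex)
  fix r :: real assume r: "0 < r" "ereal r < 1"
  then have "r < 1" by simp
  with r have "summable (\<lambda>n. hyp2F1_fps a b c $ n * (of_real r) ^ n)"
    by (intro hreg_eq_hyp2F1(2) assms) auto
  then show "\<exists>z. norm z = r \<and> summable (\<lambda>n. hyp2F1_fps a b c $ n * z ^ n)"
    using r by (intro exI[of _ "of_real r"]) auto
qed

lemma one_minus_X_powr_sums:
  assumes "norm x < 1"
  shows "(\<lambda>n. one_minus_X_powr e $ n * x ^ n) sums (1 - x) powr e"
proof -
  have "(\<lambda>n. (e gchoose n) * (- x) ^ n) sums (1 + (- x)) powr e"
    using assms by (intro gen_binomial_complex) simp
  moreover have "(e gchoose n) * (- x) ^ n = one_minus_X_powr e $ n * x ^ n" for n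
  proof -
    have "(- 1) ^ n * (- x) ^ n = x ^ n" by (simp flip: power_mult_distrib)
    then show ?thesis by (simp add: one_minus_X_powr_def gbinomial_pochhammer mult.commute mult.left_commute)
  qed
  ultimately show ?thesis by simp
qed

lemma fps_conv_radius_one_minus_X_powr: "fps_conv_radius (one_minus_X_powr e) \<ge> 1"
  unfolding fps_conv_radius_def
proof (rule conv_radius_geI_ex)
  fix r :: real assume r: "0 < r" "ereal r < 1"
  then have "r < 1" by simp
  with r have "summable (\<lambda>n. one_minus_X_powr e $ n * (of_real r) ^ n)"
    by (intro sums_summable[OF one_minus_X_powr_sums]) auto
  then show "\<exists>z. norm z = r \<and> summable (\<lambda>n. one_minus_X_powr e $ n * z ^ n)"
    using r by (intro exI[of _ "of_real r"]) auto
qed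

lemma not_Ints_imp_not_nonpos_Ints: "(c :: complex) \<notin> \<int> \<Longrightarrow> c \<notin> \<int>\<^sub>\<le>\<^sub>0"
  using nonpos_Ints_subset_Ints by blast

lemma hreg_euler:
  assumes x: "norm x < 1" and c: "c \<notin> \<int>"
  shows "hreg x a b c = (1 - x) powr (c - a - b) * hreg x (c - a) (c - b) c"
proof -
  note c' = not_Ints_imp_not_nonpos_Ints[OF c]
  have lt: "ereal (norm x) < fps_conv_radius (hyp2F1_fps u v c)"
    "ereal (norm x) < fps_conv_radius (one_minus_X_powr e)" for u v e
    using x less_le_trans[OF _ fps_conv_radius_hyp2F1_fps[OF c']]
      less_le_trans[OF _ fps_conv_radius_one_minus_X_powr] by auto
  have "eval_fps (one_minus_X_powr (c - a - b)) x = (1 - x) powr (c - a - b)"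
    unfolding eval_fps_def using one_minus_X_powr_sums[OF x] by (simp add: sums_iff)
  then have "hyp2F1 a b c x = (1 - x) powr (c - a - b) * hyp2F1 (c - a) (c - b) c x"
    unfolding hyp2F1_def hyp2F1_fps_euler[OF c, of a b] by (subst eval_fps_mult) (auto intro: lt)
  then show ?thesis
    using hreg_eq_hyp2F1(1)[OF x c'] by simp
qed

text \<open>The terms of index at most \<open>j\<close> vanish with \<open>rGamma\<close>.
  Reindexing the rest raises both upper parameters by \<open>j + 1\<close> and makes the lower one
  \<open>j + 2\<close>.\<close>

lemma hreg_nonpos_int:
  assumes "norm x < 1"
  shows "hreg x a b (- of_nat j) =
    pochhammer a (Suc j) * pochhammer b (Suc j) * x ^ Suc j / fact (Suc j) *
    hyp2F1 (a + of_nat (Suc j)) (b + of_nat (Suc j)) (of_nat (Suc (Suc j))) x"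
proof -
  have z: "hreg_term x a b (- of_nat j) n = 0" if "n < Suc j" for n
  proof -
    have "- of_nat j + of_nat n = (- of_nat (j - n) :: complex)" using that by (simp add: of_nat_diff)
    then have "rGamma (- of_nat j + of_nat n :: complex) = 0" by (simp only: rGamma_eq_zero_iff) simp
    then show ?thesis by (simp add: hreg_term_def)
  qed
  let ?K = "pochhammer a (Suc j) * pochhammer b (Suc j) * x ^ Suc j / fact (Suc j)"
  let ?F = "hyp2F1_fps (a + of_nat (Suc j)) (b + of_nat (Suc j)) (of_nat (Suc (Suc j)))"
  have t: "hreg_term x a b (- of_nat j) (m + Suc j) = ?K * (?F $ m * x ^ m)" for m
  proof -
    have 1: "rGamma (- of_nat j + of_nat (m + Suc j) :: complex) = 1 / fact m"
      using rGamma_inverse_Gamma[of "of_nat (Suc m) :: complex"] Gamma_fact[of m, where 'a = complex]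
      by (simp add: add_ac divide_inverse)
    have 2: "pochhammer z (m + Suc j) = pochhammer z (Suc j) * pochhammer (z + of_nat (Suc j)) m" for z :: complex
      using pochhammer_product'[of z "Suc j" m] by (simp only: add.commute)
    have 3: "(fact (m + Suc j) :: complex) = fact (Suc j) * pochhammer (of_nat (Suc (Suc j))) m"
      using 2[of 1] unfolding pochhammer_fact by (simp add: add.commute)
    have "(fact (m + Suc j) :: complex) \<noteq> 0" by (rule fact_nonzero)
    then have "pochhammer (of_nat (Suc (Suc j)) :: complex) m \<noteq> 0" unfolding 3 by (metis mult_zero_right)
    then show ?thesis
      unfolding hreg_term_def hyp2F1_fps_nth 1 2 3 power_add
      by (simp add: field_simps del: of_nat_Suc pochhammer_Suc fact_Suc)
  qed
  have "of_nat (Suc (Suc j)) \<notin> (\<int>\<^sub>\<le>\<^sub>0 :: complex set)"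
    unfolding of_nat_in_nonpos_Ints_iff by simp
  then have sm: "summable (\<lambda>m. ?F $ m * x ^ m)"
    by (intro hreg_eq_hyp2F1(2) assms)
  have "hreg x a b (- of_nat j) = (\<Sum>m. hreg_term x a b (- of_nat j) (m + Suc j))"
    unfolding hreg_def using suminf_split_initial_segment[OF summable_hreg_term[OF assms], of a b "- of_nat j" "Suc j"] z
    by simp
  also have "\<dots> = ?K * hyp2F1 (a + of_nat (Suc j)) (b + of_nat (Suc j)) (of_nat (Suc (Suc j))) x"
    unfolding t hyp2F1_def eval_fps_def using sm by (rule suminf_mult)
  finally show ?thesis .
qed

section \<open>Location of the poles in \<open>w\<close>\<close>

lemma eventually_not_nonpos_Ints:
  fixes r :: complex
  assumes r: "r \<noteq> 0"
  shows "\<forall>\<^sub>F w in at w0. r * w \<notin> \<int>\<^sub>\<le>\<^sub>0"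
proof -
  have "y = z" if "z \<in> \<int>\<^sub>\<le>\<^sub>0" "y \<in> \<int>\<^sub>\<le>\<^sub>0" "dist y z < 1" for y z :: complex
  proof -
    obtain m n where "z = of_int m" "y = of_int n" using \<open>z \<in> \<int>\<^sub>\<le>\<^sub>0\<close> \<open>y \<in> \<int>\<^sub>\<le>\<^sub>0\<close> by (auto simp: nonpos_Ints_def)
    then show ?thesis using that(3) by (simp add: dist_of_int)
  qed
  then have "\<not> (r * w0) islimpt (\<int>\<^sub>\<le>\<^sub>0 :: complex set)"
    by (intro discrete_imp_not_islimpt[of 1]) auto
  then have "\<forall>\<^sub>F z in at (r * w0). z \<notin> \<int>\<^sub>\<le>\<^sub>0"
    by (auto simp: islimpt_iff_eventually)
  moreover have "filterlim (\<lambda>w. r * w) (at (r * w0)) (at w0)"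
    using r by (auto simp: filterlim_at eventually_at_filter intro!: tendsto_intros)
  ultimately show ?thesis by (rule eventually_compose_filterlim)
qed

text \<open>Near \<open>w0\<close> the function is \<open>H w / rGamma (r * w)\<close>. The zeros of
  \<open>rGamma\<close> are simple, its derivative at \<open>- j\<close> being
  \<open>(-1) ^ j * fact j\<close>, so a zero of \<open>H\<close> would leave a finite limit
  there.\<close>

lemma is_pole_hyp_f:
  assumes x: "norm x < 1" and r: "r \<noteq> 0"
    and pole: "is_pole (hyp_f p q r a b x) w0"
  shows "\<exists>j. r * w0 = - of_nat j \<and> hreg x (p * w0 + a) (q * w0 + b) (- of_nat j) \<noteq> 0"
proof -
  define H where "H w = hreg x (p * w + a) (q * w + b) (r * w)" for w
  define f where "f = hyp_f p q r a b x"
  have holH: "H holomorphic_on UNIV"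
    unfolding H_def by (intro hreg_holomorphic x holomorphic_intros)
  have dH: "(H has_field_derivative deriv H w) (at w)" for w
    using holH by (simp add: holomorphic_derivI)
  then have contH: "isCont H w" for w by (rule DERIV_isCont)
  note ev = eventually_not_nonpos_Ints[OF r, of w0]
  have f: "\<forall>\<^sub>F w in at w0. H w / rGamma (r * w) = f w"
    using ev
  proof eventually_elim
    case (elim w)
    then have "rGamma (r * w) \<noteq> 0" by (simp add: rGamma_eq_zero_iff)
    then show ?case
      using hreg_eq_hyp2F1(1)[OF x elim, of "p * w + a" "q * w + b"] by (simp add: H_def f_def hyp_f_def)
  qed
  have nolim: "\<not> (f \<longlongrightarrow> l) (at w0)" for l
    using pole unfolding is_pole_def f_def by (metis at_neq_bot not_tendsto_and_filterlim_at_infinity)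
  have nolim': "\<not> ((\<lambda>w. H w / rGamma (r * w)) \<longlongrightarrow> l) (at w0)" for l
    using nolim[of l] tendsto_cong[OF f] by blast
  show ?thesis
  proof (cases "r * w0 \<in> \<int>\<^sub>\<le>\<^sub>0")
    case False
    then have "rGamma (r * w0) \<noteq> 0" by (simp add: rGamma_eq_zero_iff)
    then have "((\<lambda>w. H w / rGamma (r * w)) \<longlongrightarrow> H w0 / rGamma (r * w0)) (at w0)"
      using contH[of w0] isCont_rGamma[OF isCont_mult[OF continuous_const continuous_ident], of w0 r]
      unfolding isCont_def by (intro tendsto_divide) auto
    with nolim' show ?thesis by blast
  next
    case True
    then obtain j where j: "r * w0 = - of_nat j" by (elim nonpos_Ints_cases') auto
    have "H w0 \<noteq> 0"
    proof
      assume H0: "H w0 = 0"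
      define D where "D = r * ((-1) ^ j * fact j :: complex)"
      have "(rGamma has_field_derivative (-1) ^ j * fact j) (at (- of_nat j :: complex))"
        by (rule has_field_derivative_rGamma_nonpos_int)
      then have "((\<lambda>w. rGamma (r * w)) has_field_derivative ((-1) ^ j * fact j) * r) (at w0)"
        unfolding j[symmetric] by (rule DERIV_chain2) (auto intro!: derivative_eq_intros)
      then have g: "((\<lambda>w. (rGamma (r * w) - rGamma (r * w0)) / (w - w0)) \<longlongrightarrow> D) (at w0)"
        by (simp add: has_field_derivative_iff D_def mult.commute)
      have "rGamma (r * w0) = 0" unfolding j by (simp add: rGamma_eq_zero_iff)
      with g have g: "((\<lambda>w. rGamma (r * w) / (w - w0)) \<longlongrightarrow> D) (at w0)" by simp
      have h: "((\<lambda>w. H w / (w - w0)) \<longlongrightarrow> deriv H w0) (at w0)"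
        using dH[of w0] H0 by (simp add: has_field_derivative_iff)
      have "D \<noteq> 0" using r by (simp add: D_def)
      then have "((\<lambda>w. (H w / (w - w0)) / (rGamma (r * w) / (w - w0))) \<longlongrightarrow> deriv H w0 / D) (at w0)"
        by (intro tendsto_intros g h)
      moreover have "\<forall>\<^sub>F w in at w0. (H w / (w - w0)) / (rGamma (r * w) / (w - w0)) = H w / rGamma (r * w)"
        unfolding eventually_at_filter by (intro always_eventually) auto
      ultimately have "((\<lambda>w. H w / rGamma (r * w)) \<longlongrightarrow> deriv H w0 / D) (at w0)"
        by (rule Lim_transform_eventually)
      with nolim' show False by blast
    qed
    then show ?thesis using j by (auto simp: H_def)
  qed
qed

section \<open>Large positive parameters\<close>

definition rhyp_term :: "real \<Rightarrow> real \<Rightarrow> real \<Rightarrow> real \<Rightarrow> nat \<Rightarrow> real" where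
  "rhyp_term x a b c n = pochhammer a n * pochhammer b n / (pochhammer c n * fact n) * x ^ n"

definition rhyp :: "real \<Rightarrow> real \<Rightarrow> real \<Rightarrow> real \<Rightarrow> real" where
  "rhyp x a b c = (\<Sum>n. rhyp_term x a b c n)"

lemma rhyp_term_pos:
  assumes "0 < x" "0 < a" "0 < b" "0 < c"
  shows "0 < rhyp_term x a b c n"
  unfolding rhyp_term_def using assms
  by (intro mult_pos_pos divide_pos_pos pochhammer_pos zero_less_power) auto

lemma rhyp_term_Suc:
  assumes "0 < c"
  shows "rhyp_term x a b c (Suc n) * ((c + n) * (n + 1)) = rhyp_term x a b c n * ((a + n) * (b + n) * x)"
proof -
  have "pochhammer c n > 0" "c + n > 0" using assms by (auto intro: pochhammer_pos)
  then show ?thesis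
    by (simp add: rhyp_term_def pochhammer_Suc divide_simps del: of_nat_Suc)
qed

lemma rhyp_props:
  assumes "0 < x" "x < 1" "0 < c"
  shows "summable (rhyp_term x a b c)"
    and "hyp2F1 (of_real a) (of_real b) (of_real c) (of_real x) = of_real (rhyp x a b c)"
proof -
  have c: "complex_of_real c \<notin> \<int>\<^sub>\<le>\<^sub>0"
    using assms(3) nonpos_Ints_nonpos[of c] by (auto simp: of_real_in_nonpos_Ints_iff)
  have eq: "hyp2F1_fps (of_real a) (of_real b) (of_real c) $ n * of_real x ^ n = of_real (rhyp_term x a b c n)" for n
    by (simp add: hyp2F1_fps_nth rhyp_term_def flip: pochhammer_of_real)
  have "summable (\<lambda>n. complex_of_real (rhyp_term x a b c n))"
    using hreg_eq_hyp2F1(2)[of "of_real x" "of_real c" "of_real a" "of_real b"] assms c unfolding eq by simp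
  then show "summable (rhyp_term x a b c)" by (simp add: summable_of_real_iff)
  show "hyp2F1 (of_real a) (of_real b) (of_real c) (of_real x) = of_real (rhyp x a b c)"
    unfolding hyp2F1_def eval_fps_def eq rhyp_def
    by (rule suminf_of_real[symmetric]) fact
qed

lemma rhyp_pos:
  assumes "0 < x" "x < 1" "0 < a" "0 < b" "0 < c"
  shows "0 < rhyp x a b c"
  unfolding rhyp_def using rhyp_props(1)[of x c a b] rhyp_term_pos[of x a b c] assms
  by (intro suminf_pos) auto

section \<open>Concentration of series with large positive parameters\<close>

text \<open>Each term below \<open>N\<close> is at most \<open>1 / L ^ m\<close> times the term
  \<open>m\<close> places later, and the later terms together do not exceed the whole sum.\<close>

lemma lower_tail_bound:
  fixes t :: "nat \<Rightarrow> real"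
  assumes "\<And>n. 0 \<le> t n" "summable t" "L > 0"
    and "\<And>n. n < N + m \<Longrightarrow> L * t n \<le> t (Suc n)"
  shows "(\<Sum>n<N. t n) * L ^ m \<le> suminf t"
proof -
  have "t n * L ^ i \<le> t (n + i)" if "n < N" "i \<le> m" for n i
    using that(2)
  proof (induction i)
    case (Suc i)
    have "t n * L ^ Suc i \<le> L * t (n + i)"
      using Suc assms(3) by (simp add: mult.left_commute mult.commute[of L])
    also have "\<dots> \<le> t (n + Suc i)" using assms(4)[of "n + i"] that Suc by simp
    finally show ?case .
  qed simp
  then have "(\<Sum>n<N. t n * L ^ m) \<le> (\<Sum>n<N. t (n + m))" by (intro sum_mono) auto
  also have "\<dots> \<le> (\<Sum>n. t (n + m))"
    using assms by (intro sum_le_suminf summable_ignore_initial_segment) auto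
  also have "\<dots> \<le> suminf t"
    using suminf_split_initial_segment[OF assms(2), of m] sum_nonneg[of "{..<m}" t] assms(1) by simp
  finally show ?thesis by (simp add: sum_distrib_right)
qed

lemma upper_tail_bound:
  fixes t :: "nat \<Rightarrow> real"
  assumes "\<And>n. 0 \<le> t n" "summable t" "\<theta> > 0"
    and "\<And>n. n \<ge> N \<Longrightarrow> t (Suc n) \<le> \<theta> * t n"
  shows "(\<Sum>n. t (n + (N + m))) \<le> \<theta> ^ m * suminf t"
proof -
  have "t (n + (N + i)) \<le> \<theta> ^ i * t (n + N)" for n i
  proof (induction i)
    case (Suc i)
    have "t (n + (N + Suc i)) \<le> \<theta> * t (n + (N + i))" using assms(4)[of "n + (N + i)"] by simp
    also have "\<dots> \<le> \<theta> * (\<theta> ^ i * t (n + N))" using Suc assms(3) by simp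
    finally show ?case by simp
  qed simp
  then have "(\<Sum>n. t (n + (N + m))) \<le> (\<Sum>n. \<theta> ^ m * t (n + N))"
    using assms(2) by (intro suminf_le summable_mult summable_ignore_initial_segment) auto
  also have "\<dots> = \<theta> ^ m * (\<Sum>n. t (n + N))"
    using assms(2) by (intro suminf_mult summable_ignore_initial_segment)
  also have "\<dots> \<le> \<theta> ^ m * suminf t"
    using suminf_split_initial_segment[OF assms(2), of N] sum_nonneg[of "{..<N}" t] assms(1,3) by simp
  finally show ?thesis .
qed

text \<open>
  \<open>\<rho>\<close> is the location, in units of \<open>w\<close>, of the dominant terms of the series: there the ratio of
  consecutive terms tends to \<open>1\<close>.
\<close>

locale large_params =
  fixes x p q r \<rho> :: real and w A B C :: "nat \<Rightarrow> real"
  assumes x: "0 < x" "x < 1" and pqr: "0 < p" "0 < q" "0 < r" and \<rho>: "0 < \<rho>"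
    and root: "\<rho> * (\<rho> + r) = x * (\<rho> + p) * (\<rho> + q)"
    and w: "filterlim w at_top sequentially"
    and A: "(\<lambda>k. A k / w k) \<longlonglongrightarrow> p" and B: "(\<lambda>k. B k / w k) \<longlonglongrightarrow> q" and C: "(\<lambda>k. C k / w k) \<longlonglongrightarrow> r"
begin

text \<open>\<open>- \<rho>'\<close> is the second root of the quadratic equation for
  \<open>\<rho>\<close>, obtained from the product of the roots.\<close>

definition "\<rho>' = x * p * q / ((1 - x) * \<rho>)"

lemma \<rho>'_pos: "\<rho>' > 0" unfolding \<rho>'_def using x pqr \<rho> by simp

text \<open>At index \<open>\<nu> * w\<close> the ratio of consecutive terms tends to the left-hand
  side divided by \<open>\<nu> * (r + \<nu>)\<close>. The factorisation shows that for positive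
  \<open>\<nu>\<close> this exceeds 1 exactly below \<open>\<rho>\<close>.\<close>

lemma factor: "x * (p + \<nu>) * (q + \<nu>) = \<nu> * (r + \<nu>) - (1 - x) * (\<nu> - \<rho>) * (\<nu> + \<rho>')"
proof -
  have a: "(1 - x) * \<rho> * \<rho>' = x * p * q" unfolding \<rho>'_def using x \<rho> by simp
  have "\<rho> * ((1 - x) * \<rho> + r - x * (p + q)) = \<rho> * ((1 - x) * \<rho>')"
    using a root by (simp add: algebra_simps)
  then have b: "(1 - x) * \<rho> + r - x * (p + q) = (1 - x) * \<rho>'" using \<rho> by simp
  have "\<nu> * (r + \<nu>) - (1 - x) * (\<nu> - \<rho>) * (\<nu> + \<rho>') =
     x * \<nu> ^ 2 + r * \<nu> + (1 - x) * \<rho> * \<nu> - \<nu> * ((1 - x) * \<rho>') + (1 - x) * \<rho> * \<rho>'"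
    by (simp add: algebra_simps power2_eq_square)
  also have "\<dots> = x * (p + \<nu>) * (q + \<nu>)"
    unfolding a b[symmetric] by (simp add: algebra_simps power2_eq_square)
  finally show ?thesis by simp
qed

abbreviation "t k \<equiv> rhyp_term x (A k) (B k) (C k)"

lemma ev_w: "\<forall>\<^sub>F k in sequentially. w k > K"
  using w by (simp add: filterlim_at_top_dense)

lemma ev_bounds:
  assumes "U \<in> {(A, p), (B, q), (C, r)}" "0 < \<eta>" "\<eta> < 1"
  shows "\<forall>\<^sub>F k in sequentially. (1 - \<eta>) * (snd U * w k) \<le> fst U k \<and> fst U k \<le> (1 + \<eta>) * (snd U * w k)"
proof -
  have pos: "snd U > 0" and lim: "(\<lambda>k. fst U k / w k) \<longlonglongrightarrow> snd U" using assms(1) pqr A B C by auto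
  have "(1 - \<eta>) * snd U < snd U" "snd U < (1 + \<eta>) * snd U"
    using pos assms by (simp_all add: algebra_simps)
  then have "\<forall>\<^sub>F k in sequentially. (1 - \<eta>) * snd U < fst U k / w k"
    "\<forall>\<^sub>F k in sequentially. fst U k / w k < (1 + \<eta>) * snd U"
    using order_tendstoD[OF lim] by blast+
  with ev_w[of 0] show ?thesis
    by eventually_elim (auto simp: field_simps)
qed

lemma ev_pos: "\<forall>\<^sub>F k in sequentially. 0 < w k \<and> 0 < A k \<and> 0 < B k \<and> 0 < C k"
proof -
  have *: "\<forall>\<^sub>F k in sequentially. fst U k > 0" if "U \<in> {(A, p), (B, q), (C, r)}" for U
  proof -
    have "snd U > 0" "(\<lambda>k. fst U k / w k) \<longlonglongrightarrow> snd U" using that pqr A B C by auto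
    then have "\<forall>\<^sub>F k in sequentially. fst U k / w k > 0" by (intro order_tendstoD)
    with ev_w[of 0] show ?thesis by eventually_elim (simp add: zero_less_divide_iff)
  qed
  show ?thesis
    using ev_w[of 0] *[of "(A, p)", simplified] *[of "(B, q)", simplified] *[of "(C, r)", simplified]
    by eventually_elim simp
qed

text \<open>Allows \<open>\<nu> + \<rho>'\<close> to be bounded below by a multiple of
  \<open>\<nu> + r\<close>, the factor occurring in the denominator of the term ratio, uniformly in
  \<open>\<nu>\<close>.\<close>

definition "\<kappa> = min 1 (\<rho>' / r)"

lemma \<kappa>: "0 < \<kappa>" "\<kappa> \<le> 1" "\<nu> \<ge> 0 \<Longrightarrow> \<kappa> * (\<nu> + r) \<le> \<nu> + \<rho>'"
proof -
  show 1: "0 < \<kappa>" "\<kappa> \<le> 1" unfolding \<kappa>_def using \<rho>'_pos pqr by auto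
  assume "\<nu> \<ge> 0"
  then have "\<kappa> * \<nu> \<le> \<nu>" using 1 by (simp add: mult_left_le_one_le)
  moreover have "\<kappa> * r \<le> \<rho>'" using pqr unfolding \<kappa>_def by (simp add: min_def divide_simps)
  ultimately show "\<kappa> * (\<nu> + r) \<le> \<nu> + \<rho>'" by (simp add: algebra_simps)
qed

lemma upper_ratio:
  assumes "\<epsilon> > 0"
  obtains \<theta> where "0 < \<theta>" "\<theta> < 1"
    "\<forall>\<^sub>F k in sequentially. \<forall>n. real n \<ge> (\<rho> + \<epsilon>) * w k \<longrightarrow> t k (Suc n) \<le> \<theta> * t k n"
proof -
  \<comment> \<open>A relative gap below 1 of the limiting ratio: for
    \<open>\<nu> \<ge> \<rho> + \<epsilon>\<close> one has \<open>(\<nu> - \<rho>) / \<nu> \<ge>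
    \<epsilon> / (\<rho> + \<epsilon>)\<close>, and \<open>\<kappa>\<close> handles the other
    factor.\<close>
  define \<tau> where "\<tau> = (1 - x) * (\<epsilon> / (\<rho> + \<epsilon>)) * \<kappa>"
  have "\<epsilon> / (\<rho> + \<epsilon>) < 1" "0 < \<epsilon> / (\<rho> + \<epsilon>)" using assms \<rho> by simp_all
  moreover from this have "(1 - x) * (\<epsilon> / (\<rho> + \<epsilon>)) < 1 * 1"
    using x by (intro mult_strict_mono) auto
  moreover have "(1 - x) * (\<epsilon> / (\<rho> + \<epsilon>)) * \<kappa> \<le> (1 - x) * (\<epsilon> / (\<rho> + \<epsilon>))"
    using x \<kappa> \<open>0 < \<epsilon> / (\<rho> + \<epsilon>)\<close> by (intro mult_left_le mult_nonneg_nonneg) auto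
  moreover have "(1 - x) * (\<epsilon> / (\<rho> + \<epsilon>)) * \<kappa> > 0"
    using x \<kappa> \<open>0 < \<epsilon> / (\<rho> + \<epsilon>)\<close> by (intro mult_pos_pos) auto
  ultimately have \<tau>: "0 < \<tau>" "\<tau> < 1"
    unfolding \<tau>_def by linarith+
  \<comment> \<open>The tolerance for \<open>A\<close>, \<open>B\<close>, \<open>C\<close>, small
    enough to use up at most half of the gap \<open>\<tau>\<close>.\<close>
  define \<eta> where "\<eta> = \<tau> / 10"
  have \<eta>: "0 < \<eta>" "\<eta> < 1" using \<tau> by (auto simp: \<eta>_def)
  have key: "(1 + \<eta>) ^ 2 * (1 - \<tau>) \<le> (1 - \<eta>) * (1 - \<tau> / 2)"
  proof -
    have "(1 - \<eta>) * (1 - \<tau> / 2) - (1 + \<eta>) ^ 2 * (1 - \<tau>) = (1/5) * \<tau> + (6/25) * \<tau> ^ 2 + \<tau> ^ 3 / 100"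
      by (simp add: \<eta>_def field_simps power2_eq_square power3_eq_cube)
    also have "\<dots> \<ge> 0" using \<tau> by simp
    finally show ?thesis by simp
  qed
  have "\<forall>\<^sub>F k in sequentially. \<forall>n. real n \<ge> (\<rho> + \<epsilon>) * w k \<longrightarrow> t k (Suc n) \<le> (1 - \<tau> / 2) * t k n"
    using ev_pos ev_bounds[of "(A, p)" \<eta>, simplified, OF \<eta>] ev_bounds[of "(B, q)" \<eta>, simplified, OF \<eta>]
      ev_bounds[of "(C, r)" \<eta>, simplified, OF \<eta>]
  proof (eventually_elim, intro allI impI)
    fix k n
    assume pos: "0 < w k \<and> 0 < A k \<and> 0 < B k \<and> 0 < C k"
      and Ab: "(1 - \<eta>) * (p * w k) \<le> A k \<and> A k \<le> (1 + \<eta>) * (p * w k)"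
      and Bb: "(1 - \<eta>) * (q * w k) \<le> B k \<and> B k \<le> (1 + \<eta>) * (q * w k)"
      and Cb: "(1 - \<eta>) * (r * w k) \<le> C k \<and> C k \<le> (1 + \<eta>) * (r * w k)"
      and n: "(\<rho> + \<epsilon>) * w k \<le> real n"
    define W where "W = w k"
    define \<nu> where "\<nu> = real n / W"
    have W: "W > 0" using pos by (simp add: W_def)
    have n\<nu>: "real n = \<nu> * W" using W by (simp add: \<nu>_def)
    have \<nu>: "\<nu> \<ge> \<rho> + \<epsilon>" using n W by (simp add: n\<nu> W_def[symmetric])
    have \<nu>0: "\<nu> > 0" using \<nu> \<rho> assms by simp
    have h: "x * (p + \<nu>) * (q + \<nu>) \<le> (1 - \<tau>) * (\<nu> * (r + \<nu>))"
    proof -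
      have "\<epsilon> / (\<rho> + \<epsilon>) * \<nu> \<le> \<nu> - \<rho>"
        using mult_right_mono[OF \<nu>, of \<rho>] \<rho> assms by (simp add: field_simps)
      then have "(\<epsilon> / (\<rho> + \<epsilon>) * \<nu>) * (\<kappa> * (\<nu> + r)) \<le> (\<nu> - \<rho>) * (\<nu> + \<rho>')"
        using \<kappa>(3)[of \<nu>] \<kappa>(1) \<nu> \<nu>0 \<rho> assms pqr by (intro mult_mono) auto
      then have "(1 - x) * ((\<epsilon> / (\<rho> + \<epsilon>) * \<nu>) * (\<kappa> * (\<nu> + r))) \<le> (1 - x) * ((\<nu> - \<rho>) * (\<nu> + \<rho>'))"
        using x by (intro mult_left_mono) auto
      moreover have "(1 - x) * ((\<epsilon> / (\<rho> + \<epsilon>) * \<nu>) * (\<kappa> * (\<nu> + r))) = \<tau> * (\<nu> * (r + \<nu>))"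
        by (simp add: \<tau>_def mult_ac add_ac)
      ultimately show ?thesis unfolding factor by (simp add: algebra_simps)
    qed
    have a: "A k + n \<le> (1 + \<eta>) * (W * (p + \<nu>))" "B k + n \<le> (1 + \<eta>) * (W * (q + \<nu>))"
    proof -
      have "\<eta> * (W * \<nu>) \<ge> 0" using \<eta> W \<nu>0 by simp
      then show "A k + n \<le> (1 + \<eta>) * (W * (p + \<nu>))" "B k + n \<le> (1 + \<eta>) * (W * (q + \<nu>))"
        using Ab Bb unfolding n\<nu> W_def[symmetric] by (simp_all add: algebra_simps)
    qed
    have c: "(1 - \<eta>) * (W * (r + \<nu>)) \<le> C k + n"
    proof -
      have "\<eta> * (W * \<nu>) \<ge> 0" using \<eta> W \<nu>0 by simp
      then show ?thesis using Cb unfolding n\<nu> W_def[symmetric] by (simp add: algebra_simps)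
    qed
    have "(A k + n) * (B k + n) * x \<le> ((1 + \<eta>) * (W * (p + \<nu>))) * ((1 + \<eta>) * (W * (q + \<nu>))) * x"
      using a pos x \<eta> W \<nu>0 pqr by (intro mult_right_mono mult_mono) auto
    also have "\<dots> = (1 + \<eta>) ^ 2 * W ^ 2 * (x * (p + \<nu>) * (q + \<nu>))"
      by (simp add: power2_eq_square algebra_simps)
    also have "\<dots> \<le> (1 + \<eta>) ^ 2 * W ^ 2 * ((1 - \<tau>) * (\<nu> * (r + \<nu>)))"
      using h by (intro mult_left_mono) auto
    also have "\<dots> = ((1 + \<eta>) ^ 2 * (1 - \<tau>)) * (W ^ 2 * (\<nu> * (r + \<nu>)))" by (simp add: mult_ac)
    also have "\<dots> \<le> ((1 - \<eta>) * (1 - \<tau> / 2)) * (W ^ 2 * (\<nu> * (r + \<nu>)))"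
      using key W \<nu>0 pqr by (intro mult_right_mono) auto
    also have "\<dots> = (1 - \<tau> / 2) * (((1 - \<eta>) * (W * (r + \<nu>))) * (\<nu> * W))"
      by (simp add: power2_eq_square mult_ac)
    also have "\<dots> \<le> (1 - \<tau> / 2) * ((C k + n) * (n + 1))"
      using c \<tau> W \<nu>0 \<eta> pqr pos by (intro mult_left_mono mult_mono) (auto simp: n\<nu>)
    finally have *: "(A k + n) * (B k + n) * x \<le> (1 - \<tau> / 2) * ((C k + n) * (n + 1))" .
    have tp: "t k n > 0" using pos x by (intro rhyp_term_pos) auto
    have "t k (Suc n) * ((C k + n) * (n + 1)) \<le> ((1 - \<tau> / 2) * t k n) * ((C k + n) * (n + 1))"
      using rhyp_term_Suc[of "C k" x "A k" "B k" n] pos mult_left_mono[OF *, of "t k n"] tp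
      by (simp add: mult_ac)
    then show "t k (Suc n) \<le> (1 - \<tau> / 2) * t k n"
      using pos by (simp add: mult_le_cancel_right add_pos_nonneg)
  qed
  then show ?thesis using \<tau> by (intro that[of "1 - \<tau> / 2"]) auto
qed

lemma lower_ratio:
  assumes "\<epsilon> > 0"
  obtains L where "1 < L"
    "\<forall>\<^sub>F k in sequentially. \<forall>n. real n \<le> (\<rho> - \<epsilon>) * w k \<longrightarrow> L * t k n \<le> t k (Suc n)"
proof -
  \<comment> \<open>An additive gap, because \<open>n\<close> may be small here and
    \<open>n + 1\<close> cannot simply be replaced by \<open>n\<close>: half of \<open>c\<close>
    absorbs the \<open>+ 1\<close> as soon as \<open>w k > 2 / c\<close>, the other half keeps the
    ratio above 1.\<close>
  define c where "c = (1 - x) * \<epsilon> * \<kappa>"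
  have c: "c > 0" unfolding c_def using x assms \<kappa> by simp
  \<comment> \<open>\<open>(\<nu> + c) / (\<nu> + c / 2)\<close> decreases in \<open>\<nu>\<close>,
    so its smallest value on the range up to \<open>\<rho>\<close> is the one at
    \<open>\<rho>\<close>.\<close>
  define \<tau> where "\<tau> = (\<rho> + c) / (\<rho> + c / 2) - 1"
  have \<tau>: "\<tau> > 0" using c \<rho> by (simp add: \<tau>_def field_simps)
  have c\<tau>: "(1 + \<tau>) * (\<nu> + c / 2) \<le> \<nu> + c" if "0 \<le> \<nu>" "\<nu> \<le> \<rho>" for \<nu>
  proof -
    have "\<nu> * c \<le> \<rho> * c" using that c by simp
    then show ?thesis using c \<rho> that by (simp add: \<tau>_def field_simps)
  qed
  have "((\<lambda>\<eta>. (1 - \<eta>) ^ 2 * (1 + \<tau>) - (1 + \<eta>) * (1 + \<tau> / 2)) \<longlongrightarrow> (1 - 0) ^ 2 * (1 + \<tau>) - (1 + 0) * (1 + \<tau> / 2)) (at_right 0)"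
    by (intro tendsto_intros)
  then have "\<forall>\<^sub>F \<eta> in at_right 0. (1 - \<eta>) ^ 2 * (1 + \<tau>) - (1 + \<eta>) * (1 + \<tau> / 2) > 0"
    by (rule order_tendstoD) (use \<tau> in simp)
  moreover have "\<forall>\<^sub>F \<eta> in at_right 0. \<eta> \<in> {0<..<1::real}" by (rule eventually_at_right_real) simp
  ultimately have "\<forall>\<^sub>F \<eta> in at_right 0. \<eta> \<in> {0<..<1} \<and> (1 - \<eta>) ^ 2 * (1 + \<tau>) - (1 + \<eta>) * (1 + \<tau> / 2) > 0"
    by eventually_elim simp
  then obtain \<eta> where "\<eta> \<in> {0<..<1}" "(1 - \<eta>) ^ 2 * (1 + \<tau>) - (1 + \<eta>) * (1 + \<tau> / 2) > 0"
    using eventually_happens' trivial_limit_at_right_real by blast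
  then have \<eta>: "0 < \<eta>" "\<eta> < 1" and key: "(1 + \<eta>) * (1 + \<tau> / 2) \<le> (1 - \<eta>) ^ 2 * (1 + \<tau>)" by auto
  have "\<forall>\<^sub>F k in sequentially. \<forall>n. real n \<le> (\<rho> - \<epsilon>) * w k \<longrightarrow> (1 + \<tau> / 2) * t k n \<le> t k (Suc n)"
    using ev_pos ev_bounds[of "(A, p)" \<eta>, simplified, OF \<eta>] ev_bounds[of "(B, q)" \<eta>, simplified, OF \<eta>]
      ev_bounds[of "(C, r)" \<eta>, simplified, OF \<eta>] ev_w[of "2 / c"]
  proof (eventually_elim, intro allI impI)
    fix k n
    assume pos: "0 < w k \<and> 0 < A k \<and> 0 < B k \<and> 0 < C k"
      and Ab: "(1 - \<eta>) * (p * w k) \<le> A k \<and> A k \<le> (1 + \<eta>) * (p * w k)"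
      and Bb: "(1 - \<eta>) * (q * w k) \<le> B k \<and> B k \<le> (1 + \<eta>) * (q * w k)"
      and Cb: "(1 - \<eta>) * (r * w k) \<le> C k \<and> C k \<le> (1 + \<eta>) * (r * w k)"
      and wc: "2 / c < w k"
      and n: "real n \<le> (\<rho> - \<epsilon>) * w k"
    define W where "W = w k"
    define \<nu> where "\<nu> = real n / W"
    have W: "W > 0" using pos by (simp add: W_def)
    have n\<nu>: "real n = \<nu> * W" using W by (simp add: \<nu>_def)
    have \<nu>: "\<nu> \<le> \<rho> - \<epsilon>" "\<nu> \<ge> 0" using n W by (simp add: n\<nu> W_def[symmetric], simp add: \<nu>_def)
    have W1: "real n + 1 \<le> W * (\<nu> + c / 2)"
      using wc W c unfolding n\<nu> W_def[symmetric] by (simp add: field_simps)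
    have h: "(\<nu> + c) * (\<nu> + r) \<le> x * (p + \<nu>) * (q + \<nu>)"
    proof -
      have "\<epsilon> * (\<kappa> * (\<nu> + r)) \<le> (\<rho> - \<nu>) * (\<nu> + \<rho>')"
        using \<kappa>(3)[of \<nu>] \<kappa>(1) \<nu> assms pqr by (intro mult_mono) auto
      then have "(1 - x) * (\<epsilon> * (\<kappa> * (\<nu> + r))) \<le> (1 - x) * ((\<rho> - \<nu>) * (\<nu> + \<rho>'))"
        using x by (intro mult_left_mono) auto
      moreover have "(1 - x) * (\<epsilon> * (\<kappa> * (\<nu> + r))) = c * (\<nu> + r)" by (simp add: c_def)
      ultimately show ?thesis unfolding factor by (simp add: algebra_simps)
    qed
    have a: "(1 - \<eta>) * (W * (p + \<nu>)) \<le> A k + n" "(1 - \<eta>) * (W * (q + \<nu>)) \<le> B k + n"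
    proof -
      have "\<eta> * (W * \<nu>) \<ge> 0" using \<eta> W \<nu> by simp
      then show "(1 - \<eta>) * (W * (p + \<nu>)) \<le> A k + n" "(1 - \<eta>) * (W * (q + \<nu>)) \<le> B k + n"
        using Ab Bb unfolding n\<nu> W_def[symmetric] by (simp_all add: algebra_simps)
    qed
    have cc: "C k + n \<le> (1 + \<eta>) * (W * (r + \<nu>))"
    proof -
      have "\<eta> * (W * \<nu>) \<ge> 0" using \<eta> W \<nu> by simp
      then show ?thesis using Cb unfolding n\<nu> W_def[symmetric] by (simp add: algebra_simps)
    qed
    have "(1 + \<tau> / 2) * ((C k + n) * (n + 1)) \<le> (1 + \<tau> / 2) * (((1 + \<eta>) * (W * (r + \<nu>))) * (W * (\<nu> + c / 2)))"
      using cc W1 pos \<tau> \<eta> W \<nu> pqr c by (intro mult_left_mono mult_mono) auto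
    also have "\<dots> = ((1 + \<eta>) * (1 + \<tau> / 2)) * (W ^ 2 * (r + \<nu>) * (\<nu> + c / 2))"
      by (simp add: power2_eq_square mult_ac)
    also have "\<dots> \<le> ((1 - \<eta>) ^ 2 * (1 + \<tau>)) * (W ^ 2 * (r + \<nu>) * (\<nu> + c / 2))"
      using key W \<nu> pqr c by (intro mult_right_mono) auto
    also have "\<dots> = (1 - \<eta>) ^ 2 * W ^ 2 * (r + \<nu>) * ((1 + \<tau>) * (\<nu> + c / 2))" by (simp add: mult_ac)
    also have "\<dots> \<le> (1 - \<eta>) ^ 2 * W ^ 2 * (r + \<nu>) * (\<nu> + c)"
      using c\<tau>[of \<nu>] \<nu> assms pqr by (intro mult_left_mono) auto
    also have "\<dots> = (1 - \<eta>) ^ 2 * W ^ 2 * ((\<nu> + c) * (\<nu> + r))" by (simp add: mult_ac add_ac)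
    also have "\<dots> \<le> (1 - \<eta>) ^ 2 * W ^ 2 * (x * (p + \<nu>) * (q + \<nu>))"
      using h by (intro mult_left_mono) auto
    also have "\<dots> = ((1 - \<eta>) * (W * (p + \<nu>))) * ((1 - \<eta>) * (W * (q + \<nu>))) * x"
      by (simp add: power2_eq_square mult_ac)
    also have "\<dots> \<le> (A k + n) * (B k + n) * x"
      using a pos x \<eta> W \<nu> pqr by (intro mult_right_mono mult_mono) auto
    finally have *: "(1 + \<tau> / 2) * ((C k + n) * (n + 1)) \<le> (A k + n) * (B k + n) * x" .
    have tp: "t k n > 0" using pos x by (intro rhyp_term_pos) auto
    have "((1 + \<tau> / 2) * t k n) * ((C k + n) * (n + 1)) \<le> t k (Suc n) * ((C k + n) * (n + 1))"
      using rhyp_term_Suc[of "C k" x "A k" "B k" n] pos mult_left_mono[OF *, of "t k n"] tp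
      by (simp add: mult_ac)
    then show "(1 + \<tau> / 2) * t k n \<le> t k (Suc n)"
      using pos by (simp add: mult_le_cancel_right add_pos_nonneg)
  qed
  then show ?thesis using \<tau> by (intro that[of "1 + \<tau> / 2"]) auto
qed

abbreviation "S k \<equiv> rhyp x (A k) (B k) (C k)"

lemma upper_tail:
  assumes "\<epsilon> > 0"
  shows "\<forall>\<^sub>F k in sequentially. \<exists>N. real N \<le> (\<rho> + \<epsilon>) * w k \<and> (\<Sum>n. t k (n + N)) \<le> \<epsilon> * S k"
proof -
  \<comment> \<open>The geometric decay starts already at \<open>\<rho> + \<epsilon> / 2\<close>.
    For large \<open>w k\<close> the second half of the window has room for \<open>m\<close> further
    steps, which shrink the tail by \<open>\<theta> ^ m\<close>.\<close>
  obtain \<theta> where \<theta>: "0 < \<theta>" "\<theta> < 1"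
    "\<forall>\<^sub>F k in sequentially. \<forall>n. real n \<ge> (\<rho> + \<epsilon> / 2) * w k \<longrightarrow> t k (Suc n) \<le> \<theta> * t k n"
    using upper_ratio[of "\<epsilon> / 2"] assms by auto
  obtain m where m: "\<theta> ^ m < \<epsilon>" using real_arch_pow_inv[OF assms \<theta>(2)] by blast
  show ?thesis
    using \<theta>(3) ev_pos ev_w[of "2 * (real m + 1) / \<epsilon>"]
  proof eventually_elim
    case (elim k)
    define N where "N = nat \<lceil>(\<rho> + \<epsilon> / 2) * w k\<rceil>"
    have pos: "(\<rho> + \<epsilon> / 2) * w k > 0" using elim \<rho> assms by simp
    have N: "real N \<ge> (\<rho> + \<epsilon> / 2) * w k" "real N < (\<rho> + \<epsilon> / 2) * w k + 1"
      unfolding N_def using pos by linarith+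
    have "2 * (real m + 1) < w k * \<epsilon>" using elim(3) assms by (simp add: divide_less_eq)
    then have "real (N + m) \<le> (\<rho> + \<epsilon>) * w k" using N by (simp add: algebra_simps)
    moreover have "(\<Sum>n. t k (n + (N + m))) \<le> \<theta> ^ m * suminf (t k)"
    proof (rule upper_tail_bound)
      show "0 \<le> t k n" for n using rhyp_term_pos[of x "A k" "B k" "C k" n] elim x by simp
      show "summable (t k)" using rhyp_props(1)[of x "C k" "A k" "B k"] elim x by simp
      show "t k (Suc n) \<le> \<theta> * t k n" if "n \<ge> N" for n
        using elim(1) N that by (meson le_trans of_nat_mono order.trans)
    qed fact
    moreover have "\<theta> ^ m * suminf (t k) \<le> \<epsilon> * S k"
      using m rhyp_pos[of x "A k" "B k" "C k"] elim x unfolding rhyp_def by (intro mult_right_mono) auto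
    ultimately show ?case by (meson order.trans)
  qed
qed

lemma lower_tail:
  assumes "\<epsilon> > 0" "\<epsilon> < \<rho>"
  shows "\<forall>\<^sub>F k in sequentially. \<exists>N. real N \<ge> (\<rho> - \<epsilon>) * w k \<and> (\<Sum>n<N. t k n) \<le> \<epsilon> * S k"
proof -
  obtain L where L: "1 < L"
    "\<forall>\<^sub>F k in sequentially. \<forall>n. real n \<le> (\<rho> - \<epsilon> / 2) * w k \<longrightarrow> L * t k n \<le> t k (Suc n)"
    using lower_ratio[of "\<epsilon> / 2"] assms by auto
  obtain m where m: "1 / \<epsilon> < L ^ m" using real_arch_pow[OF L(1)] by blast
  show ?thesis
    using L(2) ev_pos ev_w[of "2 * (real m + 1) / \<epsilon>"]
  proof eventually_elim
    case (elim k)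
    define N where "N = nat \<lceil>(\<rho> - \<epsilon>) * w k\<rceil>"
    have pos: "(\<rho> - \<epsilon>) * w k > 0" using elim assms by simp
    have N: "real N \<ge> (\<rho> - \<epsilon>) * w k" "real N < (\<rho> - \<epsilon>) * w k + 1"
      unfolding N_def using pos by linarith+
    have "2 * (real m + 1) < w k * \<epsilon>" using elim(3) assms by (simp add: divide_less_eq)
    then have Nm: "real (N + m) \<le> (\<rho> - \<epsilon> / 2) * w k" using N by (simp add: algebra_simps)
    have "(\<Sum>n<N. t k n) * L ^ m \<le> suminf (t k)"
    proof (rule lower_tail_bound)
      show "0 \<le> t k n" for n using rhyp_term_pos[of x "A k" "B k" "C k" n] elim x by simp
      show "summable (t k)" using rhyp_props(1)[of x "C k" "A k" "B k"] elim x by simp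
      show "L * t k n \<le> t k (Suc n)" if "n < N + m" for n
        using elim(1) Nm that by (meson less_imp_le of_nat_mono order.trans)
      show "0 < L" using L by simp
    qed
    moreover have "0 < L ^ m" using L by simp
    ultimately have "(\<Sum>n<N. t k n) \<le> S k * (1 / L ^ m)"
      unfolding rhyp_def by (simp add: field_simps)
    also have "\<dots> \<le> S k * \<epsilon>"
      using m assms \<open>0 < L ^ m\<close> rhyp_pos[of x "A k" "B k" "C k"] elim x
      by (intro mult_left_mono) (auto simp: field_simps)
    finally show ?case using N(1) by (auto simp: mult.commute)
  qed
qed

text \<open>The terms concentrate at \<open>n\<close> about \<open>\<rho> * w k\<close>, where the
  weight \<open>u k / (u k + n)\<close> is close to the limit. The weight lies between 0 and 1 and
  decreases in \<open>n\<close>, so the lower bound uses only the upper tail and the upper bound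
  only the lower tail.\<close>

lemma mean_limit:
  assumes u: "(\<lambda>k. u k / w k) \<longlonglongrightarrow> \<mu>" and \<mu>: "\<mu> > 0"
  shows "(\<lambda>k. (\<Sum>n. u k / (u k + real n) * t k n) / S k) \<longlonglongrightarrow> \<mu> / (\<mu> + \<rho>)"
proof -
  define E where "E k = (\<Sum>n. u k / (u k + real n) * t k n)" for k
  have u_pos: "\<forall>\<^sub>F k in sequentially. u k > 0"
    using order_tendstoD(1)[OF u \<mu>] ev_w[of 0] by eventually_elim (simp add: zero_less_divide_iff)
  have \<phi>_lim: "(\<lambda>k. u k / (u k + y * w k)) \<longlonglongrightarrow> \<mu> / (\<mu> + y)" if "y > 0" for y
  proof -
    have "(\<lambda>k. (u k / w k) / (u k / w k + y)) \<longlonglongrightarrow> \<mu> / (\<mu> + y)"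
      using that \<mu> by (intro tendsto_intros u) auto
    moreover have "\<forall>\<^sub>F k in sequentially. (u k / w k) / (u k / w k + y) = u k / (u k + y * w k)"
      using ev_w[of 0] u_pos by eventually_elim (use that in \<open>simp add: divide_simps add_pos_pos\<close>)
    ultimately show ?thesis by (rule Lim_transform_eventually)
  qed
  have props: "\<forall>\<^sub>F k in sequentially. u k > 0 \<and> w k > 0 \<and> S k > 0 \<and> (\<forall>n. t k n > 0) \<and> summable (t k) \<and>
      summable (\<lambda>n. u k / (u k + real n) * t k n)"
    using u_pos ev_pos
  proof eventually_elim
    case (elim k)
    have tp: "t k n > 0" for n using rhyp_term_pos[of x "A k" "B k" "C k" n] elim x by simp
    have sm: "summable (t k)" using rhyp_props(1)[of x "C k" "A k" "B k"] elim x by simp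
    have "norm (u k / (u k + real n) * t k n) \<le> t k n" for n
      using tp[of n] elim by (simp add: abs_mult mult_le_cancel_right1 divide_le_eq)
    then have "summable (\<lambda>n. u k / (u k + real n) * t k n)"
      by (intro summable_comparison_test[OF _ sm]) auto
    then show ?case using tp sm elim x rhyp_pos[of x "A k" "B k" "C k"] by auto
  qed
  have lower: "\<forall>\<^sub>F k in sequentially. u k / (u k + (\<rho> + \<epsilon>) * w k) * (1 - \<epsilon>) \<le> E k / S k"
    if "0 < \<epsilon>" for \<epsilon>
    using props upper_tail[OF that]
  proof eventually_elim
    case (elim k)
    then obtain N where N: "real N \<le> (\<rho> + \<epsilon>) * w k" "(\<Sum>n. t k (n + N)) \<le> \<epsilon> * S k" by blast
    define \<phi> where "\<phi> = u k / (u k + (\<rho> + \<epsilon>) * w k)"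
    have \<phi>: "\<phi> \<ge> 0" using elim \<rho> that by (simp add: \<phi>_def)
    have "S k = (\<Sum>n. t k (n + N)) + (\<Sum>n<N. t k n)"
      unfolding rhyp_def using elim by (intro suminf_split_initial_segment) auto
    with N have "(1 - \<epsilon>) * S k \<le> (\<Sum>n<N. t k n)" by (simp add: algebra_simps)
    then have "\<phi> * ((1 - \<epsilon>) * S k) \<le> \<phi> * (\<Sum>n<N. t k n)" using \<phi> by (rule mult_left_mono)
    also have "\<dots> \<le> (\<Sum>n<N. u k / (u k + real n) * t k n)"
      unfolding sum_distrib_left
    proof (intro sum_mono mult_right_mono)
      fix n assume "n \<in> {..<N}"
      then have "real n \<le> (\<rho> + \<epsilon>) * w k" using N(1) by simp
      then show "\<phi> \<le> u k / (u k + real n)" unfolding \<phi>_def using elim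
        by (intro divide_left_mono) (auto intro!: mult_pos_pos add_pos_nonneg)
      show "0 \<le> t k n" using elim less_imp_le by blast
    qed
    also have "\<dots> \<le> E k"
      unfolding E_def using elim by (intro sum_le_suminf) (auto intro!: mult_nonneg_nonneg less_imp_le)
    finally show ?case using elim unfolding \<phi>_def[symmetric] by (simp add: le_divide_eq mult.assoc)
  qed
  have upper: "\<forall>\<^sub>F k in sequentially. E k / S k \<le> u k / (u k + (\<rho> - \<epsilon>) * w k) + \<epsilon>"
    if "0 < \<epsilon>" "\<epsilon> < \<rho>" for \<epsilon>
    using props lower_tail[OF that]
  proof eventually_elim
    case (elim k)
    then obtain N where N: "real N \<ge> (\<rho> - \<epsilon>) * w k" "(\<Sum>n<N. t k n) \<le> \<epsilon> * S k" by blast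
    define \<phi> where "\<phi> = u k / (u k + (\<rho> - \<epsilon>) * w k)"
    have \<phi>: "\<phi> \<ge> 0" using elim that by (simp add: \<phi>_def)
    have "(\<Sum>n<N. u k / (u k + real n) * t k n) \<le> (\<Sum>n<N. 1 * t k n)"
      using elim by (intro sum_mono mult_right_mono) (auto intro: less_imp_le simp: divide_le_eq)
    also have "\<dots> \<le> \<epsilon> * S k" using N by simp
    finally have 1: "(\<Sum>n<N. u k / (u k + real n) * t k n) \<le> \<epsilon> * S k" .
    have sm: "summable (\<lambda>n. t k (n + N))" "summable (\<lambda>n. u k / (u k + real (n + N)) * t k (n + N))"
      using elim summable_ignore_initial_segment[of "t k" N]
        summable_ignore_initial_segment[of "\<lambda>n. u k / (u k + real n) * t k n" N] by auto
    have "(\<Sum>n. u k / (u k + real (n + N)) * t k (n + N)) \<le> (\<Sum>n. \<phi> * t k (n + N))"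
    proof (intro suminf_le mult_right_mono summable_mult sm)
      fix n
      have "(\<rho> - \<epsilon>) * w k \<le> real (n + N)" using N(1) by simp
      moreover have "(\<rho> - \<epsilon>) * w k > 0" using that elim by simp
      ultimately show "u k / (u k + real (n + N)) \<le> \<phi>" unfolding \<phi>_def using elim
        by (intro divide_left_mono) (auto intro!: mult_pos_pos add_pos_nonneg)
      show "0 \<le> t k (n + N)" using elim less_imp_le by blast
    qed
    also have "\<dots> = \<phi> * (\<Sum>n. t k (n + N))" using sm by (intro suminf_mult)
    also have "\<dots> \<le> \<phi> * S k"
    proof (rule mult_left_mono[OF _ \<phi>])
      have "S k = (\<Sum>n. t k (n + N)) + (\<Sum>n<N. t k n)"
        unfolding rhyp_def using elim by (intro suminf_split_initial_segment) auto
      moreover have "(\<Sum>n<N. t k n) \<ge> 0" using elim by (intro sum_nonneg) (auto intro: less_imp_le)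
      ultimately show "(\<Sum>n. t k (n + N)) \<le> S k" by simp
    qed
    finally have 2: "(\<Sum>n. u k / (u k + real (n + N)) * t k (n + N)) \<le> \<phi> * S k" .
    have "E k = (\<Sum>n. u k / (u k + real (n + N)) * t k (n + N)) + (\<Sum>n<N. u k / (u k + real n) * t k n)"
      unfolding E_def using elim by (intro suminf_split_initial_segment) auto
    with 1 2 have "E k \<le> (\<phi> + \<epsilon>) * S k" by (simp add: algebra_simps)
    then show ?case using elim unfolding \<phi>_def[symmetric] by (simp add: divide_le_eq)
  qed
  have "(\<lambda>k. E k / S k) \<longlonglongrightarrow> \<mu> / (\<mu> + \<rho>)"
  proof (rule order_tendstoI)
    fix l assume l: "l < \<mu> / (\<mu> + \<rho>)"
    have "((\<lambda>\<epsilon>. \<mu> / (\<mu> + (\<rho> + \<epsilon>)) * (1 - \<epsilon>)) \<longlongrightarrow> \<mu> / (\<mu> + (\<rho> + 0)) * (1 - 0)) (at_right 0)"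
      using \<mu> \<rho> by (intro tendsto_intros) auto
    then have "\<forall>\<^sub>F \<epsilon> in at_right 0. \<mu> / (\<mu> + (\<rho> + \<epsilon>)) * (1 - \<epsilon>) > l"
      by (rule order_tendstoD) (use l in simp)
    moreover have "\<forall>\<^sub>F \<epsilon> in at_right 0. \<epsilon> \<in> {0<..<\<rho>}" by (rule eventually_at_right_real) (rule \<rho>)
    ultimately have "\<forall>\<^sub>F \<epsilon> in at_right 0. \<mu> / (\<mu> + (\<rho> + \<epsilon>)) * (1 - \<epsilon>) > l \<and> \<epsilon> \<in> {0<..<\<rho>}"
      by eventually_elim simp
    then obtain \<epsilon> where \<epsilon>: "\<mu> / (\<mu> + (\<rho> + \<epsilon>)) * (1 - \<epsilon>) > l" "\<epsilon> > 0"
      using eventually_happens' trivial_limit_at_right_real by (metis (mono_tags, lifting) greaterThanLessThan_iff)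
    have "(\<lambda>k. u k / (u k + (\<rho> + \<epsilon>) * w k) * (1 - \<epsilon>)) \<longlonglongrightarrow> \<mu> / (\<mu> + (\<rho> + \<epsilon>)) * (1 - \<epsilon>)"
      using \<epsilon> \<rho> by (intro tendsto_intros \<phi>_lim) auto
    from order_tendstoD(1)[OF this \<epsilon>(1)] lower[OF \<epsilon>(2)]
    show "\<forall>\<^sub>F k in sequentially. E k / S k > l" by eventually_elim simp
  next
    fix l assume l: "l > \<mu> / (\<mu> + \<rho>)"
    have "((\<lambda>\<epsilon>. \<mu> / (\<mu> + (\<rho> - \<epsilon>)) + \<epsilon>) \<longlongrightarrow> \<mu> / (\<mu> + (\<rho> - 0)) + 0) (at_right 0)"
      using \<mu> \<rho> by (intro tendsto_intros) auto
    then have "\<forall>\<^sub>F \<epsilon> in at_right 0. \<mu> / (\<mu> + (\<rho> - \<epsilon>)) + \<epsilon> < l"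
      by (rule order_tendstoD) (use l in simp)
    moreover have "\<forall>\<^sub>F \<epsilon> in at_right 0. \<epsilon> \<in> {0<..<\<rho>}" by (rule eventually_at_right_real) (rule \<rho>)
    ultimately have "\<forall>\<^sub>F \<epsilon> in at_right 0. \<mu> / (\<mu> + (\<rho> - \<epsilon>)) + \<epsilon> < l \<and> \<epsilon> \<in> {0<..<\<rho>}"
      by eventually_elim simp
    then obtain \<epsilon> where \<epsilon>: "\<mu> / (\<mu> + (\<rho> - \<epsilon>)) + \<epsilon> < l" "\<epsilon> > 0" "\<epsilon> < \<rho>"
      using eventually_happens' trivial_limit_at_right_real by (metis (mono_tags, lifting) greaterThanLessThan_iff)
    have "(\<lambda>k. u k / (u k + (\<rho> - \<epsilon>) * w k) + \<epsilon>) \<longlonglongrightarrow> \<mu> / (\<mu> + (\<rho> - \<epsilon>)) + \<epsilon>"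
      using \<epsilon> \<rho> by (intro tendsto_intros \<phi>_lim) auto
    from order_tendstoD(2)[OF this \<epsilon>(1)] upper[OF \<epsilon>(2,3)]
    show "\<forall>\<^sub>F k in sequentially. E k / S k < l" by eventually_elim simp
  qed
  then show ?thesis by (simp add: E_def)
qed

lemma shift:
  "large_params x p q r \<rho> w (\<lambda>k. A k + i) (\<lambda>k. B k + j) (\<lambda>k. C k + l)"
proof -
  have *: "(\<lambda>k. (U k + i) / w k) \<longlonglongrightarrow> z" if "(\<lambda>k. U k / w k) \<longlonglongrightarrow> z" for U :: "nat \<Rightarrow> real" and z i :: real
  proof -
    have "(\<lambda>k. i / w k) \<longlonglongrightarrow> 0"
      using w by (intro tendsto_divide_0[OF tendsto_const] filterlim_at_top_imp_at_infinity)
    from tendsto_add[OF that this] show ?thesis by (simp add: add_divide_distrib)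
  qed
  show ?thesis
    by unfold_locales (use x pqr \<rho> root w A B C * in auto)
qed

lemma swap: "large_params x q p r \<rho> w B A C"
  by unfold_locales (use x pqr \<rho> root w A B C in \<open>auto simp: mult_ac\<close>)

lemma ev_S_pos: "\<forall>\<^sub>F k in sequentially. S k > 0"
  using ev_pos by eventually_elim (use x in \<open>auto intro: rhyp_pos\<close>)

end

section \<open>Limits of ratios of series under integer shifts of the parameters\<close>

lemma rhyp_term_num:
  assumes "0 < a"
  shows "rhyp_term x a b c n = a / (a + n) * rhyp_term x (a + 1) b c n"
proof -
  have "pochhammer a n * (a + n) = a * pochhammer (a + 1) n"
    using pochhammer_Suc[of a n] pochhammer_rec[of a n] by simp
  then have "pochhammer a n = a / (a + n) * pochhammer (a + 1) n"
    using assms by (simp add: field_simps)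
  then show ?thesis by (simp add: rhyp_term_def)
qed

lemma rhyp_term_den:
  assumes "0 < c"
  shows "rhyp_term x a b (c + 1) n = c / (c + n) * rhyp_term x a b c n"
proof -
  have p: "pochhammer c n * (c + n) = c * pochhammer (c + 1) n"
    using pochhammer_Suc[of c n] pochhammer_rec[of c n] by simp
  have pos: "pochhammer c n > 0" "pochhammer (c + 1) n > 0" using assms by (auto intro!: pochhammer_pos)
  have e: "1 / pochhammer (c + 1) n = c / (c + n) * (1 / pochhammer c n)"
    using p pos assms by (simp add: divide_simps) (simp add: algebra_simps)
  have r: "rhyp_term x a b d n = pochhammer a n * pochhammer b n * (1 / pochhammer d n) / fact n * x ^ n" for d
    by (simp add: rhyp_term_def)
  show ?thesis unfolding r[of "c + 1"] e r[of c] by (simp add: mult_ac)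
qed

lemma rhyp_commute: "rhyp x a b c = rhyp x b a c"
  by (simp add: rhyp_def rhyp_term_def[abs_def] mult_ac)

context large_params
begin

text \<open>The mean is taken over the series with the raised parameter, for which the weight
  \<open>A k / (A k + n)\<close> is bounded, and the limit is then inverted; the weight in the
  direct direction would be unbounded.\<close>

lemma ratio_num: "(\<lambda>k. rhyp x (A k + 1) (B k) (C k) / S k) \<longlonglongrightarrow> (p + \<rho>) / p"
proof -
  interpret L: large_params x p q r \<rho> w "\<lambda>k. A k + 1" B C
    using shift[of 1 0 0] by simp
  have "(\<lambda>k. (\<Sum>n. A k / (A k + real n) * L.t k n) / L.S k) \<longlonglongrightarrow> p / (p + \<rho>)"
    by (rule L.mean_limit[OF A pqr(1)])
  moreover have "\<forall>\<^sub>F k in sequentially. (\<Sum>n. A k / (A k + real n) * L.t k n) / L.S k = S k / L.S k"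
    using ev_pos
  proof eventually_elim
    case (elim k)
    then have "(\<lambda>n. A k / (A k + real n) * L.t k n) = t k"
      by (intro ext rhyp_term_num[symmetric]) simp
    then show ?case by (simp only: rhyp_def)
  qed
  ultimately have "(\<lambda>k. S k / L.S k) \<longlonglongrightarrow> p / (p + \<rho>)" by (rule Lim_transform_eventually)
  then have "(\<lambda>k. inverse (S k / L.S k)) \<longlonglongrightarrow> inverse (p / (p + \<rho>))"
    using pqr \<rho> by (intro tendsto_inverse) auto
  then show ?thesis by simp
qed

lemma ratio_den: "(\<lambda>k. rhyp x (A k) (B k) (C k + 1) / S k) \<longlonglongrightarrow> r / (r + \<rho>)"
proof -
  have "(\<lambda>k. (\<Sum>n. C k / (C k + real n) * t k n) / S k) \<longlonglongrightarrow> r / (r + \<rho>)"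
    by (rule mean_limit[OF C pqr(3)])
  moreover have "\<forall>\<^sub>F k in sequentially. (\<Sum>n. C k / (C k + real n) * t k n) / S k = rhyp x (A k) (B k) (C k + 1) / S k"
    using ev_pos
  proof eventually_elim
    case (elim k)
    then have "(\<lambda>n. C k / (C k + real n) * t k n) = rhyp_term x (A k) (B k) (C k + 1)"
      by (intro ext rhyp_term_den[symmetric]) simp
    then show ?case by (simp only: rhyp_def)
  qed
  ultimately show ?thesis by (rule Lim_transform_eventually)
qed

lemma ratio_num_pow: "(\<lambda>k. rhyp x (A k + real i) (B k) (C k) / S k) \<longlonglongrightarrow> ((p + \<rho>) / p) ^ i"
proof (induction i)
  case 0
  have "\<forall>\<^sub>F k in sequentially. 1 = S k / S k" using ev_S_pos by eventually_elim simp
  then show ?case by (simp add: tendsto_eventually eventually_mono)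
next
  case (Suc i)
  interpret L: large_params x p q r \<rho> w "\<lambda>k. A k + real i" B C
    using shift[of "real i" 0 0] by simp
  have "(\<lambda>k. (rhyp x (A k + real i + 1) (B k) (C k) / L.S k) * (L.S k / S k)) \<longlonglongrightarrow> (p + \<rho>) / p * ((p + \<rho>) / p) ^ i"
    by (intro tendsto_mult L.ratio_num Suc)
  moreover have "\<forall>\<^sub>F k in sequentially. (rhyp x (A k + real i + 1) (B k) (C k) / L.S k) * (L.S k / S k) =
     rhyp x (A k + real (Suc i)) (B k) (C k) / S k"
    using L.ev_S_pos by eventually_elim (simp add: add_ac)
  ultimately show ?case by (simp add: Lim_transform_eventually)
qed

lemma ratio_den_pow: "(\<lambda>k. rhyp x (A k) (B k) (C k + real i) / S k) \<longlonglongrightarrow> (r / (r + \<rho>)) ^ i"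
proof (induction i)
  case 0
  have "\<forall>\<^sub>F k in sequentially. 1 = S k / S k" using ev_S_pos by eventually_elim simp
  then show ?case by (simp add: tendsto_eventually eventually_mono)
next
  case (Suc i)
  interpret L: large_params x p q r \<rho> w A B "\<lambda>k. C k + real i"
    using shift[of 0 0 "real i"] by simp
  have "(\<lambda>k. (rhyp x (A k) (B k) (C k + real i + 1) / L.S k) * (L.S k / S k)) \<longlonglongrightarrow> r / (r + \<rho>) * (r / (r + \<rho>)) ^ i"
    by (intro tendsto_mult L.ratio_den Suc)
  moreover have "\<forall>\<^sub>F k in sequentially. (rhyp x (A k) (B k) (C k + real i + 1) / L.S k) * (L.S k / S k) =
     rhyp x (A k) (B k) (C k + real (Suc i)) / S k"
    using L.ev_S_pos by eventually_elim (simp add: add_ac)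
  ultimately show ?case by (simp add: Lim_transform_eventually)
qed

theorem ratio_shift:
  "(\<lambda>k. rhyp x (A k + real i) (B k + real j) (C k + real l) / S k) \<longlonglongrightarrow>
     ((p + \<rho>) / p) ^ i * ((q + \<rho>) / q) ^ j * (r / (r + \<rho>)) ^ l"
proof -
  interpret L1: large_params x p q r \<rho> w "\<lambda>k. A k + real i" B C
    using shift[of "real i" 0 0] by simp
  interpret L2: large_params x p q r \<rho> w "\<lambda>k. A k + real i" "\<lambda>k. B k + real j" C
    using shift[of "real i" "real j" 0] by simp
  interpret L1': large_params x q p r \<rho> w B "\<lambda>k. A k + real i" C
    by (rule L1.swap)
  have B': "(\<lambda>k. L2.S k / L1.S k) \<longlonglongrightarrow> ((q + \<rho>) / q) ^ j"
    using L1'.ratio_num_pow[of j] by (simp add: rhyp_commute)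
  have "(\<lambda>k. (L1.S k / S k) * (L2.S k / L1.S k) * (rhyp x (A k + real i) (B k + real j) (C k + real l) / L2.S k))
     \<longlonglongrightarrow> ((p + \<rho>) / p) ^ i * ((q + \<rho>) / q) ^ j * (r / (r + \<rho>)) ^ l"
    by (intro tendsto_mult ratio_num_pow B' L2.ratio_den_pow)
  moreover have "\<forall>\<^sub>F k in sequentially. (L1.S k / S k) * (L2.S k / L1.S k) *
     (rhyp x (A k + real i) (B k + real j) (C k + real l) / L2.S k) =
     rhyp x (A k + real i) (B k + real j) (C k + real l) / S k"
    using L1.ev_S_pos L2.ev_S_pos by eventually_elim simp
  ultimately show ?thesis by (rule Lim_transform_eventually)
qed

end

section \<open>Limits of rational functions at infinity\<close>

lemma poly_ratio_tendsto_0: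
  fixes e d :: "complex poly"
  assumes d: "d \<noteq> 0" and z: "filterlim z at_infinity sequentially"
    and lim: "(\<lambda>k. poly e (z k) / poly d (z k)) \<longlonglongrightarrow> 0"
  shows "e = 0 \<or> degree e < degree d"
proof (rule ccontr)
  assume *: "\<not> (e = 0 \<or> degree e < degree d)"
  then have e: "e \<noteq> 0" and deg: "degree d \<le> degree e" by auto
  have lead: "(\<lambda>k. poly g (z k) / z k ^ degree g) \<longlonglongrightarrow> lead_coeff g" for g :: "complex poly"
    using filterlim_compose[OF poly_divide_tendsto_aux z] .
  have "(\<lambda>k. (poly d (z k) / z k ^ degree d) / (poly e (z k) / z k ^ degree e)) \<longlonglongrightarrow> lead_coeff d / lead_coeff e"
    using e by (intro tendsto_divide lead) auto
  from tendsto_mult[OF lim this]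
  have l0: "(\<lambda>k. (poly e (z k) / poly d (z k)) * ((poly d (z k) / z k ^ degree d) / (poly e (z k) / z k ^ degree e))) \<longlonglongrightarrow> 0"
    by simp
  have nz: "\<forall>\<^sub>F k in sequentially. poly g (z k) \<noteq> 0" if "g \<noteq> 0" for g :: "complex poly"
  proof -
    have "\<forall>\<^sub>F k in sequentially. poly g (z k) / z k ^ degree g \<noteq> 0"
      using lead[of g] that by (intro tendsto_imp_eventually_ne) auto
    then show ?thesis by eventually_elim auto
  qed
  have "\<forall>\<^sub>F k in sequentially. norm (z k) \<ge> 1"
    using z by (auto simp: filterlim_at_infinity[OF order_refl])
  with nz[OF d] nz[OF e]
  have "\<forall>\<^sub>F k in sequentially. norm ((poly e (z k) / poly d (z k)) * ((poly d (z k) / z k ^ degree d) / (poly e (z k) / z k ^ degree e))) \<ge> 1"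
  proof eventually_elim
    case (elim k)
    have "z k \<noteq> 0" using elim by auto
    then have "(poly e (z k) / poly d (z k)) * ((poly d (z k) / z k ^ degree d) / (poly e (z k) / z k ^ degree e)) =
      z k ^ (degree e - degree d)"
      using elim deg by (simp add: power_diff)
    then show ?case using elim by (simp add: norm_power one_le_power)
  qed
  moreover have "\<forall>\<^sub>F k in sequentially. norm ((poly e (z k) / poly d (z k)) * ((poly d (z k) / z k ^ degree d) / (poly e (z k) / z k ^ degree e))) < 1"
    using order_tendstoD(2)[OF tendsto_norm[OF l0], of 1] by simp
  ultimately have "\<forall>\<^sub>F k in sequentially. False" by eventually_elim simp
  then show False by simp
qed

text \<open>For a rational function a limit along a single sequence to infinity already bounds the
  degrees, hence is the limit at infinity in all directions. This is how values at the two ends of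
  the real axis are compared.\<close>

lemma poly_ratio_tendsto_at_infinity:
  fixes n d :: "complex poly"
  assumes d: "d \<noteq> 0" and z: "filterlim z at_infinity sequentially"
    and lim: "(\<lambda>k. poly n (z k) / poly d (z k)) \<longlonglongrightarrow> c"
  shows "((\<lambda>w. poly n w / poly d w) \<longlongrightarrow> c) at_infinity"
    and "n - smult c d = 0 \<or> degree (n - smult c d) < degree d"
proof -
  define e where "e = n - smult c d"
  have ev: "\<forall>\<^sub>F w in at_infinity. poly d w \<noteq> 0"
  proof -
    have "((\<lambda>w. poly d w / w ^ degree d) \<longlongrightarrow> lead_coeff d) at_infinity" by (rule poly_divide_tendsto_aux)
    then have "\<forall>\<^sub>F w in at_infinity. poly d w / w ^ degree d \<noteq> 0"
      using d by (intro tendsto_imp_eventually_ne) auto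
    then show ?thesis by eventually_elim auto
  qed
  have ez: "\<forall>\<^sub>F w in at_infinity. poly n w / poly d w - c = poly e w / poly d w"
    using ev by eventually_elim (simp add: e_def field_simps)
  have "(\<lambda>k. poly n (z k) / poly d (z k) - c) \<longlonglongrightarrow> 0"
    using lim by (simp add: LIM_zero)
  moreover have "\<forall>\<^sub>F k in sequentially. poly n (z k) / poly d (z k) - c = poly e (z k) / poly d (z k)"
    using ez z by (rule eventually_compose_filterlim)
  ultimately have "(\<lambda>k. poly e (z k) / poly d (z k)) \<longlonglongrightarrow> 0" by (rule Lim_transform_eventually)
  from poly_ratio_tendsto_0[OF d z this]
  show *: "n - smult c d = 0 \<or> degree (n - smult c d) < degree d" by (simp add: e_def)
  have "((\<lambda>w. poly e w / poly d w) \<longlongrightarrow> 0) at_infinity"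
    using * poly_divide_tendsto_0_at_infinity[of e d] by (auto simp: e_def)
  moreover have "\<forall>\<^sub>F w in at_infinity. poly e w / poly d w = poly n w / poly d w - c"
    using ez by eventually_elim simp
  ultimately have "((\<lambda>w. poly n w / poly d w - c) \<longlongrightarrow> 0) at_infinity" by (rule Lim_transform_eventually)
  then show "((\<lambda>w. poly n w / poly d w) \<longlongrightarrow> c) at_infinity" by (rule LIM_zero_cancel)
qed

lemma pochhammer_asymp:
  fixes u w :: "nat \<Rightarrow> real"
  assumes "(\<lambda>k. u k / w k) \<longlonglongrightarrow> \<mu>" "filterlim w at_top sequentially"
  shows "(\<lambda>k. pochhammer (u k) n / w k ^ n) \<longlonglongrightarrow> \<mu> ^ n"
proof (induction n)
  case (Suc n)
  have "(\<lambda>k. real n / w k) \<longlonglongrightarrow> 0"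
    using assms(2) by (intro tendsto_divide_0[OF tendsto_const] filterlim_at_top_imp_at_infinity)
  from tendsto_mult[OF Suc tendsto_add[OF assms(1) this]]
  have "(\<lambda>k. pochhammer (u k) n / w k ^ n * (u k / w k + real n / w k)) \<longlonglongrightarrow> \<mu> ^ Suc n"
    by (simp add: mult.commute)
  moreover have "pochhammer (u k) n / w k ^ n * (u k / w k + real n / w k) = pochhammer (u k) (Suc n) / w k ^ Suc n" for k
    by (simp add: pochhammer_Suc add_divide_distrib[symmetric] mult.commute)
  ultimately show ?case by simp
qed simp

section \<open>The characteristic equation\<close>

text \<open>The roots of the quadratic equation in the locale \<open>large_params\<close>;
  \<open>s\<close> is the sign of the square root.\<close>

definition char_root :: "real \<Rightarrow> nat \<Rightarrow> nat \<Rightarrow> nat \<Rightarrow> real \<Rightarrow> real" where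
  "char_root s p q r x = ((real p + real q) * x - real r + s * sqrt (hyp_Delta p q r x)) / (2 * (1 - x))"

text \<open>Up to a factor depending only on \<open>p\<close>, \<open>q\<close>, \<open>r\<close>,
  the limit of \<open>R\<close> at the end of the real axis governed by the root
  \<open>\<rho>\<close>.\<close>

definition growth :: "nat \<Rightarrow> nat \<Rightarrow> nat \<Rightarrow> real \<Rightarrow> real" where
  "growth p q r \<rho> = (\<rho> + p) ^ p * (\<rho> + q) ^ q / (\<rho> + r) ^ r"

lemma hyp_Delta_eq:
  "hyp_Delta p q r x = (real r - (real p + real q) * x) ^ 2 + 4 * real p * real q * x * (1 - x)"
  by (simp add: hyp_Delta_def power2_eq_square algebra_simps)

text \<open>Euler's transformation replaces \<open>p\<close>, \<open>q\<close> by
  \<open>r - p\<close>, \<open>r - q\<close>; the invariance transfers estimates for one root to the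
  other.\<close>

lemma hyp_Delta_dual:
  assumes "p \<le> r" "q \<le> r"
  shows "hyp_Delta (r - p) (r - q) r x = hyp_Delta p q r x"
  using assms by (simp add: hyp_Delta_def of_nat_diff power2_eq_square algebra_simps)

lemma hyp_Delta_pos:
  assumes "0 < p" "0 < q" "0 < x" "x < 1"
  shows "(real r - (real p + real q) * x) ^ 2 < hyp_Delta p q r x" "0 < hyp_Delta p q r x"
proof -
  have "4 * real p * real q * x * (1 - x) > 0" using assms by simp
  then show "(real r - (real p + real q) * x) ^ 2 < hyp_Delta p q r x" unfolding hyp_Delta_eq by simp
  then show "0 < hyp_Delta p q r x" by (smt (verit) zero_le_power2)
qed

lemma hyp_Delta_pos':
  assumes "p \<le> r" "q \<le> r" "0 < r" "0 \<le> x" "x < 1"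
  shows "0 < hyp_Delta p q r x"
proof -
  have a: "4 * real p * real q * x * (1 - x) \<ge> 0" using assms by simp
  show ?thesis
  proof (cases "4 * real p * real q * x * (1 - x) = 0")
    case True
    have "real r - (real p + real q) * x \<noteq> 0"
    proof (cases "x = 0")
      case False
      then have "p = 0 \<or> q = 0" using True assms by auto
      then have "(real p + real q) * x \<le> real r * x" using assms by (intro mult_right_mono) auto
      also have "\<dots> < real r" using assms by simp
      finally show ?thesis by simp
    qed (use assms in simp)
    then show ?thesis unfolding hyp_Delta_eq True by simp
  next
    case False
    with a show ?thesis unfolding hyp_Delta_eq by (smt (verit) zero_le_power2)
  qed
qed

context
  fixes p q r :: nat and x :: real
  assumes pq: "0 < p" "0 < q" "p + q \<le> r" and x: "0 < x" "x < 1"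
begin

lemma sqrt_Delta: "sqrt (hyp_Delta p q r x) ^ 2 = hyp_Delta p q r x" "sqrt (hyp_Delta p q r x) > 0"
  using hyp_Delta_pos(2)[OF pq(1,2) x, of r] by simp_all

lemma char_root_eq:
  assumes "s \<in> {1, - 1}"
  shows "char_root s p q r x * (char_root s p q r x + r) = x * (char_root s p q r x + p) * (char_root s p q r x + q)"
proof -
  define S where "S = s * sqrt (hyp_Delta p q r x)"
  define \<rho> where "\<rho> = char_root s p q r x"
  have S: "S ^ 2 = hyp_Delta p q r x" using assms sqrt_Delta by (auto simp: S_def power_mult_distrib)
  have "2 * (1 - x) * \<rho> = (real p + real q) * x - real r + S" using x by (simp add: \<rho>_def char_root_def S_def)
  then have "(2 * (1 - x) * \<rho> + real r - (real p + real q) * x) ^ 2 = hyp_Delta p q r x" using S by simp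
  then have "4 * (1 - x) * (\<rho> * (\<rho> + r) - x * (\<rho> + p) * (\<rho> + q)) = 0"
    unfolding hyp_Delta_eq by (simp add: power2_eq_square algebra_simps)
  then show ?thesis using x by (simp add: \<rho>_def)
qed

lemma char_root_pos: "char_root 1 p q r x > 0"
proof -
  have "\<bar>real r - (real p + real q) * x\<bar> < sqrt (hyp_Delta p q r x)"
    using hyp_Delta_pos(1)[OF pq(1,2) x, of r] by (metis real_sqrt_abs real_sqrt_less_iff)
  then show ?thesis using x unfolding char_root_def by (intro divide_pos_pos) auto
qed

text \<open>With \<open>\<rho>\<close> the root in question, \<open>- (\<rho> + r)\<close> is the
  positive root for the dual parameters \<open>r - p\<close> and \<open>r - q\<close>, so this is
  the dual of \<open>char_root_pos\<close>.\<close>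

lemma char_root_neg: "char_root (- 1) p q r x + r < 0"
proof -
  have "0 < r - p" "0 < r - q" "p \<le> r" "q \<le> r" using pq by auto
  then have "\<bar>real r - (real (r - p) + real (r - q)) * x\<bar> < sqrt (hyp_Delta p q r x)"
    using hyp_Delta_pos(1)[of "r - p" "r - q" x r] x hyp_Delta_dual[of p r q x]
    by (metis real_sqrt_abs real_sqrt_less_iff)
  then have a: "real r - (2 * real r - p - q) * x < sqrt (hyp_Delta p q r x)"
    using pq by (simp add: of_nat_diff algebra_simps)
  have "char_root (- 1) p q r x + r = (real r - (2 * real r - p - q) * x - sqrt (hyp_Delta p q r x)) / (2 * (1 - x))"
    using x by (simp add: char_root_def field_simps)
  also have "\<dots> < 0" using a x by (intro divide_neg_pos) auto
  finally show ?thesis .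
qed

lemma char_root_ne:
  assumes "s \<in> {1, - 1}"
  shows "char_root s p q r x + r \<noteq> 0" "char_root s p q r x + p \<noteq> 0" "char_root s p q r x + q \<noteq> 0"
proof -
  have "real p \<le> r" "real q \<le> r" using pq by auto
  then show "char_root s p q r x + r \<noteq> 0" "char_root s p q r x + p \<noteq> 0" "char_root s p q r x + q \<noteq> 0"
    using assms char_root_pos char_root_neg by auto
qed

text \<open>By the quadratic equation the three factors of \<open>Z\<close> are constants times
  \<open>(\<rho> + r) / (\<rho> + p)\<close>, \<open>(\<rho> + r) / (\<rho> + q)\<close> and
  \<open>\<rho> + r\<close>. Their exponents add up to \<open>r\<close>, so \<open>Z\<close> is a
  constant times the reciprocal of \<open>growth\<close>, with the same constant for both
  signs.\<close>

lemma hyp_Z_growth: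
  assumes "s \<in> {1, - 1}"
  shows "hyp_Z s p q r x * growth p q r (char_root s p q r x) =
    (2 * p) ^ p * (2 * q) ^ q * (- 2 * (1 - x)) ^ (r - p - q)"
proof -
  define S where "S = s * sqrt (hyp_Delta p q r x)"
  define \<rho> where "\<rho> = char_root s p q r x"
  have S: "S ^ 2 = hyp_Delta p q r x" using assms sqrt_Delta by (auto simp: S_def power_mult_distrib)
  have \<rho>: "2 * (1 - x) * \<rho> = (real p + real q) * x - real r + S" using x by (simp add: \<rho>_def char_root_def S_def)
  have ne: "\<rho> + r \<noteq> 0" "\<rho> + p \<noteq> 0" "\<rho> + q \<noteq> 0" using char_root_ne[OF assms] by (simp_all add: \<rho>_def)
  have S': "S = 2 * (1 - x) * \<rho> - (real p + real q) * x + real r" using \<rho> by simp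
  have eq: "\<rho> * (\<rho> + r) = x * (\<rho> + p) * (\<rho> + q)" unfolding \<rho>_def by (rule char_root_eq[OF assms])
  have 1: "(real r + (real p - real q) * x + S) * (\<rho> + p) = 2 * p * (\<rho> + r)"
  proof -
    have "(real r + (real p - real q) * x + S) * (\<rho> + p) - 2 * p * (\<rho> + r) = 2 * (\<rho> * (\<rho> + r) - x * (\<rho> + p) * (\<rho> + q))"
      unfolding S' by (simp add: algebra_simps)
    then show ?thesis unfolding eq by simp
  qed
  have 2: "(real r - (real p - real q) * x + S) * (\<rho> + q) = 2 * q * (\<rho> + r)"
  proof -
    have "(real r - (real p - real q) * x + S) * (\<rho> + q) - 2 * q * (\<rho> + r) = 2 * (\<rho> * (\<rho> + r) - x * (\<rho> + p) * (\<rho> + q))"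
      unfolding S' by (simp add: algebra_simps)
    then show ?thesis unfolding eq by simp
  qed
  have 3: "(2 * real r - real p - real q) * x - real r - S = - 2 * (1 - x) * (\<rho> + r)"
    unfolding S' by (simp add: algebra_simps)
  have rr: "(\<rho> + r) ^ r = (\<rho> + r) ^ p * (\<rho> + r) ^ q * (\<rho> + r) ^ (r - p - q)"
    unfolding power_add[symmetric] using pq by simp
  have "hyp_Z s p q r x * growth p q r \<rho> =
     ((real r + (real p - real q) * x + S) * (\<rho> + p)) ^ p * ((real r - (real p - real q) * x + S) * (\<rho> + q)) ^ q *
     ((2 * real r - real p - real q) * x - real r - S) ^ (r - p - q) / (\<rho> + r) ^ r"
    by (simp add: hyp_Z_def growth_def S_def power_mult_distrib)
  also have "\<dots> = (2 * p) ^ p * (2 * q) ^ q * (- 2 * (1 - x)) ^ (r - p - q)"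
    unfolding 1 2 3 rr power_mult_distrib using ne by simp
  finally show ?thesis by (simp add: \<rho>_def)
qed

lemma hyp_Z_eqI:
  assumes "growth p q r (char_root 1 p q r x) = growth p q r (char_root (- 1) p q r x)"
  shows "hyp_Z 1 p q r x = hyp_Z (- 1) p q r x"
proof -
  have "growth p q r (char_root 1 p q r x) \<noteq> 0"
    using char_root_ne[of 1] by (simp add: growth_def)
  then show ?thesis
    using hyp_Z_growth[of 1] hyp_Z_growth[of "- 1"] assms by (metis insertCI mult_right_cancel)
qed

text \<open>The third factor of \<open>Z\<close> is now absent, and changing the sign of the square
  root strictly decreases the absolute values of the other two, since \<open>u\<close> and
  \<open>v\<close> are positive.\<close>

lemma hyp_Z_ne:
  assumes "r = p + q" "q \<le> p"
  shows "hyp_Z 1 p q r x \<noteq> hyp_Z (- 1) p q r x"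
proof -
  define S where "S = sqrt (hyp_Delta p q r x)"
  have S: "S > 0" using sqrt_Delta by (simp add: S_def)
  define u where "u = real r + (real p - real q) * x"
  define v where "v = real r - (real p - real q) * x"
  have u: "u > 0" unfolding u_def using assms x pq by (intro add_pos_nonneg) auto
  have v: "v > 0"
  proof -
    have "(real p - real q) * x \<le> (real p - real q) * 1" using assms x by (intro mult_left_mono) auto
    then show ?thesis using assms pq by (simp add: v_def)
  qed
  have "\<bar>(u - S) ^ p * (v - S) ^ q\<bar> < (u + S) ^ p * (v + S) ^ q"
    unfolding abs_mult power_abs using u v S pq
    by (intro mult_strict_mono power_strict_mono) auto
  then have "(u - S) ^ p * (v - S) ^ q \<noteq> (u + S) ^ p * (v + S) ^ q" by auto
  then show ?thesis
    using assms(1) by (auto simp: hyp_Z_def u_def v_def S_def)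
qed

end

section \<open>The polynomials X and Y\<close>

text \<open>
  The degree conditions say that \<open>X + s Y \<surd>\<Delta>\<close> has weight at most \<open>m\<close> when \<open>z\<close> and \<open>\<surd>\<Delta>\<close> have
  weight \<open>1\<close>.  If \<open>p = q\<close>, the product of the first two factors of \<open>Z\<close> even has weight \<open>1\<close>, because
  then \<open>\<Delta>\<close> is linear.
\<close>

definition zrep :: "nat \<Rightarrow> nat \<Rightarrow> nat \<Rightarrow> nat \<Rightarrow> (real \<Rightarrow> real \<Rightarrow> real) \<Rightarrow> int poly \<Rightarrow> int poly \<Rightarrow> bool" where
  "zrep p q r m f X Y \<longleftrightarrow> degree X \<le> m \<and> degree (pCons 0 Y) \<le> m \<and>
     (\<forall>z\<in>{0..<1}. \<forall>s\<in>{1, -1}. f s z = poly (map_poly of_int X) z + s * poly (map_poly of_int Y) z * sqrt (hyp_Delta p q r z))"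

definition Delta_poly :: "nat \<Rightarrow> nat \<Rightarrow> nat \<Rightarrow> int poly" where
  "Delta_poly p q r = [:int r ^ 2, - 2 * ((int p + int q) * int r - 2 * int p * int q), (int p - int q) ^ 2:]"

lemma poly_Delta_poly: "poly (map_poly of_int (Delta_poly p q r)) z = hyp_Delta p q r z"
  by (simp add: Delta_poly_def hyp_Delta_def map_poly_pCons power2_eq_square algebra_simps)

lemma map_poly_of_int_add: "map_poly of_int (P + Q) = (map_poly of_int P + map_poly of_int Q :: real poly)"
  by (intro poly_eqI) (simp add: coeff_map_poly)

lemma map_poly_of_int_mult: "map_poly of_int (P * Q) = (map_poly of_int P * map_poly of_int Q :: real poly)"
  by (intro poly_eqI) (simp add: coeff_map_poly coeff_mult)

text \<open>Multiplication of expressions \<open>X + s Y \<surd>\<Delta>\<close>. Weights add up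
  because the degree of \<open>\<Delta>\<close> is at most 2, the weight of the square of
  \<open>\<surd>\<Delta>\<close>.\<close>

lemma zrep_mult:
  assumes pq: "p \<le> r" "q \<le> r" "0 < r"
    and 1: "zrep p q r m f X Y" and 2: "zrep p q r m' f' X' Y'"
  shows "zrep p q r (m + m') (\<lambda>s z. f s z * f' s z) (X * X' + Y * Y' * Delta_poly p q r) (X * Y' + Y * X')"
proof -
  have d: "degree X \<le> m" "degree (pCons 0 Y) \<le> m" "degree X' \<le> m'" "degree (pCons 0 Y') \<le> m'"
    using 1 2 by (auto simp: zrep_def)
  have "degree (Delta_poly p q r) \<le> 2" by (simp add: Delta_poly_def)
  have YY: "degree (Y * Y' * Delta_poly p q r) \<le> m + m'"
  proof (cases "Y = 0 \<or> Y' = 0")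
    case False
    then have "Suc (degree Y) \<le> m" "Suc (degree Y') \<le> m'" using d by auto
    moreover have "degree (Y * Y' * Delta_poly p q r) \<le> degree Y + degree Y' + 2"
      using degree_mult_le[of "Y * Y'" "Delta_poly p q r"] degree_mult_le[of Y Y'] \<open>degree (Delta_poly p q r) \<le> 2\<close>
      by linarith
    ultimately show ?thesis by linarith
  qed auto
  have "degree (X * X') \<le> m + m'" using degree_mult_le[of X X'] d by linarith
  moreover have "degree (pCons 0 (X * Y' + Y * X')) \<le> m + m'"
  proof -
    have "pCons 0 (X * Y' + Y * X') = X * pCons 0 Y' + pCons 0 Y * X'" by (simp add: mult.commute)
    moreover have "degree (X * pCons 0 Y' + pCons 0 Y * X') \<le> m + m'"
      using degree_mult_le[of X "pCons 0 Y'"] degree_mult_le[of "pCons 0 Y" X'] d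
      by (intro degree_add_le) linarith+
    ultimately show ?thesis by simp
  qed
  moreover have "f s z * f' s z = poly (map_poly of_int (X * X' + Y * Y' * Delta_poly p q r)) z +
      s * poly (map_poly of_int (X * Y' + Y * X')) z * sqrt (hyp_Delta p q r z)"
    if "z \<in> {0..<1}" "s \<in> {1, -1}" for z s
  proof -
    have "hyp_Delta p q r z > 0" using that pq by (intro hyp_Delta_pos') auto
    then have D: "sqrt (hyp_Delta p q r z) * sqrt (hyp_Delta p q r z) = hyp_Delta p q r z" by simp
    have s: "s * s = 1" using that by auto
    have "f s z = poly (map_poly of_int X) z + s * poly (map_poly of_int Y) z * sqrt (hyp_Delta p q r z)"
      "f' s z = poly (map_poly of_int X') z + s * poly (map_poly of_int Y') z * sqrt (hyp_Delta p q r z)"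
      using 1 2 that by (auto simp: zrep_def)
    then show ?thesis
      unfolding map_poly_of_int_add map_poly_of_int_mult poly_add poly_mult poly_Delta_poly
      using D s by algebra
  qed
  ultimately show ?thesis
    using YY by (auto simp: zrep_def intro: degree_add_le)
qed

lemma zrep_power:
  assumes pq: "p \<le> r" "q \<le> r" "0 < r" and 1: "zrep p q r m f X Y"
  shows "\<exists>X Y. zrep p q r (n * m) (\<lambda>s z. f s z ^ n) X Y"
proof (induction n)
  case 0
  have "zrep p q r (0 * m) (\<lambda>s z. f s z ^ 0) 1 0"
    by (simp add: zrep_def)
  then show ?case by blast
next
  case (Suc n)
  then obtain X' Y' where "zrep p q r (n * m) (\<lambda>s z. f s z ^ n) X' Y'" by blast
  from zrep_mult[OF pq 1 this] show ?case by (auto simp: add.commute)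
qed

lemma zrep_linear:
  "zrep p q r 1 (\<lambda>s z. real_of_int c + real_of_int d * z + of_int e * s * sqrt (hyp_Delta p q r z)) [:c, d:] [:e:]"
  by (auto simp: zrep_def map_poly_pCons algebra_simps)

lemma is_XY_exists:
  assumes pq: "0 < q" "q \<le> p" "p + q \<le> r"
  obtains X Y where "is_XY p q r X Y" "Y \<noteq> 0" "degree Y \<le> r - 1" "p = q \<Longrightarrow> degree Y \<le> r - p - 1"
proof -
  define n where "n = r - p - q"
  have pr: "p \<le> r" "q \<le> r" "0 < r" using pq by auto
  define f1 where "f1 s z = real r + (real p - real q) * z + s * sqrt (hyp_Delta p q r z)" for s z
  define f2 where "f2 s z = real r - (real p - real q) * z + s * sqrt (hyp_Delta p q r z)" for s z
  define f3 where "f3 s z = (2 * real r - real p - real q) * z - real r - s * sqrt (hyp_Delta p q r z)" for s z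
  have 1: "zrep p q r 1 f1 [:int r, int p - int q:] [:1:]"
    using zrep_linear[of p q r "int r" "int p - int q" 1] by (simp add: f1_def[abs_def])
  have 2: "zrep p q r 1 f2 [:int r, - (int p - int q):] [:1:]"
    using zrep_linear[of p q r "int r" "- (int p - int q)" 1] by (simp add: f2_def[abs_def] algebra_simps)
  have 3: "zrep p q r 1 f3 [:- int r, 2 * int r - int p - int q:] [:- 1:]"
    using zrep_linear[of p q r "- int r" "2 * int r - int p - int q" "- 1"] by (simp add: f3_def[abs_def] algebra_simps)
  have Z: "hyp_Z s p q r z = f1 s z ^ p * f2 s z ^ q * f3 s z ^ n" for s z
    by (simp add: hyp_Z_def f1_def f2_def f3_def n_def)
  have "\<exists>X Y M. zrep p q r M (\<lambda>s z. hyp_Z s p q r z) X Y \<and> M \<le> r \<and> (p = q \<longrightarrow> M \<le> r - p)"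
  proof (cases "p = q")
    case False
    obtain X1 Y1 where "zrep p q r (p * 1) (\<lambda>s z. f1 s z ^ p) X1 Y1" using zrep_power[OF pr 1] by blast
    moreover obtain X2 Y2 where "zrep p q r (q * 1) (\<lambda>s z. f2 s z ^ q) X2 Y2" using zrep_power[OF pr 2] by blast
    moreover obtain X3 Y3 where "zrep p q r (n * 1) (\<lambda>s z. f3 s z ^ n) X3 Y3" using zrep_power[OF pr 3] by blast
    ultimately obtain X Y where "zrep p q r (p * 1 + q * 1 + n * 1) (\<lambda>s z. f1 s z ^ p * f2 s z ^ q * f3 s z ^ n) X Y"
      using zrep_mult[OF pr] by blast
    moreover have "p * 1 + q * 1 + n * 1 \<le> r" using pq by (simp add: n_def)
    ultimately show ?thesis using False unfolding Z by blast
  next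
    case True
    define c where "c = - 2 * ((int p + int q) * int r - 2 * int p * int q)"
    have "zrep p q r 1 (\<lambda>s z. f1 s z * f2 s z) [:2 * int r ^ 2, c:] [:2 * int r:]"
      unfolding zrep_def
    proof (intro conjI ballI)
      fix z s :: real assume zs: "z \<in> {0..<1}" "s \<in> {1, -1}"
      have "hyp_Delta p q r z > 0" using zs pr by (intro hyp_Delta_pos') auto
      then have D: "sqrt (hyp_Delta p q r z) * sqrt (hyp_Delta p q r z) = hyp_Delta p q r z" by simp
      have s: "s * s = 1" using zs by auto
      have "f1 s z * f2 s z = (real r + s * sqrt (hyp_Delta p q r z)) * (real r + s * sqrt (hyp_Delta p q r z))"
        using True by (simp add: f1_def f2_def)
      also have "\<dots> = real r ^ 2 + 2 * real r * s * sqrt (hyp_Delta p q r z) +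
         (s * s) * (sqrt (hyp_Delta p q r z) * sqrt (hyp_Delta p q r z))"
        by (simp add: power2_eq_square algebra_simps)
      also have "\<dots> = real r ^ 2 + 2 * real r * s * sqrt (hyp_Delta p q r z) + hyp_Delta p q r z"
        unfolding D s by simp
      finally have f12: "f1 s z * f2 s z = real r ^ 2 + 2 * real r * s * sqrt (hyp_Delta p q r z) + hyp_Delta p q r z" .
      have Dl: "hyp_Delta p q r z = of_int c * z + real r ^ 2"
      proof -
        have "real p - real q = 0" using True by simp
        then have "hyp_Delta p q r z = real r ^ 2 - 2 * ((real p + real q) * real r - 2 * real p * real q) * z"
          unfolding hyp_Delta_def by (simp only:) simp
        also have "2 * ((real p + real q) * real r - 2 * real p * real q) = - of_int c"
          by (simp add: c_def)
        finally show ?thesis by simp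
      qed
      have "f1 s z * f2 s z = (2 * real r ^ 2 + z * of_int c) + s * (2 * real r) * sqrt (hyp_Delta p q r z)"
        using f12 Dl by (simp add: mult_ac)
      then show "f1 s z * f2 s z = poly (map_poly of_int [:2 * int r ^ 2, c:]) z +
         s * poly (map_poly of_int [:2 * int r:]) z * sqrt (hyp_Delta p q r z)"
        by (simp add: map_poly_pCons)
    qed auto
    then obtain X1 Y1 where "zrep p q r (p * 1) (\<lambda>s z. (f1 s z * f2 s z) ^ p) X1 Y1" using zrep_power[OF pr] by blast
    moreover obtain X3 Y3 where "zrep p q r (n * 1) (\<lambda>s z. f3 s z ^ n) X3 Y3" using zrep_power[OF pr 3] by blast
    ultimately obtain X Y where "zrep p q r (p * 1 + n * 1) (\<lambda>s z. (f1 s z * f2 s z) ^ p * f3 s z ^ n) X Y"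
      using zrep_mult[OF pr] by blast
    moreover have "(f1 s z * f2 s z) ^ p * f3 s z ^ n = hyp_Z s p q r z" for s z
      unfolding Z power_mult_distrib using True by simp
    moreover have "p * 1 + n * 1 \<le> r - p" using True pq by (simp add: n_def)
    moreover have "r - p \<le> r" by simp
    ultimately show ?thesis by (metis (no_types, lifting) order.trans ext)
  qed
  then obtain X Y M where XY: "zrep p q r M (\<lambda>s z. hyp_Z s p q r z) X Y" "M \<le> r" "p = q \<longrightarrow> M \<le> r - p"
    by blast
  have "is_XY p q r X Y" using XY by (simp add: is_XY_def zrep_def)
  \<comment> \<open>At \<open>z = 0\<close> the square root equals \<open>r\<close>, so the minus
    sign makes the first two factors vanish while the plus sign makes no factor vanish.\<close>
  moreover have Y0: "Y \<noteq> 0"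
  proof
    assume "Y = 0"
    then have "hyp_Z 1 p q r 0 = hyp_Z (- 1) p q r 0" using XY by (simp add: zrep_def)
    moreover have "hyp_Z (- 1) p q r 0 = 0" using pq by (simp add: hyp_Z_def hyp_Delta_def)
    moreover have "hyp_Z 1 p q r 0 \<noteq> 0" using pq by (simp add: hyp_Z_def hyp_Delta_def)
    ultimately show False by simp
  qed
  \<comment> \<open>The weight of the square root is counted by \<open>pCons 0 Y\<close>, which
    costs \<open>Y\<close> one degree.\<close>
  moreover have "Suc (degree Y) \<le> M" using XY Y0 by (simp add: zrep_def)
  ultimately show ?thesis using XY by (intro that) auto
qed

section \<open>Behaviour of the quotient at infinity\<close>

lemma hreg_of_real_pos:
  assumes "0 < x" "x < 1" "0 < c"
  shows "hreg (of_real x) (of_real a) (of_real b) (of_real c) = of_real (rGamma c * rhyp x a b c)"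
proof -
  have "complex_of_real c \<notin> \<int>\<^sub>\<le>\<^sub>0"
    using assms(3) nonpos_Ints_nonpos[of c] by (auto simp: of_real_in_nonpos_Ints_iff)
  then show ?thesis
    using hreg_eq_hyp2F1(1)[of "of_real x" "of_real c" "of_real a" "of_real b"]
      rhyp_props(2)[OF assms, of a b] assms by (simp add: rGamma_complex_of_real)
qed

text \<open>The real form of the right-hand side of \<open>hreg_nonpos_int\<close>; up to a nonzero
  factor, a residue of \<open>f\<close>.\<close>

definition rpole :: "real \<Rightarrow> real \<Rightarrow> real \<Rightarrow> nat \<Rightarrow> real" where
  "rpole x a b j = pochhammer a (Suc j) * pochhammer b (Suc j) * x ^ Suc j / fact (Suc j) *
    rhyp x (a + Suc j) (b + Suc j) (real (j + 2))"

lemma hreg_of_real_nonpos_int: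
  assumes "0 < x" "x < 1"
  shows "hreg (of_real x) (of_real a) (of_real b) (- of_nat j) = of_real (rpole x a b j)"
proof -
  have "hyp2F1 (of_real a + of_nat (Suc j)) (of_real b + of_nat (Suc j)) (of_nat (Suc (Suc j))) (of_real x) =
     of_real (rhyp x (a + Suc j) (b + Suc j) (real (j + 2)))"
    using rhyp_props(2)[OF assms, of "real (j + 2)" "a + Suc j" "b + Suc j"] by simp
  then show ?thesis
    using assms by (simp add: hreg_nonpos_int rpole_def pochhammer_of_real del: pochhammer_Suc fact_Suc of_nat_Suc)
qed

section \<open>The rational function \<open>R\<close> at both ends of the real axis\<close>

locale closed_form =
  fixes p q r :: nat and a b x :: real and nn dd :: "complex poly"
  assumes pq: "0 < q" "q \<le> p" "p + q \<le> r"
    and x: "0 < x" "x < 1"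
    and dd: "dd \<noteq> 0"
    and R: "\<forall>\<^sub>\<approx>w\<in>UNIV. hyp_R (of_nat p) (of_nat q) (of_nat r) (of_real a) (of_real b) (of_real x) w =
              poly nn w / poly dd w"
    and poles: "infinite {w. is_pole (hyp_f (of_nat p) (of_nat q) (of_nat r) (of_real a) (of_real b) (of_real x)) w}"
begin

abbreviation "f \<equiv> hyp_f (of_nat p) (of_nat q) (of_nat r) (of_real a) (of_real b) (of_real x)"

text \<open>With \<open>t\<close>, the increments of the upper parameters after Euler's
  transformation.\<close>

definition "s = r - p"
definition "t = r - q"

lemma st: "0 < s" "s \<le> t" "t < r" "r \<le> s + t" "real s = real r - real p" "real t = real r - real q"
  using pq by (auto simp: s_def t_def)

lemma r0: "0 < r" "complex_of_nat r \<noteq> 0" and p0: "0 < p"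
  using pq by auto

lemma normx: "norm (complex_of_real x) < 1"
  using x by simp

definition H :: "complex \<Rightarrow> complex" where
  "H w = hreg (of_real x) (of_nat p * w + of_real a) (of_nat q * w + of_real b) (of_nat r * w)"

lemma isCont_H: "isCont H w"
proof -
  have "H holomorphic_on UNIV"
    unfolding H_def by (intro hreg_holomorphic normx holomorphic_intros)
  then show ?thesis
    by (meson UNIV_I continuous_on_eq_continuous_at holomorphic_on_imp_continuous_on open_UNIV)
qed

text \<open>Clearing denominators and Gamma factors in \<open>R = nn / dd\<close> gives an identity
  near \<open>w\<close>, where the hypothesis keeps \<open>H\<close> from vanishing. By continuity
  it holds at \<open>w\<close> itself, even if \<open>w\<close> is a pole of
  \<open>f\<close>.\<close>

lemma H_relation:
  assumes "H w \<noteq> 0"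
  shows "poly nn w * H w = poly dd w * pochhammer (of_nat r * w) r * H (w + 1)"
proof -
  have ev: "\<forall>\<^sub>F z in at w. poly nn z * H z = poly dd z * pochhammer (of_nat r * z) r * H (z + 1)"
  proof -
    have "\<forall>\<^sub>F z in at w. hyp_R (of_nat p) (of_nat q) (of_nat r) (of_real a) (of_real b) (of_real x) z =
              poly nn z / poly dd z"
      using R by (simp add: eventually_cosparse_open_eq)
    moreover have "\<forall>\<^sub>F z in at w. of_nat r * z \<notin> (\<int>\<^sub>\<le>\<^sub>0 :: complex set)"
      by (rule eventually_not_nonpos_Ints[OF r0(2)])
    moreover have "\<forall>\<^sub>F z in at w. poly dd z \<noteq> 0"
      using poly_roots_finite[OF dd] islimpt_finite[of "{z. poly dd z = 0}" w]
      by (simp add: islimpt_iff_eventually)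
    moreover have "\<forall>\<^sub>F z in at w. H z \<noteq> 0"
      using isCont_H[of w] assms unfolding isCont_def by (rule tendsto_imp_eventually_ne)
    ultimately show ?thesis
    proof eventually_elim
      case (elim z)
      define c where "c = complex_of_nat r * z"
      have c: "c \<notin> \<int>\<^sub>\<le>\<^sub>0" using elim by (simp add: c_def)
      have c': "c + of_nat r \<notin> \<int>\<^sub>\<le>\<^sub>0"
      proof
        assume "c + of_nat r \<in> \<int>\<^sub>\<le>\<^sub>0"
        then obtain k where "c + of_nat r = - of_nat k" by (elim nonpos_Ints_cases')
        then have "c = - of_nat (k + r)" by (simp add: algebra_simps eq_neg_iff_add_eq_0)
        with c show False by (simp del: of_nat_add)
      qed
      have G: "rGamma c \<noteq> 0" "rGamma (c + of_nat r) \<noteq> 0" using c c' by (simp_all add: rGamma_eq_zero_iff)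
      have f: "H z = rGamma c * f z"
        using hreg_eq_hyp2F1(1)[OF normx c] by (simp add: H_def hyp_f_def c_def)
      have e: "of_nat r * (z + 1) = c + of_nat r" by (simp add: c_def algebra_simps)
      have f': "H (z + 1) = rGamma (c + of_nat r) * f (z + 1)"
        using hreg_eq_hyp2F1(1)[OF normx c'] unfolding H_def hyp_f_def e by simp
      have "hyp_R (of_nat p) (of_nat q) (of_nat r) (of_real a) (of_real b) (of_real x) z =
        (H (z + 1) / rGamma (c + of_nat r)) / (H z / rGamma c)"
        unfolding hyp_R_def f f' using G by simp
      also have "\<dots> = pochhammer c r * H (z + 1) / H z"
        using G pochhammer_rGamma[of c r] elim by (simp add: field_simps)
      finally have "poly nn z / poly dd z = pochhammer c r * H (z + 1) / H z" using elim by simp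
      then show ?case using elim by (simp add: field_simps c_def)
    qed
  qed
  have cont: "((\<lambda>z. poly nn z * H z) \<longlongrightarrow> poly nn w * H w) (at w)"
    using isCont_H[of w] unfolding isCont_def by (intro tendsto_intros)
  have H1: "((\<lambda>z. H (z + 1)) \<longlongrightarrow> H (w + 1)) (at w)"
    by (rule isCont_tendsto_compose[OF isCont_H]) (intro tendsto_intros)
  have m1: "((\<lambda>z. poly dd z * pochhammer (of_nat r * z) r * H (z + 1)) \<longlongrightarrow>
     poly dd w * pochhammer (of_nat r * w) r * H (w + 1)) (at w)"
    unfolding pochhammer_prod by (intro tendsto_intros H1)
  have m2: "((\<lambda>z. poly dd z * pochhammer (of_nat r * z) r * H (z + 1)) \<longlongrightarrow> poly nn w * H w) (at w)"
    using cont ev by (rule Lim_transform_eventually)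
  show ?thesis by (rule tendsto_unique[OF at_neq_bot m2 m1])
qed

definition limit_of :: "real \<Rightarrow> real" where
  "limit_of \<rho> = growth p q r \<rho> * real r ^ r / (real p ^ p * real q ^ q)"

lemma filterlim_of_nat_at_infinity: "filterlim (\<lambda>N. complex_of_nat N) at_infinity sequentially"
  by (simp add: filterlim_at_infinity_conv_norm_at_top filterlim_real_sequentially)

lemma ev_poly_ne_0:
  assumes "g \<noteq> 0" "filterlim z at_infinity sequentially"
  shows "\<forall>\<^sub>F k in sequentially. poly g (z k :: complex) \<noteq> 0"
proof -
  have "\<forall>\<^sub>F w in at_infinity. poly g w \<noteq> 0"
  proof -
    have "((\<lambda>w. poly g w / w ^ degree g) \<longlongrightarrow> lead_coeff g) at_infinity" by (rule poly_divide_tendsto_aux)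
    then have "\<forall>\<^sub>F w in at_infinity. poly g w / w ^ degree g \<noteq> 0"
      using assms by (intro tendsto_imp_eventually_ne) auto
    then show ?thesis by eventually_elim auto
  qed
  then show ?thesis using assms(2) by (rule eventually_compose_filterlim)
qed

lemma linear_div_tendsto:
  fixes c d e :: real
  assumes "e > 0"
  shows "(\<lambda>k. (c * (real k / e) + d) / (real k / e)) \<longlonglongrightarrow> c"
proof -
  have "filterlim (\<lambda>k. real k / e) at_top sequentially"
    using assms by real_asymp
  then have "(\<lambda>k. d / (real k / e)) \<longlonglongrightarrow> 0"
    by (intro tendsto_divide_0[OF tendsto_const] filterlim_at_top_imp_at_infinity)
  then have "(\<lambda>k. c + d / (real k / e)) \<longlonglongrightarrow> c + 0" by (intro tendsto_intros)
  moreover have "\<forall>\<^sub>F k in sequentially. c + d / (real k / e) = (c * (real k / e) + d) / (real k / e)"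
    using eventually_gt_at_top[of 0] by eventually_elim (use assms in \<open>simp add: field_simps\<close>)
  ultimately show ?thesis by (simp add: Lim_transform_eventually)
qed

lemma large_params_right:
  "large_params x p q r (char_root 1 p q r x) real (\<lambda>N. p * real N + a) (\<lambda>N. q * real N + b) (\<lambda>N. r * real N)"
proof unfold_locales
  show "char_root 1 p q r x * (char_root 1 p q r x + real r) =
    x * (char_root 1 p q r x + real p) * (char_root 1 p q r x + real q)"
    using char_root_eq[of p q r x 1] pq p0 x by simp
  show "0 < char_root 1 p q r x" using char_root_pos pq p0 x by blast
  show "filterlim real at_top sequentially" by (rule filterlim_real_sequentially)
  show "(\<lambda>k. (real p * real k + a) / real k) \<longlonglongrightarrow> real p" using linear_div_tendsto[of 1 p a] by simp
  show "(\<lambda>k. (real q * real k + b) / real k) \<longlonglongrightarrow> real q" using linear_div_tendsto[of 1 q b] by simp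
  show "(\<lambda>k. real r * real k / real k) \<longlonglongrightarrow> real r" using linear_div_tendsto[of 1 r 0] by simp
qed (use pq p0 r0 x in auto)

lemma H_of_nat:
  assumes "N > 0"
  shows "H (of_nat N) = of_real (rGamma (r * real N) * rhyp x (p * real N + a) (q * real N + b) (r * real N))"
  using hreg_of_real_pos[OF x, of "r * real N" "p * real N + a" "q * real N + b"] assms r0
  by (simp add: H_def)

text \<open>The step from \<open>w\<close> to \<open>w + 1\<close> raises the parameters by the
  integers \<open>p\<close>, \<open>q\<close>, \<open>r\<close>, so \<open>ratio_shift\<close>
  applies directly; the Gamma factors cancel against the Pochhammer symbol in
  \<open>H_relation\<close>.\<close>

lemma limit_right:
  "(\<lambda>N. poly nn (of_nat N) / poly dd (of_nat N)) \<longlonglongrightarrow> of_real (limit_of (char_root 1 p q r x))"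
proof -
  define \<rho> where "\<rho> = char_root 1 p q r x"
  interpret L: large_params x p q r \<rho> real "\<lambda>N. p * real N + a" "\<lambda>N. q * real N + b" "\<lambda>N. r * real N"
    unfolding \<rho>_def by (rule large_params_right)
  have "(\<lambda>N. rhyp x (p * real N + a + p) (q * real N + b + q) (r * real N + r) / L.S N) \<longlonglongrightarrow>
     ((p + \<rho>) / p) ^ p * ((q + \<rho>) / q) ^ q * (r / (r + \<rho>)) ^ r"
    by (rule L.ratio_shift)
  also have "((p + \<rho>) / p) ^ p * ((q + \<rho>) / q) ^ q * (r / (r + \<rho>)) ^ r = limit_of \<rho>"
    by (simp add: limit_of_def growth_def power_divide add.commute mult_ac)
  finally have "(\<lambda>N. complex_of_real (rhyp x (p * real N + a + p) (q * real N + b + q) (r * real N + r) / L.S N))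
     \<longlonglongrightarrow> of_real (limit_of \<rho>)" by (rule tendsto_of_real)
  moreover have "\<forall>\<^sub>F N in sequentially. complex_of_real (rhyp x (p * real N + a + p) (q * real N + b + q) (r * real N + r) / L.S N) =
     poly nn (of_nat N) / poly dd (of_nat N)"
    using L.ev_S_pos eventually_gt_at_top[of 0] ev_poly_ne_0[OF dd filterlim_of_nat_at_infinity]
  proof eventually_elim
    case (elim N)
    define c where "c = real r * real N"
    have c: "c > 0" using elim r0 by (simp add: c_def)
    then have G: "rGamma c > 0" by (simp add: rGamma_inverse_Gamma)
    have HN: "H (of_nat N) = of_real (rGamma c * L.S N)" using H_of_nat elim by (simp add: c_def)
    then have H0: "H (of_nat N) \<noteq> 0" using G elim by simp
    have HN': "H (of_nat N + 1) = of_real (rGamma (c + r) * rhyp x (p * real N + a + p) (q * real N + b + q) (r * real N + r))"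
      using H_of_nat[of "Suc N"] by (simp add: c_def algebra_simps)
    have P: "pochhammer (of_nat r * complex_of_nat N) r = of_real (pochhammer c r)"
      by (simp add: c_def pochhammer_of_real[symmetric])
    have "poly nn (of_nat N) * of_real (rGamma c * L.S N) =
       poly dd (of_nat N) * of_real (pochhammer c r * rGamma (c + r)) *
         of_real (rhyp x (p * real N + a + p) (q * real N + b + q) (r * real N + r))"
      using H_relation[OF H0] unfolding HN HN' P by simp
    also have "pochhammer c r * rGamma (c + r) = rGamma c" using pochhammer_rGamma[of c r] by simp
    finally have "of_real (rGamma c) * (poly nn (of_nat N) * of_real (L.S N)) =
       of_real (rGamma c) * (poly dd (of_nat N) * of_real (rhyp x (p * real N + a + p) (q * real N + b + q) (r * real N + r)))"
      by (simp add: mult_ac)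
    then have "poly nn (of_nat N) * of_real (L.S N) =
       poly dd (of_nat N) * of_real (rhyp x (p * real N + a + p) (q * real N + b + q) (r * real N + r))"
      using G by simp
    then show ?case using elim by (simp add: field_simps)
  qed
  ultimately show ?thesis unfolding \<rho>_def by (rule Lim_transform_eventually)
qed

text \<open>The point \<open>- j / r\<close> with \<open>j = l + r\<close>. Thanks to the offset,
  \<open>wpole l + 1\<close> is the point \<open>- l / r\<close>, so both values of \<open>H\<close>
  in \<open>H_relation\<close> are given by \<open>rpole\<close>.\<close>

definition wpole :: "nat \<Rightarrow> complex" where
  "wpole l = - of_real (real (l + r) / real r)"

text \<open>Every pole of \<open>f\<close> is some \<open>- j / r\<close> with \<open>H\<close>
  nonzero there, and the offset in \<open>wpole\<close> misses only the finitely many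
  \<open>j < r\<close>.\<close>

lemma infinite_nonvanishing: "infinite {l. H (wpole l) \<noteq> 0}"
proof
  assume fin: "finite {l. H (wpole l) \<noteq> 0}"
  have "{w. is_pole f w} \<subseteq>
     wpole ` {l. H (wpole l) \<noteq> 0} \<union> (\<lambda>j. - of_nat j / of_nat r) ` {..<r}"
  proof
    fix w assume "w \<in> {w. is_pole f w}"
    then obtain j where j: "of_nat r * w = - of_nat j"
        "hreg (of_real x) (of_nat p * w + of_real a) (of_nat q * w + of_real b) (- of_nat j) \<noteq> 0"
      using is_pole_hyp_f[OF normx r0(2)] by blast
    have w: "w = - of_nat j / of_nat r" using j(1) r0 by (simp add: field_simps)
    have "H w \<noteq> 0" using j by (simp add: H_def)
    show "w \<in> wpole ` {l. H (wpole l) \<noteq> 0} \<union> (\<lambda>j. - of_nat j / of_nat r) ` {..<r}"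
    proof (cases "j < r")
      case False
      then have "w = wpole (j - r)" using w by (simp add: wpole_def)
      then show ?thesis using \<open>H w \<noteq> 0\<close> by auto
    qed (use w in auto)
  qed
  with fin have "finite {w. is_pole f w}"
    by (meson finite_UnI finite_imageI finite_lessThan finite_subset)
  with poles show False by contradiction
qed

text \<open>A sequence of admissible indices fixed once, since it serves both for the comparison of
  limits and for the proof that \<open>PG\<close> vanishes.\<close>

definition \<phi> :: "nat \<Rightarrow> nat" where
  "\<phi> = (SOME \<phi>. strict_mono \<phi> \<and> (\<forall>k. H (wpole (\<phi> k)) \<noteq> 0))"

lemma \<phi>: "strict_mono \<phi>" "H (wpole (\<phi> k)) \<noteq> 0"
proof -
  have "\<exists>\<phi>::nat \<Rightarrow> nat. strict_mono \<phi> \<and> (\<forall>k. \<phi> k \<in> {l. H (wpole l) \<noteq> 0})"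
    using infinite_enumerate[OF infinite_nonvanishing] by blast
  then have "\<exists>\<phi>::nat \<Rightarrow> nat. strict_mono \<phi> \<and> (\<forall>k. H (wpole (\<phi> k)) \<noteq> 0)" by simp
  from someI_ex[OF this] show "strict_mono \<phi>" "H (wpole (\<phi> k)) \<noteq> 0"
    unfolding \<phi>_def by blast+
qed

lemma filterlim_\<phi>: "filterlim \<phi> sequentially sequentially"
  using \<phi>(1) by (rule filterlim_subseq)

lemma filterlim_wpole: "filterlim wpole at_infinity sequentially"
proof -
  have "norm (wpole l) = real (l + r) / real r" for l
    by (simp add: wpole_def norm_divide flip: of_nat_add del: of_nat_add)
  moreover have "filterlim (\<lambda>l. real (l + r) / real r) at_top sequentially"
    using r0 by real_asymp
  ultimately show ?thesis by (simp add: filterlim_at_infinity_conv_norm_at_top)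
qed

lemma filterlim_wpole_\<phi>: "filterlim (\<lambda>k. wpole (\<phi> k)) at_infinity sequentially"
  using filterlim_wpole filterlim_\<phi> by (rule filterlim_compose)

definition "\<alpha> l = a - p * (real (l + r) / real r)"
definition "\<beta> l = b - q * (real (l + r) / real r)"

lemma H_wpole: "H (wpole l) = of_real (rpole x (\<alpha> l) (\<beta> l) (l + r))"
proof -
  have "of_nat r * wpole l = - of_nat (l + r)" using r0 by (simp add: wpole_def)
  then show ?thesis
    using hreg_of_real_nonpos_int[OF x, of "\<alpha> l" "\<beta> l" "l + r"]
    by (simp add: H_def wpole_def \<alpha>_def \<beta>_def)
qed

lemma H_wpole_plus_1: "H (wpole l + 1) = of_real (rpole x (\<alpha> l + p) (\<beta> l + q) l)"
proof -
  have e: "of_nat r * (wpole l + 1) = - of_nat l" using r0 by (simp add: wpole_def field_simps)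
  show ?thesis
    using hreg_of_real_nonpos_int[OF x, of "\<alpha> l + p" "\<beta> l + q" "l"]
    unfolding H_def e by (simp add: wpole_def \<alpha>_def \<beta>_def algebra_simps)
qed

text \<open>Upper parameters of the reindexed series at \<open>wpole l + 1\<close>: reindexing adds
  \<open>l + 1\<close> and so turns the slope \<open>- p / r\<close> into
  \<open>s / r\<close>.\<close>

definition "A0 l = s * (real l / real r) + (a + 1)"
definition "B0 l = t * (real l / real r) + (b + 1)"

lemma A0: "\<alpha> l + p + Suc l = A0 l" "\<beta> l + q + Suc l = B0 l"
  using r0 by (simp_all add: A0_def B0_def \<alpha>_def \<beta>_def st field_simps)

text \<open>The value of \<open>R\<close> at \<open>wpole l\<close> with the Pochhammer symbols of
  growing length cancelled. Those that remain have fixed length, so \<open>pochhammer_asymp\<close>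
  applies to them.\<close>

definition pole_ratio :: "nat \<Rightarrow> real" where
  "pole_ratio l = (- 1) ^ r * pochhammer (real l + 1) r * pochhammer (real l + 2) r /
     (x ^ r * pochhammer (\<alpha> l) p * pochhammer (A0 l) s * pochhammer (\<beta> l) q * pochhammer (B0 l) t) *
     (rhyp x (A0 l) (B0 l) (real l + 2) / rhyp x (A0 l + s) (B0 l + t) (real l + 2 + r))"

lemma pole_ratio_eq:
  assumes "rpole x (\<alpha> l) (\<beta> l) (l + r) \<noteq> 0"
  shows "pochhammer (- real (l + r)) r * rpole x (\<alpha> l + p) (\<beta> l + q) l / rpole x (\<alpha> l) (\<beta> l) (l + r) = pole_ratio l"
proof -
  \<comment> \<open>A symbol of length \<open>l + r + 1\<close> is cut into three pieces; the middle
    one, of length \<open>l + 1\<close>, also occurs in the value at \<open>wpole l + 1\<close> and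
    cancels.\<close>
  have split: "pochhammer z (Suc (l + r)) = pochhammer z i * pochhammer (z + real i) (Suc l) * pochhammer (z + real i + real (Suc l)) (r - i)"
    if "i \<le> r" for z :: real and i
  proof -
    have "Suc (l + r) = i + (Suc l + (r - i))" using that by simp
    then show ?thesis by (simp only: pochhammer_product' mult.assoc)
  qed
  have a: "pochhammer (\<alpha> l) (Suc (l + r)) = pochhammer (\<alpha> l) p * pochhammer (\<alpha> l + p) (Suc l) * pochhammer (A0 l) s"
    using split[of p "\<alpha> l"] pq unfolding A0 s_def by simp
  have b: "pochhammer (\<beta> l) (Suc (l + r)) = pochhammer (\<beta> l) q * pochhammer (\<beta> l + q) (Suc l) * pochhammer (B0 l) t"
    using split[of q "\<beta> l"] pq unfolding A0 t_def by simp
  have f: "fact (Suc (l + r)) = fact (Suc l) * pochhammer (real l + 2) r"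
    using pochhammer_product'[of "1::real" "Suc l" r] unfolding pochhammer_fact by (simp add: add_ac)
  have m: "pochhammer (- real (l + r)) r = (- 1) ^ r * pochhammer (real l + 1) r"
    using pochhammer_minus[of "real (l + r)" r] by simp
  have C: "\<alpha> l + Suc (l + r) = A0 l + s" "\<beta> l + Suc (l + r) = B0 l + t" "real (l + r + 2) = real l + 2 + r"
    using A0[of l] st by simp_all
  have xp: "x ^ Suc (l + r) = x ^ Suc l * x ^ r" by (simp add: power_add)
  have A0': "\<alpha> l + p + real (Suc l) = A0 l" "\<beta> l + q + real (Suc l) = B0 l" "real (l + 2) = real l + 2"
    using A0[of l] by simp_all
  have ne: "pochhammer (\<alpha> l + p) (Suc l) \<noteq> 0" "pochhammer (\<beta> l + q) (Suc l) \<noteq> 0"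
    using assms unfolding rpole_def a b by auto
  have f0: "(fact (Suc l) :: real) \<noteq> 0" by (rule fact_nonzero)
  have x0: "x ^ Suc l \<noteq> 0" using x by simp
  show ?thesis
    unfolding rpole_def a b f C xp A0' m pole_ratio_def
    using ne f0 x0 by (simp add: divide_simps del: pochhammer_Suc fact_Suc of_nat_Suc power_Suc)
qed

lemma ratio_at_wpole:
  assumes "H (wpole l) \<noteq> 0" "poly dd (wpole l) \<noteq> 0"
  shows "poly nn (wpole l) / poly dd (wpole l) = of_real (pole_ratio l)"
proof -
  have n0: "rpole x (\<alpha> l) (\<beta> l) (l + r) \<noteq> 0" using assms H_wpole by auto
  have P: "pochhammer (of_nat r * wpole l) r = of_real (pochhammer (- real (l + r)) r)"
  proof -
    have "of_nat r * wpole l = of_real (- real (l + r))" using r0 by (simp add: wpole_def)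
    then show ?thesis by (simp only: pochhammer_of_real)
  qed
  have "poly nn (wpole l) / poly dd (wpole l) = pochhammer (of_nat r * wpole l) r * H (wpole l + 1) / H (wpole l)"
    using H_relation[OF assms(1)] assms by (simp add: field_simps)
  also have "\<dots> = of_real (pochhammer (- real (l + r)) r * rpole x (\<alpha> l + p) (\<beta> l + q) l / rpole x (\<alpha> l) (\<beta> l) (l + r))"
    unfolding P H_wpole H_wpole_plus_1 by simp
  finally show ?thesis unfolding pole_ratio_eq[OF n0] .
qed

text \<open>The substitution \<open>\<rho> = - (\<sigma> + r)\<close> turns the quadratic equation
  for \<open>p\<close>, \<open>q\<close> into the one for \<open>s\<close>, \<open>t\<close>, and
  \<open>char_root_neg\<close> says that \<open>\<sigma>\<close> is its positive root.\<close>

lemma large_params_left: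
  defines "\<sigma> \<equiv> - (char_root (- 1) p q r x + r)"
  shows "large_params x s t r \<sigma> (\<lambda>l. real l / real r) A0 B0 (\<lambda>l. real l + 2)"
proof unfold_locales
  define \<rho> where "\<rho> = char_root (- 1) p q r x"
  have eq: "\<rho> * (\<rho> + r) = x * (\<rho> + p) * (\<rho> + q)"
    using char_root_eq[of p q r x "- 1"] pq p0 x by (simp add: \<rho>_def)
  have "\<sigma> * (\<sigma> + r) = \<rho> * (\<rho> + r)" by (simp add: \<sigma>_def \<rho>_def algebra_simps)
  also have "\<dots> = x * (\<sigma> + s) * (\<sigma> + t)" unfolding eq by (simp add: \<sigma>_def \<rho>_def st algebra_simps)
  finally show "\<sigma> * (\<sigma> + real r) = x * (\<sigma> + real s) * (\<sigma> + real t)" .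
  show "0 < \<sigma>" using char_root_neg[of p q r x] pq p0 x by (simp add: \<sigma>_def)
  show "filterlim (\<lambda>l. real l / real r) at_top sequentially" using r0 by real_asymp
  show "(\<lambda>k. A0 k / (real k / real r)) \<longlonglongrightarrow> real s"
    unfolding A0_def using r0 by (intro linear_div_tendsto) simp
  show "(\<lambda>k. B0 k / (real k / real r)) \<longlonglongrightarrow> real t"
    unfolding B0_def using r0 by (intro linear_div_tendsto) simp
  show "(\<lambda>k. (real k + 2) / (real k / real r)) \<longlonglongrightarrow> real r"
    using linear_div_tendsto[of r r 2] r0 by simp
qed (use st r0 x in auto)

lemma limit_left: "pole_ratio \<longlonglongrightarrow> limit_of (char_root (- 1) p q r x)"
proof -
  define \<rho> where "\<rho> = char_root (- 1) p q r x"
  define \<sigma> where "\<sigma> = - (\<rho> + r)"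
  define w where "w l = real l / real r" for l
  interpret L: large_params x s t r \<sigma> w A0 B0 "\<lambda>l. real l + 2"
    unfolding \<sigma>_def \<rho>_def w_def[abs_def] by (rule large_params_left)
  have r': "real r > 0" using r0 by simp
  have lin: "(\<lambda>k. (c * w k + d) / w k) \<longlonglongrightarrow> c" for c d
    unfolding w_def by (rule linear_div_tendsto[OF r'])
  have poch: "(\<lambda>l. pochhammer (c * w l + d) n / w l ^ n) \<longlonglongrightarrow> c ^ n" for c d n
    by (rule pochhammer_asymp[OF lin L.w])
  have rw: "r * w l = real l" for l using r0 by (simp add: w_def)
  have \<alpha>: "\<alpha> l = - p * w l + (a - p)" "\<beta> l = - q * w l + (b - q)" for l
    using r0 by (simp_all add: \<alpha>_def \<beta>_def w_def field_simps)
  have lims: "(\<lambda>l. pochhammer (real l + 1) r / w l ^ r) \<longlonglongrightarrow> real r ^ r"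
    "(\<lambda>l. pochhammer (real l + 2) r / w l ^ r) \<longlonglongrightarrow> real r ^ r"
    "(\<lambda>l. pochhammer (\<alpha> l) p / w l ^ p) \<longlonglongrightarrow> (- real p) ^ p"
    "(\<lambda>l. pochhammer (\<beta> l) q / w l ^ q) \<longlonglongrightarrow> (- real q) ^ q"
    "(\<lambda>l. pochhammer (A0 l) s / w l ^ s) \<longlonglongrightarrow> real s ^ s"
    "(\<lambda>l. pochhammer (B0 l) t / w l ^ t) \<longlonglongrightarrow> real t ^ t"
    using poch[of r 1 r] poch[of r 2 r] poch[of "- p" "a - p" p] poch[of "- q" "b - q" q]
      poch[of s "a + 1" s] poch[of t "b + 1" t]
    unfolding rw \<alpha> A0_def[abs_def] B0_def[abs_def] w_def[symmetric] by simp_all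
  have "(\<lambda>l. inverse (rhyp x (A0 l + s) (B0 l + t) (real l + 2 + r) / L.S l)) \<longlonglongrightarrow>
     inverse (((s + \<sigma>) / s) ^ s * ((t + \<sigma>) / t) ^ t * (r / (r + \<sigma>)) ^ r)"
    using L.\<rho> st r0 by (intro tendsto_inverse L.ratio_shift) (auto simp: add_pos_pos)
  then have rat: "(\<lambda>l. L.S l / rhyp x (A0 l + s) (B0 l + t) (real l + 2 + r)) \<longlonglongrightarrow>
     inverse (((s + \<sigma>) / s) ^ s * ((t + \<sigma>) / t) ^ t * (r / (r + \<sigma>)) ^ r)" by simp
  have ne: "real p \<noteq> 0" "real q \<noteq> 0" "real s \<noteq> 0" "real t \<noteq> 0" "x \<noteq> 0" using p0 pq st x by auto
  have main: "(\<lambda>l. (- 1) ^ r * (pochhammer (real l + 1) r / w l ^ r) * (pochhammer (real l + 2) r / w l ^ r) /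
       (x ^ r * (pochhammer (\<alpha> l) p / w l ^ p) * (pochhammer (A0 l) s / w l ^ s) *
        (pochhammer (\<beta> l) q / w l ^ q) * (pochhammer (B0 l) t / w l ^ t)) *
       (L.S l / rhyp x (A0 l + s) (B0 l + t) (real l + 2 + r)))
     \<longlonglongrightarrow> (- 1) ^ r * real r ^ r * real r ^ r / (x ^ r * (- real p) ^ p * real s ^ s * (- real q) ^ q * real t ^ t) *
        inverse (((s + \<sigma>) / s) ^ s * ((t + \<sigma>) / t) ^ t * (r / (r + \<sigma>)) ^ r)"
    using ne by (intro tendsto_intros lims rat) auto
  have ev: "\<forall>\<^sub>F l in sequentially. (- 1) ^ r * (pochhammer (real l + 1) r / w l ^ r) * (pochhammer (real l + 2) r / w l ^ r) /
       (x ^ r * (pochhammer (\<alpha> l) p / w l ^ p) * (pochhammer (A0 l) s / w l ^ s) *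
        (pochhammer (\<beta> l) q / w l ^ q) * (pochhammer (B0 l) t / w l ^ t)) *
       (L.S l / rhyp x (A0 l + s) (B0 l + t) (real l + 2 + r)) = pole_ratio l"
    using L.ev_w[of 0]
  proof eventually_elim
    case (elim l)
    \<comment> \<open>Numerator and denominator contain Pochhammer symbols of the same total length
      \<open>2 r = p + s + q + t\<close>, so the normalising powers of \<open>w l\<close>
      cancel.\<close>
    have "w l ^ r = w l ^ p * w l ^ s" "w l ^ r = w l ^ q * w l ^ t"
      unfolding power_add[symmetric] using pq by (simp_all add: s_def t_def)
    then have e: "w l ^ r * w l ^ r = w l ^ p * w l ^ s * w l ^ q * w l ^ t" by simp
    define V where "V = w l ^ p * w l ^ s * w l ^ q * w l ^ t"
    have V: "V \<noteq> 0" using elim by (simp add: V_def)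
    have n: "(- 1) ^ r * (pochhammer (real l + 1) r / w l ^ r) * (pochhammer (real l + 2) r / w l ^ r) =
      (- 1) ^ r * pochhammer (real l + 1) r * pochhammer (real l + 2) r / V"
      unfolding V_def e[symmetric] by simp
    have d: "x ^ r * (pochhammer (\<alpha> l) p / w l ^ p) * (pochhammer (A0 l) s / w l ^ s) *
        (pochhammer (\<beta> l) q / w l ^ q) * (pochhammer (B0 l) t / w l ^ t) =
       x ^ r * pochhammer (\<alpha> l) p * pochhammer (A0 l) s * pochhammer (\<beta> l) q * pochhammer (B0 l) t / V"
      by (simp add: V_def)
    show ?case unfolding n d using V by (simp add: pole_ratio_def)
  qed
  have "(- 1) ^ r * real r ^ r * real r ^ r / (x ^ r * (- real p) ^ p * real s ^ s * (- real q) ^ q * real t ^ t) *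
        inverse (((s + \<sigma>) / s) ^ s * ((t + \<sigma>) / t) ^ t * (r / (r + \<sigma>)) ^ r) = limit_of \<rho>"
  proof -
    have \<sigma>: "\<sigma> > 0" by (rule L.\<rho>)
    have pos: "s + \<sigma> > 0" "t + \<sigma> > 0" "r + \<sigma> > 0" using \<sigma> by auto
    \<comment> \<open>Raised to the power \<open>r = p + s = q + t\<close>, the quadratic equation
      trades the powers with exponents \<open>s\<close> and \<open>t\<close> for the powers with
      exponents \<open>p\<close> and \<open>q\<close> in \<open>limit_of\<close>.\<close>
    have "(\<sigma> * (\<sigma> + r)) ^ r = (x * (\<sigma> + s) * (\<sigma> + t)) ^ r" unfolding L.root ..
    moreover have "(\<sigma> + s) ^ r = (s + \<sigma>) ^ p * (s + \<sigma>) ^ s" "(\<sigma> + t) ^ r = (t + \<sigma>) ^ q * (t + \<sigma>) ^ t"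
      unfolding power_add[symmetric] using pq by (simp_all add: s_def t_def add.commute)
    ultimately have key: "\<sigma> ^ r * (r + \<sigma>) ^ r = x ^ r * ((s + \<sigma>) ^ p * (s + \<sigma>) ^ s) * ((t + \<sigma>) ^ q * (t + \<sigma>) ^ t)"
      by (simp add: power_mult_distrib add.commute)
    have \<rho>: "\<rho> + p = - (s + \<sigma>)" "\<rho> + q = - (t + \<sigma>)" "\<rho> + r = - \<sigma>" by (simp_all add: \<sigma>_def st)
    have sg: "(- u) ^ n = (- 1) ^ n * u ^ n" for u :: real and n by (rule power_minus)
    have m1: "(- 1 :: real) ^ n * ((- 1) ^ n * u) = u" for n u by (simp flip: mult.assoc power_mult_distrib)
    have "limit_of \<rho> = ((- 1) ^ p * (- 1) ^ q / (- 1) ^ r) *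
         ((s + \<sigma>) ^ p * (t + \<sigma>) ^ q * real r ^ r / (\<sigma> ^ r * real p ^ p * real q ^ q))"
      unfolding limit_of_def growth_def \<rho> sg[of "s + \<sigma>"] sg[of "t + \<sigma>"] sg[of \<sigma>] by (simp add: mult_ac)
    also have "(s + \<sigma>) ^ p * (t + \<sigma>) ^ q * real r ^ r / (\<sigma> ^ r * real p ^ p * real q ^ q) =
       real r ^ r * (r + \<sigma>) ^ r / (x ^ r * real p ^ p * real q ^ q * (s + \<sigma>) ^ s * (t + \<sigma>) ^ t)"
      using key \<sigma> pos ne by (simp add: divide_simps) (simp add: mult_ac)
    also have "(- 1) ^ p * (- 1) ^ q / (- 1 :: real) ^ r = (- 1) ^ r / ((- 1) ^ p * (- 1) ^ q)"
      by (simp add: divide_simps flip: power_add power_mult_distrib)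
    finally have lim: "limit_of \<rho> = (- 1) ^ r / ((- 1) ^ p * (- 1) ^ q) *
      (real r ^ r * (r + \<sigma>) ^ r / (x ^ r * real p ^ p * real q ^ q * (s + \<sigma>) ^ s * (t + \<sigma>) ^ t))" .
    have frac: "e0 * R' * R' / (X' * (e1 * P') * S' * (e2 * Q') * T') * inverse (S1 / S' * (T1 / T') * (R' / R1)) =
        e0 / (e1 * e2) * (R' * R1 / (X' * P' * Q' * S1 * T1))"
      if "e1 \<noteq> 0" "e2 \<noteq> 0" "X' \<noteq> 0" "P' \<noteq> 0" "Q' \<noteq> 0" "S' \<noteq> 0" "T' \<noteq> 0" "R' \<noteq> 0" "R1 \<noteq> 0" "S1 \<noteq> 0" "T1 \<noteq> 0"
      for e0 e1 e2 R' X' P' S' Q' T' S1 T1 R1 :: real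
      using that by (simp add: field_simps)
    show ?thesis
      unfolding lim sg[of "real p"] sg[of "real q"] power_divide
      by (rule frac) (use ne pos r0 in auto)
  qed
  with main have "(\<lambda>l. (- 1) ^ r * (pochhammer (real l + 1) r / w l ^ r) * (pochhammer (real l + 2) r / w l ^ r) /
       (x ^ r * (pochhammer (\<alpha> l) p / w l ^ p) * (pochhammer (A0 l) s / w l ^ s) *
        (pochhammer (\<beta> l) q / w l ^ q) * (pochhammer (B0 l) t / w l ^ t)) *
       (L.S l / rhyp x (A0 l + s) (B0 l + t) (real l + 2 + r))) \<longlonglongrightarrow> limit_of \<rho>" by simp
  then show ?thesis unfolding \<rho>_def using ev by (rule Lim_transform_eventually)
qed

lemma limits_agree: "limit_of (char_root 1 p q r x) = limit_of (char_root (- 1) p q r x)"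
proof -
  have "((\<lambda>w. poly nn w / poly dd w) \<longlongrightarrow> of_real (limit_of (char_root 1 p q r x))) at_infinity"
    by (rule poly_ratio_tendsto_at_infinity(1)[OF dd filterlim_of_nat_at_infinity limit_right])
  from filterlim_compose[OF this filterlim_wpole_\<phi>]
  have 1: "(\<lambda>k. poly nn (wpole (\<phi> k)) / poly dd (wpole (\<phi> k))) \<longlonglongrightarrow> of_real (limit_of (char_root 1 p q r x))" .
  have "(\<lambda>k. complex_of_real (pole_ratio (\<phi> k))) \<longlonglongrightarrow> of_real (limit_of (char_root (- 1) p q r x))"
    using filterlim_compose[OF limit_left filterlim_\<phi>] by (rule tendsto_of_real)
  moreover have "\<forall>\<^sub>F k in sequentially. complex_of_real (pole_ratio (\<phi> k)) = poly nn (wpole (\<phi> k)) / poly dd (wpole (\<phi> k))"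
    using ev_poly_ne_0[OF dd filterlim_wpole_\<phi>] by eventually_elim (simp add: ratio_at_wpole \<phi>)
  ultimately have "(\<lambda>k. poly nn (wpole (\<phi> k)) / poly dd (wpole (\<phi> k))) \<longlonglongrightarrow> of_real (limit_of (char_root (- 1) p q r x))"
    by (rule Lim_transform_eventually)
  from LIMSEQ_unique[OF 1 this] show ?thesis by simp
qed

lemma hyp_Z_agree: "hyp_Z 1 p q r x = hyp_Z (- 1) p q r x"
proof -
  have "growth p q r (char_root 1 p q r x) = growth p q r (char_root (- 1) p q r x)"
    using limits_agree r0 p0 pq by (simp add: limit_of_def)
  then show ?thesis using hyp_Z_eqI pq p0 x by blast
qed

lemma p_plus_q_less: "p + q < r"
proof -
  have "r \<noteq> p + q" using hyp_Z_ne[of p q r x] hyp_Z_agree pq p0 x by blast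
  then show ?thesis using pq by simp
qed

end

section \<open>Truncated products as polynomials in the parameter\<close>

text \<open>The truncated product times \<open>pochhammer g N\<close>, with the denominators
  cancelled term by term as in \<open>pochhammer_mult_complement\<close>; this shows that
  \<open>P\<close> is a polynomial.\<close>

definition trunc_poly ::
  "complex \<Rightarrow> nat \<Rightarrow> nat \<Rightarrow> complex poly \<Rightarrow> complex poly \<Rightarrow> complex poly \<Rightarrow> complex poly \<Rightarrow> complex poly \<Rightarrow> complex poly" where
  "trunc_poly x t N A B A' B' g =
     (\<Sum>k<t. \<Sum>i\<le>k. smult (x ^ k * (- 1) ^ (k - i) / (fact i * fact (k - i)))
        (pochhammer A i * pochhammer B i * pochhammer A' (k - i) * pochhammer B' (k - i) *
         pochhammer (g + of_nat i) (N - k)))"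

lemma poly_trunc_poly:
  assumes "0 < t" "t \<le> Suc N" "pochhammer (poly g w) N \<noteq> 0"
  shows "poly (trunc_poly x t N A B A' B' g) w = pochhammer (poly g w) N *
     poly (fps_trunc (t - 1) (hyp2F1_fps (poly A w) (poly B w) (poly g w) *
       hyp2F1_fps (poly A' w) (poly B' w) (1 - (poly g w + of_nat N)))) x"
proof -
  define c where "c = poly g w"
  define F where "F = hyp2F1_fps (poly A w) (poly B w) c"
  define F' where "F' = hyp2F1_fps (poly A' w) (poly B' w) (1 - (c + of_nat N))"
  have summand: "poly (smult (x ^ k * (- 1) ^ (k - i) / (fact i * fact (k - i)))
        (pochhammer A i * pochhammer B i * pochhammer A' (k - i) * pochhammer B' (k - i) *
         pochhammer (g + of_nat i) (N - k))) w = pochhammer c N * (F $ i * F' $ (k - i) * x ^ k)"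
    if "k < t" "i \<le> k" for k i
  proof -
    have c: "pochhammer c N = (- 1) ^ (k - i) * (pochhammer c i * pochhammer (1 - (c + of_nat N)) (k - i)) *
        pochhammer (c + of_nat i) (N - k)"
      using pochhammer_mult_complement[of i "k - i" N c] that assms by simp
    then have "pochhammer c i \<noteq> 0" "pochhammer (1 - (c + of_nat N)) (k - i) \<noteq> 0"
      using assms(3) by (auto simp: c_def)
    then show ?thesis
      unfolding c F_def F'_def hyp2F1_fps_nth poly_smult poly_mult poly_pochhammer poly_add poly_of_nat c_def[symmetric]
      by simp
  qed
  have "poly (fps_trunc (t - 1) (F * F')) x = (\<Sum>k<t. (F * F') $ k * x ^ k)"
  proof -
    have "degree (fps_trunc (t - 1) (F * F')) \<le> t - 1" by (rule degree_fps_trunc)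
    then have "poly (fps_trunc (t - 1) (F * F')) x = (\<Sum>k\<le>t - 1. coeff (fps_trunc (t - 1) (F * F')) k * x ^ k)"
      unfolding poly_altdef by (intro sum.mono_neutral_left) (auto simp: coeff_eq_0)
    also have "{..t - 1} = {..<t}" using assms(1) by auto
    also have "(\<Sum>k<t. coeff (fps_trunc (t - 1) (F * F')) k * x ^ k) = (\<Sum>k<t. (F * F') $ k * x ^ k)"
      using assms(1) by (intro sum.cong) (auto simp: fps_trunc_def coeff_truncate_fps)
    finally show ?thesis .
  qed
  then have "pochhammer c N * poly (fps_trunc (t - 1) (F * F')) x =
     (\<Sum>k<t. \<Sum>i\<le>k. pochhammer c N * (F $ i * F' $ (k - i) * x ^ k))"
    by (simp add: fps_mult_nth atLeast0AtMost sum_distrib_left sum_distrib_right)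
  also have "\<dots> = poly (trunc_poly x t N A B A' B' g) w"
    unfolding trunc_poly_def poly_sum using summand by (intro sum.cong refl) auto
  finally show ?thesis by (simp add: F_def F'_def c_def)
qed

text \<open>Off the real axis an affine function of \<open>w\<close> with real coefficients and
  nonzero slope is never an integer, which is the genericity demanded by the contiguity
  relations.\<close>

lemma continuous_eq_off_reals:
  fixes f g :: "complex \<Rightarrow> complex"
  assumes "\<And>w. isCont f w" "\<And>w. isCont g w" and eq: "\<And>w. Im w \<noteq> 0 \<Longrightarrow> f w = g w"
  shows "f w = g w"
proof (cases "Im w = 0")
  case True
  define z where "z n = w + \<i> * of_real (1 / real (Suc n))" for n
  have "(\<lambda>n. of_real (1 / real (Suc n)) :: complex) \<longlonglongrightarrow> of_real 0"
  proof (rule tendsto_of_real)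
    show "(\<lambda>n. 1 / real (Suc n)) \<longlonglongrightarrow> 0" by real_asymp
  qed
  then have "(\<lambda>n. w + \<i> * of_real (1 / real (Suc n))) \<longlonglongrightarrow> w + \<i> * of_real 0"
    by (intro tendsto_add tendsto_mult tendsto_const)
  then have z: "z \<longlonglongrightarrow> w" by (simp add: z_def[abs_def])
  have "(\<lambda>n. f (z n)) \<longlonglongrightarrow> f w" "(\<lambda>n. g (z n)) \<longlonglongrightarrow> g w"
    using isCont_tendsto_compose[OF assms(1) z] isCont_tendsto_compose[OF assms(2) z] by auto
  moreover have "f (z n) = g (z n)" for n
    using True by (intro eq) (simp add: z_def del: of_nat_Suc)
  ultimately show ?thesis by (metis (no_types, lifting) LIMSEQ_unique ext)
qed (use eq in auto)

lemma poly_eqI_off_reals: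
  fixes f g :: "complex poly"
  assumes "\<And>w. Im w \<noteq> 0 \<Longrightarrow> poly f w = poly g w"
  shows "f = g"
proof -
  have "poly f w = poly g w" for w
    by (rule continuous_eq_off_reals[OF poly_isCont poly_isCont assms])
  then show ?thesis by (simp add: poly_eq_poly_eq_iff[symmetric] ext)
qed

lemma degree_pochhammer_linear:
  fixes c d :: complex
  assumes "d \<noteq> 0"
  shows "degree (pochhammer [:c, d:] n) = n" "pochhammer [:c, d:] n \<noteq> 0"
proof -
  have *: "[:c, d:] + of_nat i = [:c + of_nat i, d:]" for i
    by (simp add: of_nat_poly)
  have "degree (pochhammer [:c, d:] n) = n \<and> pochhammer [:c, d:] n \<noteq> 0"
  proof (induction n)
    case (Suc n)
    have "degree [:c + of_nat n, d:] = 1" "[:c + of_nat n, d:] \<noteq> 0" using assms by simp_all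
    then show ?case using Suc unfolding pochhammer_Suc *
      by (simp add: degree_mult_eq del: mult_pCons_right mult_pCons_left)
  qed simp
  then show "degree (pochhammer [:c, d:] n) = n" "pochhammer [:c, d:] n \<noteq> 0" by auto
qed

lemma not_Ints_Im: "Im z \<noteq> 0 \<Longrightarrow> z \<notin> \<int>"
  by (auto elim!: Ints_cases)

lemma hyp2F1_contiguity_eval:
  assumes ints: "a \<notin> \<int>" "b \<notin> \<int>" "c \<notin> \<int>" "a - c \<notin> \<int>" "b - c \<notin> \<int>"
    and st: "s \<le> t" "t \<le> r" "r < s + t" and x: "norm x < 1"
  shows "hyp2F1 (a - of_nat s) (b - of_nat t) (c - of_nat r) x =
     (1 - x) * poly (truncF a b c s t r) x * hyp2F1 a b c x +
     wconst a b c * x * poly (truncG a b c s t r) x * hyp2F1 a b (c + 1) x"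
proof -
  define T where "T = [:1, -1:] * truncF a b c s t r"
  define U where "U = [:0, wconst a b c:] * truncG a b c s t r"
  have c1: "c + 1 \<notin> \<int>" using not_Ints_add_of_nat[OF ints(3), of 1] by simp
  have lt: "ereal (norm x) < fps_conv_radius (hyp2F1_fps a b d)" if "d \<notin> \<int>" for d
    using x less_le_trans[OF _ fps_conv_radius_hyp2F1_fps[OF not_Ints_imp_not_nonpos_Ints[OF that]], of "ereal (norm x)"]
    by simp
  have lt': "ereal (norm x) < fps_conv_radius (fps_of_poly V * hyp2F1_fps a b d)" if "d \<notin> \<int>" for d V
    using lt[OF that] by (intro less_le_trans[OF _ fps_conv_radius_mult]) auto
  have "hyp2F1 (a - of_nat s) (b - of_nat t) (c - of_nat r) x =
      eval_fps (fps_of_poly T * hyp2F1_fps a b c + fps_of_poly U * hyp2F1_fps a b (c + 1)) x"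
    unfolding hyp2F1_def T_def U_def by (subst hyp2F1_contiguity(1)[OF ints st]) simp
  also have "\<dots> = eval_fps (fps_of_poly T * hyp2F1_fps a b c) x + eval_fps (fps_of_poly U * hyp2F1_fps a b (c + 1)) x"
    by (intro eval_fps_add lt' ints c1)
  also have "\<dots> = poly T x * hyp2F1 a b c x + poly U x * hyp2F1 a b (c + 1) x"
    unfolding hyp2F1_def by (subst (1 2) eval_fps_mult) (auto intro!: lt ints c1)
  finally show ?thesis by (simp add: T_def U_def algebra_simps)
qed

section \<open>The Euler-transformed function and the vanishing of the second coefficient\<close>

context closed_form
begin

abbreviation "X \<equiv> complex_of_real x"
definition "n = r - p - q"

lemma n: "0 < n" "s + t - r = n" "r < s + t" "s + t = r + n"
  using p_plus_q_less by (auto simp: n_def s_def t_def)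

definition "\<alpha>' w = of_nat s * w - complex_of_real a"
definition "\<beta>' w = of_nat t * w - complex_of_real b"

text \<open>Regularised by different Gamma factors, \<open>K\<close> and \<open>KG\<close> have as
  quotient exactly \<open>r w\<close> times the quotient of the unregularised functions.\<close>

definition K :: "complex \<Rightarrow> complex" where "K w = hreg X (\<alpha>' w) (\<beta>' w) (of_nat r * w)"
definition KG :: "complex \<Rightarrow> complex" where "KG w = hreg X (\<alpha>' w) (\<beta>' w) (of_nat r * w + 1)"

lemma isCont_K: "isCont K w" "isCont KG w"
proof -
  have "K holomorphic_on UNIV" "KG holomorphic_on UNIV"
    unfolding K_def KG_def \<alpha>'_def \<beta>'_def by (intro hreg_holomorphic normx holomorphic_intros)+
  then show "isCont K w" "isCont KG w"
    by (meson UNIV_I continuous_on_eq_continuous_at holomorphic_on_imp_continuous_on open_UNIV)+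
qed

lemma one_minus_X: "1 - X \<noteq> 0" "X \<noteq> 0"
  using x by (simp_all add: complex_eq_iff)

text \<open>The power of \<open>1 - x\<close> from Euler's transformation, written with
  \<open>exp\<close> so that it is plainly entire and without zeros.\<close>

definition \<xi> :: "complex \<Rightarrow> complex" where
  "\<xi> w = exp ((of_nat n * w - of_real a - of_real b) * Ln (1 - X))"

lemma \<xi>_plus_1: "\<xi> (w + 1) = (1 - X) ^ n * \<xi> w"
proof -
  have "(of_nat n * (w + 1) - of_real a - of_real b) * Ln (1 - X) =
     of_nat n * Ln (1 - X) + (of_nat n * w - of_real a - of_real b) * Ln (1 - X)"
    by (simp add: algebra_simps)
  then show ?thesis using one_minus_X by (simp add: \<xi>_def exp_add exp_of_nat_mult)
qed

lemma H_eq_K: "H w = \<xi> w * K w"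
proof (rule continuous_eq_off_reals[where f = H and g = "\<lambda>w. \<xi> w * K w"])
  show "isCont H w" for w by (rule isCont_H)
  show "isCont (\<lambda>w. \<xi> w * K w) w" for w
    unfolding \<xi>_def by (intro continuous_intros isCont_K)
  fix w :: complex assume "Im w \<noteq> 0"
  then have c: "of_nat r * w \<notin> \<int>" using r0 by (intro not_Ints_Im) simp
  have e: "of_nat r * w - (of_nat p * w + of_real a) - (of_nat q * w + of_real b) = of_nat n * w - of_real a - of_real b"
    "of_nat r * w - (of_nat p * w + of_real a) = \<alpha>' w" "of_nat r * w - (of_nat q * w + of_real b) = \<beta>' w"
    using pq by (simp_all add: n_def \<alpha>'_def \<beta>'_def s_def t_def of_nat_diff algebra_simps)
  show "H w = \<xi> w * K w"
    using hreg_euler[OF normx c, of "of_nat p * w + of_real a" "of_nat q * w + of_real b"] one_minus_X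
    unfolding H_def K_def e(2,3)[symmetric] \<xi>_def e(1)[symmetric] powr_def by simp
qed

lemma K_relation:
  assumes "K w \<noteq> 0"
  shows "poly nn w * K w = poly dd w * pochhammer (of_nat r * w) r * (1 - X) ^ n * K (w + 1)"
proof -
  have \<xi>0: "\<xi> w \<noteq> 0" by (simp add: \<xi>_def)
  then have "H w \<noteq> 0" using assms by (simp add: H_eq_K)
  from H_relation[OF this] have "\<xi> w * (poly nn w * K w) =
      \<xi> w * (poly dd w * pochhammer (of_nat r * w) r * (1 - X) ^ n * K (w + 1))"
    unfolding H_eq_K \<xi>_plus_1 by (simp add: mult_ac)
  then show ?thesis using \<xi>0 by simp
qed

definition P :: "complex poly" where
  "P = trunc_poly X t r [:- of_real a, of_nat s:] [:- of_real b, of_nat t:]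
     [:1 - of_nat s + of_real a, - of_nat s:] [:1 - of_nat t + of_real b, - of_nat t:] [:0, of_nat r:]"

text \<open>The lower parameter \<open>2 - c\<close> of \<open>truncG\<close> equals
  \<open>1 - (r w + (r - 1))\<close> at \<open>c = r (w + 1)\<close>, so a symbol of length
  \<open>r - 1\<close> clears the denominators.\<close>

definition PG :: "complex poly" where
  "PG = trunc_poly X t (r - 1) [:- of_real a, of_nat s:] [:- of_real b, of_nat t:]
     [:1 - of_nat s + of_real a, - of_nat s:] [:1 - of_nat t + of_real b, - of_nat t:] [:0, of_nat r:]"

text \<open>The analogue for the relation with target lower parameter \<open>r w + 1\<close>, where
  length \<open>r - 2\<close> suffices; it supplies the diagonal entry complementary to
  \<open>P\<close> in the contiguity matrix.\<close>

definition PD :: "complex poly" where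
  "PD = trunc_poly X t (r - 2) [:- of_real a, of_nat s:] [:- of_real b, of_nat t:]
     [:1 - of_nat s + of_real a, - of_nat s:] [:1 - of_nat t + of_real b, - of_nat t:] [:1, of_nat r:]"

lemma st': "0 < t" "t \<le> r" "2 \<le> r" "Suc (Suc (r - 2)) = r"
  using st pq p0 by auto

lemma poly_P:
  assumes "pochhammer (of_nat r * w) r \<noteq> 0"
  shows "poly P w = hyp_P_val p q r (of_real a) (of_real b) (of_real x) w"
proof -
  have g: "poly [:0, of_nat r:] w = of_nat r * w" by simp
  have e: "of_nat r - of_nat p = (of_nat s :: complex)" "of_nat r - of_nat q = (of_nat t :: complex)" "r - q - 1 = t - 1"
    using pq by (simp_all add: s_def t_def of_nat_diff)
  show ?thesis
    unfolding P_def hyp_P_val_def Let_def e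
    by (subst poly_trunc_poly) (use st' assms in \<open>simp_all add: algebra_simps\<close>)
qed

lemma parameters_not_Ints:
  assumes "Im w \<noteq> 0"
  shows "\<alpha>' (w + 1) \<notin> \<int>" "\<beta>' (w + 1) \<notin> \<int>" "of_nat r * (w + 1) \<notin> \<int>"
    "\<alpha>' (w + 1) - of_nat r * (w + 1) \<notin> \<int>" "\<beta>' (w + 1) - of_nat r * (w + 1) \<notin> \<int>"
  using assms st st' by (auto intro!: not_Ints_Im simp: \<alpha>'_def \<beta>'_def left_diff_distrib[symmetric])

lemma poly_trunc:
  assumes "Im w \<noteq> 0"
  defines "A \<equiv> \<alpha>' (w + 1)" and "B \<equiv> \<beta>' (w + 1)" and "c \<equiv> of_nat r * (w + 1)"
  shows "poly P w = pochhammer (of_nat r * w) r * poly (truncF A B c s t r) X"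
    and "poly PG w = pochhammer (of_nat r * w) (r - 1) * poly (truncG A B c s t r) X"
    and "poly PD w = pochhammer (of_nat r * w + 1) (r - 2) * poly (truncG A B c s t (r - 1)) X"
proof -
  have rw: "of_nat r * w \<notin> \<int>" "of_nat r * w + 1 \<notin> \<int>"
    using assms(1) r0 by (auto intro!: not_Ints_Im)
  have e: "c - of_nat r = of_nat r * w" "A - of_nat s = of_nat s * w - of_real a" "B - of_nat t = of_nat t * w - of_real b"
    "c - of_nat (r - 1) = of_nat r * w + 1"
    using st' by (simp_all add: A_def B_def c_def \<alpha>'_def \<beta>'_def of_nat_diff algebra_simps)
  have e1: "1 - c = 1 - (of_nat r * w + of_nat r)" "2 - c = 1 - (of_nat r * w + of_nat (r - 1))"
    "2 - c = 1 - (of_nat r * w + 1 + of_nat (r - 2))"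
    using st' by (simp_all add: c_def of_nat_diff algebra_simps)
  have e2: "1 - A = 1 - of_nat s + of_real a - of_nat s * w" "1 - B = 1 - of_nat t + of_real b - of_nat t * w"
    by (simp_all add: A_def B_def \<alpha>'_def \<beta>'_def algebra_simps)
  have g: "poly [:0, of_nat r:] w = of_nat r * w" "poly [:1, of_nat r:] w = of_nat r * w + 1"
    "poly [:- of_real a, of_nat s:] w = of_nat s * w - of_real a"
    "poly [:- of_real b, of_nat t:] w = of_nat t * w - of_real b"
    "poly [:1 - of_nat s + of_real a, - of_nat s:] w = 1 - of_nat s + of_real a - of_nat s * w"
    "poly [:1 - of_nat t + of_real b, - of_nat t:] w = 1 - of_nat t + of_real b - of_nat t * w"
    by (simp_all add: algebra_simps)
  have le: "t \<le> Suc r" "t \<le> Suc (r - 1)" "t \<le> Suc (r - 2)" using st st' by auto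
  have ne: "pochhammer (poly [:0, of_nat r:] w) r \<noteq> 0" "pochhammer (poly [:0, of_nat r:] w) (r - 1) \<noteq> 0"
    "pochhammer (poly [:1, of_nat r:] w) (r - 2) \<noteq> 0"
    unfolding g using pochhammer_ne_0 rw by auto
  show "poly P w = pochhammer (of_nat r * w) r * poly (truncF A B c s t r) X"
    unfolding P_def poly_trunc_poly[OF st'(1) le(1) ne(1)] g truncF_def e e1(1) e2 ..
  show "poly PG w = pochhammer (of_nat r * w) (r - 1) * poly (truncG A B c s t r) X"
    unfolding PG_def poly_trunc_poly[OF st'(1) le(2) ne(2)] g truncG_def e e1(2) e2 ..
  show "poly PD w = pochhammer (of_nat r * w + 1) (r - 2) * poly (truncG A B c s t (r - 1)) X"
    unfolding PD_def poly_trunc_poly[OF st'(1) le(3) ne(3)] g truncG_def e e1(3) e2 ..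
qed

text \<open>The numerator \<open>(c - A) (c - B)\<close> of \<open>wconst\<close> at the parameters
  of \<open>w + 1\<close>.\<close>

definition c1 :: "complex poly" where
  "c1 = [:of_nat p + of_real a, of_nat p:] * [:of_nat q + of_real b, of_nat q:]"

lemma poly_c1: "poly c1 w = (of_nat r * (w + 1) - \<alpha>' (w + 1)) * (of_nat r * (w + 1) - \<beta>' (w + 1))"
proof -
  have "of_nat r * (w + 1) - \<alpha>' (w + 1) = of_nat p + of_real a + w * of_nat p"
    "of_nat r * (w + 1) - \<beta>' (w + 1) = of_nat q + of_real b + w * of_nat q"
    using pq by (simp_all add: \<alpha>'_def \<beta>'_def s_def t_def of_nat_diff algebra_simps)
  then show ?thesis unfolding c1_def poly_mult by simp
qed

lemma K_contiguity: "K w = (1 - X) * poly P w * K (w + 1) + X * poly (c1 * PG) w * KG (w + 1)"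
proof (rule continuous_eq_off_reals[where f = K and g = "\<lambda>w. (1 - X) * poly P w * K (w + 1) + X * poly (c1 * PG) w * KG (w + 1)"])
  show "isCont K w" for w by (rule isCont_K)
  have sh: "isCont (\<lambda>w. f (w + 1)) w" if "\<And>w. isCont f w" for f :: "complex \<Rightarrow> complex" and w
    by (rule isCont_o2[OF _ that]) (intro continuous_intros)
  show "isCont (\<lambda>w. (1 - X) * poly P w * K (w + 1) + X * poly (c1 * PG) w * KG (w + 1)) w" for w
    by (intro continuous_intros sh isCont_K)
  fix w :: complex assume w: "Im w \<noteq> 0"
  define A where "A = \<alpha>' (w + 1)"
  define B where "B = \<beta>' (w + 1)"
  define c where "c = of_nat r * (w + 1)"
  note pt = poly_trunc[OF w, folded A_def B_def c_def]
  note ints = parameters_not_Ints[OF w, folded A_def B_def c_def]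
  have e: "c - of_nat r = of_nat r * w" "A - of_nat s = \<alpha>' w" "B - of_nat t = \<beta>' w"
    by (simp_all add: A_def B_def c_def \<alpha>'_def \<beta>'_def algebra_simps)
  have rw: "of_nat r * w \<notin> \<int>" using w r0 by (intro not_Ints_Im) simp
  have c1': "c + 1 \<notin> \<int>" using not_Ints_add_of_nat[OF ints(3), of 1] by simp
  have c0: "c \<noteq> 0" "c - 1 \<noteq> 0" using ints by (auto simp: eq_iff_diff_eq_0[symmetric])
  note reg = hreg_eq_hyp2F1(1)[OF normx not_Ints_imp_not_nonpos_Ints]
  have K1: "K (w + 1) = rGamma c * hyp2F1 A B c X"
    using reg[OF ints(3), of A B] by (simp add: K_def A_def B_def c_def)
  have KG1: "KG (w + 1) = rGamma (c + 1) * hyp2F1 A B (c + 1) X"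
    using reg[OF c1', of A B] by (simp add: KG_def A_def B_def c_def)
  have G1: "rGamma (of_nat r * w) = pochhammer (of_nat r * w) r * rGamma c"
    using pochhammer_rGamma[of "of_nat r * w" r] by (simp add: c_def algebra_simps)
  have G2: "rGamma c = c * rGamma (c + 1)" using rGamma_plus1[of c] by simp
  have pr: "pochhammer (of_nat r * w) r = pochhammer (of_nat r * w) (r - 1) * (c - 1)"
  proof -
    have "pochhammer (of_nat r * w) (Suc (r - 1)) = pochhammer (of_nat r * w) (r - 1) * (of_nat r * w + of_nat (r - 1))"
      by (rule pochhammer_Suc)
    then show ?thesis using st' by (simp add: c_def of_nat_diff algebra_simps)
  qed
  have "K w = rGamma (of_nat r * w) * hyp2F1 (\<alpha>' w) (\<beta>' w) (of_nat r * w) X"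
    using reg[OF rw] by (simp add: K_def)
  also have "hyp2F1 (\<alpha>' w) (\<beta>' w) (of_nat r * w) X =
     (1 - X) * poly (truncF A B c s t r) X * hyp2F1 A B c X +
     wconst A B c * X * poly (truncG A B c s t r) X * hyp2F1 A B (c + 1) X"
    using hyp2F1_contiguity_eval[OF ints st(2) st'(2) n(3) normx] unfolding e .
  also have "rGamma (of_nat r * w) * \<dots> =
     (1 - X) * (pochhammer (of_nat r * w) r * poly (truncF A B c s t r) X) * (rGamma c * hyp2F1 A B c X) +
     X * (pochhammer (of_nat r * w) r * wconst A B c * c) * poly (truncG A B c s t r) X * (rGamma (c + 1) * hyp2F1 A B (c + 1) X)"
    unfolding G1 ring_distribs using G2 by (simp add: mult_ac)
  \<comment> \<open>The denominators of \<open>wconst\<close> disappear: \<open>c - 1\<close> is the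
    last factor of the Pochhammer symbol, and \<open>c\<close> comes from replacing
    \<open>rGamma c\<close> by \<open>rGamma (c + 1)\<close>.\<close>
  also have "pochhammer (of_nat r * w) r * wconst A B c * c = pochhammer (of_nat r * w) (r - 1) * poly c1 w"
    unfolding pr poly_c1 wconst_def A_def[symmetric] B_def[symmetric] c_def[symmetric] using c0 by simp
  finally show "K w = (1 - X) * poly P w * K (w + 1) + X * poly (c1 * PG) w * KG (w + 1)"
    unfolding pt(1,2) K1[symmetric] KG1[symmetric] poly_mult by (simp add: mult_ac)
qed

lemma K_of_nat:
  assumes "0 < r * real N" 
  shows "K (of_nat N) = of_real (rGamma (r * real N) * rhyp x (s * real N - a) (t * real N - b) (r * real N))"
    and "KG (of_nat N) = of_real (rGamma (r * real N + 1) * rhyp x (s * real N - a) (t * real N - b) (r * real N + 1))"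
  using hreg_of_real_pos[OF x, of "r * real N" "s * real N - a" "t * real N - b"]
    hreg_of_real_pos[OF x, of "r * real N + 1" "s * real N - a" "t * real N - b"] assms
  by (simp_all add: K_def KG_def \<alpha>'_def \<beta>'_def)

definition \<sigma> :: real where "\<sigma> = - (char_root (- 1) p q r x + r)"

text \<open>After Euler's transformation the parameters grow like \<open>s\<close>,
  \<open>t\<close>, \<open>r\<close> on the right as well, so the root that governs the poles of
  \<open>f\<close> governs this end too.\<close>

lemma large_params_dual:
  "large_params x s t r \<sigma> real (\<lambda>N. s * real N + (s - a)) (\<lambda>N. t * real N + (t - b)) (\<lambda>N. r * real N + r)"
proof -
  interpret L: large_params x s t r \<sigma> "\<lambda>l. real l / real r" A0 B0 "\<lambda>l. real l + 2"
    unfolding \<sigma>_def by (rule large_params_left)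
  show ?thesis
  proof unfold_locales
    show "filterlim real at_top sequentially" by (rule filterlim_real_sequentially)
    show "(\<lambda>k. (real s * real k + (real s - a)) / real k) \<longlonglongrightarrow> real s" using linear_div_tendsto[of 1 s "s - a"] by simp
    show "(\<lambda>k. (real t * real k + (real t - b)) / real k) \<longlonglongrightarrow> real t" using linear_div_tendsto[of 1 t "t - b"] by simp
    show "(\<lambda>k. (real r * real k + real r) / real k) \<longlonglongrightarrow> real r" using linear_div_tendsto[of 1 r r] by simp
  qed (use L.x L.pqr L.\<rho> L.root in auto)
qed

lemma K_over_KG_limit:
  "(\<lambda>N. K (of_nat N + 1) / (of_nat N * KG (of_nat N + 1))) \<longlonglongrightarrow> of_real (r + \<sigma>)"
  and K_right_ne_0: "\<forall>\<^sub>F N in sequentially. K (of_nat N + 1) \<noteq> 0 \<and> KG (of_nat N + 1) \<noteq> 0"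
proof -
  interpret L: large_params x s t r \<sigma> real "\<lambda>N. s * real N + (s - a)" "\<lambda>N. t * real N + (t - b)" "\<lambda>N. r * real N + r"
    by (rule large_params_dual)
  have rN: "r * real (Suc N) = r * real N + r" "s * real (Suc N) - a = s * real N + (s - a)"
    "t * real (Suc N) - b = t * real N + (t - b)" "complex_of_nat (Suc N) = of_nat N + 1" for N
    by (simp_all add: algebra_simps)
  have pos: "0 < r * real (Suc N)" for N using r0 by simp
  have Kv: "K (of_nat N + 1) = of_real (rGamma (r * real N + r) * L.S N)"
    "KG (of_nat N + 1) = of_real (rGamma (r * real N + r + 1) * rhyp x (s * real N + (s - a)) (t * real N + (t - b)) (r * real N + r + 1))" for N
    using K_of_nat[OF pos, of N] unfolding rN by simp_all
  have cpos: "r * real N + r > 0" for N using r0 by (simp add: add_nonneg_pos)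
  have G: "rGamma (r * real N + r) = (r * real N + r) * rGamma (r * real N + r + 1)" "rGamma (r * real N + r + 1) > 0" for N
    using rGamma_plus1[of "r * real N + r"] cpos[of N] by (simp_all add: rGamma_inverse_Gamma)
  interpret L': large_params x s t r \<sigma> real "\<lambda>N. s * real N + (s - a)" "\<lambda>N. t * real N + (t - b)" "\<lambda>N. r * real N + r + 1"
    using L.shift[of 0 0 1] by simp
  show "\<forall>\<^sub>F N in sequentially. K (of_nat N + 1) \<noteq> 0 \<and> KG (of_nat N + 1) \<noteq> 0"
    using L.ev_S_pos L'.ev_S_pos
  proof eventually_elim
    case (elim N)
    then show ?case unfolding Kv of_real_eq_0_iff G(1) using cpos[of N] G(2)[of N] by simp
  qed
  have "(\<lambda>N. ((r * real N + r) / real N) * inverse (L'.S N / L.S N)) \<longlonglongrightarrow> r * inverse (r / (r + \<sigma>))"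
    using L.ratio_den L.\<rho> r0 by (intro tendsto_mult tendsto_inverse L.C) auto
  also have "r * inverse (r / (r + \<sigma>)) = r + \<sigma>" using r0 by simp
  finally have lim: "(\<lambda>N. complex_of_real (((r * real N + r) / real N) * inverse (L'.S N / L.S N))) \<longlonglongrightarrow> of_real (r + \<sigma>)"
    by (rule tendsto_of_real)
  have ev: "\<forall>\<^sub>F N in sequentially. complex_of_real (((r * real N + r) / real N) * inverse (L'.S N / L.S N)) =
     K (of_nat N + 1) / (of_nat N * KG (of_nat N + 1))"
    using L.ev_S_pos L'.ev_S_pos eventually_gt_at_top[of 0]
  proof eventually_elim
    case (elim N)
    have "rGamma (r * real N + r) * L.S N / (real N * (rGamma (r * real N + r + 1) * L'.S N)) =
       ((r * real N + r) / real N) * inverse (L'.S N / L.S N)"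
      unfolding G(1) using G(2)[of N] elim by (simp add: field_simps)
    then have "complex_of_real (((r * real N + r) / real N) * inverse (L'.S N / L.S N)) =
       of_real (rGamma (r * real N + r) * L.S N) / (of_real (real N) * of_real (rGamma (r * real N + r + 1) * L'.S N))"
      by (simp only: of_real_divide[symmetric] of_real_mult[symmetric])
    then show ?case unfolding Kv by simp
  qed
  show "(\<lambda>N. K (of_nat N + 1) / (of_nat N * KG (of_nat N + 1))) \<longlonglongrightarrow> of_real (r + \<sigma>)"
    using lim ev by (rule Lim_transform_eventually)
qed

text \<open>Both values are \<open>rpole\<close> with the same upper parameters, at consecutive
  indices. The long Pochhammer symbols may have any sign, but their quotient is
  \<open>(A + l) * (B + l)\<close>, and both factors are positive for large
  \<open>l\<close>.\<close>

lemma KG_pole_pos: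
  "\<forall>\<^sub>F l in sequentially. K (wpole l + 1) \<noteq> 0 \<longrightarrow>
     (\<exists>Q>0. K (wpole l + 1) = of_real Q * KG (wpole l + 1) \<and> KG (wpole l + 1) \<noteq> 0)"
proof -
  have "\<forall>\<^sub>F l in sequentially. p * (real l / r) - a > 0" "\<forall>\<^sub>F l in sequentially. q * (real l / r) - b > 0"
    using r0 p0 pq by real_asymp+
  then show ?thesis using eventually_gt_at_top[of 0]
  proof eventually_elim
    case (elim l)
    define A where "A = - s * (real l / r) - a"
    define B where "B = - t * (real l / r) - b"
    have rl: "real r * (real l / real r) = real l" using r0 by simp
    have A: "A + l > 0" and B: "B + l > 0"
    proof -
      define u where "u = real l / r"
      have "u * real s + u * real p = u * real r" "u * real t + u * real q = u * real r"
        unfolding ring_distribs[symmetric] using st(5,6) by simp_all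
      then have "A + l = (p * u - a) + (l - r * u)" "B + l = (q * u - b) + (l - r * u)"
        unfolding A_def B_def u_def[symmetric] by (simp_all add: algebra_simps)
      then have "A + l = (p * (real l / r) - a) + (l - r * (real l / r))"
        "B + l = (q * (real l / r) - b) + (l - r * (real l / r))"
        unfolding u_def by simp_all
      then show "A + l > 0" "B + l > 0" using elim unfolding rl by simp_all
    qed
    have w1: "wpole l + 1 = of_real (- (real l / r))" using r0 by (simp add: wpole_def field_simps)
    have e: "\<alpha>' (wpole l + 1) = of_real A" "\<beta>' (wpole l + 1) = of_real B"
      "of_nat r * (wpole l + 1) = - of_nat l" "of_nat r * (wpole l + 1) + 1 = - of_nat (l - 1)"
      unfolding w1 using r0 elim by (simp_all add: \<alpha>'_def \<beta>'_def A_def B_def of_nat_diff)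
    have "K (wpole l + 1) = of_real (rpole x A B l)"
      unfolding K_def e(1-3) by (rule hreg_of_real_nonpos_int[OF x])
    moreover have "KG (wpole l + 1) = of_real (rpole x A B (l - 1))"
      unfolding KG_def e(1,2,4) by (rule hreg_of_real_nonpos_int[OF x])
    ultimately have K: "K (wpole l + 1) = of_real (rpole x A B l)" "KG (wpole l + 1) = of_real (rpole x A B (l - 1))" .
    obtain m where m: "l = Suc m" using elim by (cases l) auto
    define Q where "Q = (A + l) * (B + l) * x / (l + 1) * (rhyp x (A + Suc l) (B + Suc l) (real (l + 2)) / rhyp x (A + l) (B + l) (real (l + 1)))"
    have h1: "rhyp x (A + Suc l) (B + Suc l) (real (l + 2)) > 0" using A B x by (intro rhyp_pos) auto
    have h2: "rhyp x (A + l) (B + l) (real (l + 1)) > 0" using A B x by (intro rhyp_pos) auto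
    have Q: "Q > 0" unfolding Q_def using A B x h1 h2 by (intro mult_pos_pos divide_pos_pos) auto
    have "rpole x A B l = Q * rpole x A B (l - 1)"
    proof -
      have pa: "pochhammer z (Suc l) = pochhammer z l * (z + l)" for z :: real by (rule pochhammer_Suc)
      have ff: "fact (Suc l) = (real l + 1) * fact l" by simp
      have "rpole x A B (l - 1) = pochhammer A l * pochhammer B l * x ^ l / fact l * rhyp x (A + l) (B + l) (real (l + 1))"
        unfolding rpole_def by (simp add: m del: pochhammer_Suc fact_Suc of_nat_Suc)
      then show ?thesis
        unfolding rpole_def pa ff Q_def using h2 by (simp add: divide_simps add_ac del: fact_Suc of_nat_Suc) (simp add: mult_ac)
    qed
    then show ?case using Q by (intro impI exI[of _ Q]) (auto simp: K)
  qed
qed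

lemma nn_ne_0: "nn \<noteq> 0"
proof
  assume "nn = 0"
  then have "(\<lambda>N. 0 :: complex) \<longlonglongrightarrow> of_real (limit_of (char_root 1 p q r x))"
    using limit_right by simp
  then have "limit_of (char_root 1 p q r x) = 0" by (simp add: LIMSEQ_const_iff)
  moreover have "limit_of (char_root 1 p q r x) > 0"
    using char_root_pos[of p q r x] p0 pq x r0 unfolding limit_of_def growth_def
    by (intro mult_pos_pos divide_pos_pos zero_less_power add_pos_nonneg) auto
  ultimately show False by simp
qed

definition rp :: "complex poly" where "rp = pochhammer [:0, of_nat r:] r"

lemma poly_rp: "poly rp w = pochhammer (of_nat r * w) r"
  by (simp add: rp_def poly_pochhammer mult.commute)

lemma rp: "degree rp = r" "rp \<noteq> 0"
  unfolding rp_def using degree_pochhammer_linear[OF r0(2)] by auto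

lemma K_of_nat_ne_0: "\<forall>\<^sub>F N in sequentially. K (of_nat N) \<noteq> 0"
proof -
  have "\<forall>\<^sub>F N in sequentially. K (of_nat N + 1) \<noteq> 0"
    using K_right_ne_0 by eventually_elim simp
  then have "\<forall>\<^sub>F N in sequentially. K (of_nat (Suc N)) \<noteq> 0" by (simp add: add.commute)
  then show ?thesis by (rule eventually_sequentially_Suc[THEN iffD1])
qed

text \<open>
  Otherwise \<open>K(w + 1) / KG(w + 1)\<close> would be a rational function, asymptotic to \<open>(r + \<sigma>) w\<close> by
  its behaviour on the right, but positive at infinitely many \<open>wpole l\<close> on the left.
\<close>

lemma PG_eq_0: "PG = 0"
proof (rule ccontr)
  assume PG: "PG \<noteq> 0"
  define V where "V = smult X (c1 * PG)"
  \<comment> \<open>Eliminating \<open>K w\<close> between \<open>K_relation\<close> and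
    \<open>K_contiguity\<close> leaves a linear relation between \<open>K (w + 1)\<close> and
    \<open>KG (w + 1)\<close> with these polynomial coefficients.\<close>
  define N1 where "N1 = smult ((1 - X) ^ n) (dd * rp) - smult (1 - X) (nn * P)"
  define N2 where "N2 = nn * V"
  have "c1 \<noteq> 0" using p0 pq by (simp add: c1_def)
  then have "V \<noteq> 0" using PG one_minus_X by (simp add: V_def)
  then have N2: "N2 \<noteq> 0" using nn_ne_0 by (simp add: N2_def)
  have rel: "poly N1 w * K (w + 1) = poly N2 w * KG (w + 1)" if "K w \<noteq> 0" for w
  proof -
    have "poly nn w * K w = poly dd w * poly rp w * (1 - X) ^ n * K (w + 1)"
      using K_relation[OF that] by (simp add: poly_rp)
    moreover have "poly nn w * K w = poly nn w * ((1 - X) * poly P w * K (w + 1)) + poly nn w * poly V w * KG (w + 1)"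
      unfolding K_contiguity[of w] by (simp add: V_def algebra_simps)
    ultimately show ?thesis by (simp add: N1_def N2_def algebra_simps)
  qed
  note N2ev = ev_poly_ne_0[OF N2 filterlim_of_nat_at_infinity]
  have N1: "N1 \<noteq> 0"
  proof
    assume "N1 = 0"
    have "\<forall>\<^sub>F N in sequentially. False"
      using N2ev K_of_nat_ne_0 K_right_ne_0
    proof eventually_elim
      case (elim N)
      then show ?case using rel[of "of_nat N"] \<open>N1 = 0\<close> by simp
    qed
    then show False by simp
  qed
  \<comment> \<open>The quotient \<open>N2 / N1\<close> grows linearly; dividing it by
    \<open>w\<close> as well gives a finite limit.\<close>
  define D where "D = [:0, 1:] * N1"
  have D: "D \<noteq> 0" using N1 by (simp add: D_def)
  have "\<forall>\<^sub>F N in sequentially. K (of_nat N + 1) / (of_nat N * KG (of_nat N + 1)) = poly N2 (of_nat N) / poly D (of_nat N)"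
    using ev_poly_ne_0[OF N1 filterlim_of_nat_at_infinity] K_of_nat_ne_0 K_right_ne_0 eventually_gt_at_top[of 0]
  proof eventually_elim
    case (elim N)
    then show ?case using rel[of "of_nat N"] by (simp add: D_def field_simps)
  qed
  with K_over_KG_limit have "(\<lambda>N. poly N2 (of_nat N) / poly D (of_nat N)) \<longlonglongrightarrow> of_real (r + \<sigma>)"
    by (rule Lim_transform_eventually)
  from poly_ratio_tendsto_at_infinity(1)[OF D filterlim_of_nat_at_infinity this]
  have "((\<lambda>w. poly N2 w / poly D w) \<longlongrightarrow> of_real (r + \<sigma>)) at_infinity" .
  from filterlim_compose[OF this filterlim_wpole_\<phi>]
  have "(\<lambda>k. poly N2 (wpole (\<phi> k)) / poly D (wpole (\<phi> k))) \<longlonglongrightarrow> of_real (r + \<sigma>)" .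
  then have "(\<lambda>k. Re (poly N2 (wpole (\<phi> k)) / poly D (wpole (\<phi> k)))) \<longlonglongrightarrow> r + \<sigma>"
    using tendsto_Re by fastforce
  moreover have "r + \<sigma> > 0"
  proof -
    interpret L: large_params x s t r \<sigma> real "\<lambda>N. s * real N + (s - a)" "\<lambda>N. t * real N + (t - b)" "\<lambda>N. r * real N + r"
      by (rule large_params_dual)
    show ?thesis using L.\<rho> by simp
  qed
  ultimately have "\<forall>\<^sub>F k in sequentially. Re (poly N2 (wpole (\<phi> k)) / poly D (wpole (\<phi> k))) > 0"
    by (rule order_tendstoD)
  moreover have "\<forall>\<^sub>F k in sequentially. Re (poly N2 (wpole (\<phi> k)) / poly D (wpole (\<phi> k))) < 0"
    using ev_poly_ne_0[OF N1 filterlim_wpole_\<phi>] ev_poly_ne_0[OF nn_ne_0 filterlim_wpole_\<phi>]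
      eventually_compose_filterlim[OF KG_pole_pos filterlim_\<phi>]
  proof eventually_elim
    case (elim k)
    define w where "w = wpole (\<phi> k)"
    define W where "W = real (\<phi> k + r) / real r"
    have w: "w = - of_real W" "W > 0" using r0 by (simp_all add: w_def W_def wpole_def)
    have K: "K w \<noteq> 0" using \<phi>(2)[of k] by (simp add: w_def H_eq_K)
    then have "K (w + 1) \<noteq> 0" using K_relation[OF K] elim by (auto simp: w_def)
    then obtain Q where Q: "Q > 0" "K (w + 1) = of_real Q * KG (w + 1)" "KG (w + 1) \<noteq> 0"
      using elim by (auto simp: w_def)
    have "poly N1 w * of_real Q = poly N2 w" using rel[OF K] Q by simp
    then have "poly N2 w / poly D w = (poly N1 w * of_real Q) / (poly N1 w * w)"
      by (simp add: D_def mult.commute)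
    also have "\<dots> = of_real Q / w" using elim by (simp add: w_def[symmetric])
    also have "\<dots> = of_real (- (Q / W))" using w by simp
    finally show ?case using Q w by (simp add: w_def)
  qed
  ultimately have "\<forall>\<^sub>F k in sequentially. False" by eventually_elim simp
  then show False by simp
qed

section \<open>Formula for \<open>R\<close>, degree and divisors of \<open>P\<close>\<close>

text \<open>With \<open>PG = 0\<close> the contiguity relation and \<open>K_relation\<close> both
  express \<open>K w\<close> through \<open>K (w + 1)\<close>. Comparing them at all large integers
  gives a polynomial identity.\<close>

lemma nn_P: "nn * P = smult ((1 - X) ^ (n - 1)) (dd * rp)"
proof -
  define f where "f = smult (1 - X) (nn * P) - smult ((1 - X) ^ n) (dd * rp)"
  have "f = 0"
  proof (rule ccontr)
    assume "f \<noteq> 0"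
    have "\<forall>\<^sub>F N in sequentially. poly f (of_nat N) = 0"
      using K_of_nat_ne_0 K_right_ne_0
    proof eventually_elim
      case (elim N)
      have e: "K (of_nat N) = (1 - X) * poly P (of_nat N) * K (of_nat N + 1)"
        using K_contiguity[of "of_nat N"] by (simp add: PG_eq_0)
      have "K (of_nat N + 1) * poly f (of_nat N) = poly nn (of_nat N) * ((1 - X) * poly P (of_nat N) * K (of_nat N + 1)) -
          poly dd (of_nat N) * poly rp (of_nat N) * (1 - X) ^ n * K (of_nat N + 1)"
        by (simp add: f_def algebra_simps)
      also have "\<dots> = 0"
        using K_relation[of "of_nat N"] elim unfolding e[symmetric] poly_rp by simp
      finally have "K (of_nat N + 1) * poly f (of_nat N) = 0" .
      with elim show ?case by simp
    qed
    with ev_poly_ne_0[OF \<open>f \<noteq> 0\<close> filterlim_of_nat_at_infinity]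
    have "\<forall>\<^sub>F N::nat in sequentially. False" by eventually_elim simp
    then show False by simp
  qed
  then have "smult (1 - X) (nn * P) = smult (1 - X) (smult ((1 - X) ^ (n - 1)) (dd * rp))"
    using n(1) by (cases n) (simp_all add: f_def)
  then have "smult (1 - X) (nn * P - smult ((1 - X) ^ (n - 1)) (dd * rp)) = 0"
    by (simp only: smult_diff_right diff_self)
  then show ?thesis using one_minus_X by simp
qed

text \<open>The finite nonzero limit of \<open>R\<close> at infinity forces \<open>nn\<close> and
  \<open>dd\<close> to have equal degrees, so by \<open>nn_P\<close> the degree of \<open>P\<close>
  is that of \<open>rp\<close>.\<close>

lemma degree_P: "degree P = r"
proof -
  define L where "L = complex_of_real (limit_of (char_root 1 p q r x))"
  have "limit_of (char_root 1 p q r x) \<noteq> 0"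
    using char_root_pos[of p q r x] p0 pq x r0 by (auto simp: limit_of_def growth_def)
  then have L: "L \<noteq> 0" by (simp add: L_def)
  have "nn - smult L dd = 0 \<or> degree (nn - smult L dd) < degree dd"
    unfolding L_def by (rule poly_ratio_tendsto_at_infinity(2)[OF dd filterlim_of_nat_at_infinity limit_right])
  then have "degree nn = degree dd"
  proof
    assume "degree (nn - smult L dd) < degree dd"
    then have "degree ((nn - smult L dd) + smult L dd) = degree (smult L dd)"
      using L by (intro degree_add_eq_right) simp
    then show ?thesis using L by simp
  qed (use L in auto)
  moreover have rhs: "smult ((1 - X) ^ (n - 1)) (dd * rp) \<noteq> 0"
    using dd rp one_minus_X by simp
  then have "nn \<noteq> 0" "P \<noteq> 0" unfolding nn_P[symmetric] by auto
  then have "degree nn + degree P = degree (smult ((1 - X) ^ (n - 1)) (dd * rp))"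
    unfolding nn_P[symmetric] by (simp add: degree_mult_eq)
  moreover have "\<dots> = degree dd + r"
    using one_minus_X dd rp by (simp add: degree_mult_eq)
  ultimately show ?thesis by simp
qed

lemma hyp_R_eq:
  "\<forall>\<^sub>\<approx>w\<in>UNIV. hyp_R (of_nat p) (of_nat q) (of_nat r) (of_real a) (of_real b) (of_real x) w =
     (1 - of_real x) ^ (r - p - q - 1) * pochhammer (of_nat r * w) r / poly P w"
proof -
  have P0: "P \<noteq> 0" using degree_P r0 by auto
  then have "finite {w. poly (dd * P) w = 0}" using dd by (intro poly_roots_finite) simp
  then have "\<forall>\<^sub>\<approx>w\<in>UNIV. poly (dd * P) w \<noteq> 0"
    by (auto simp: eventually_cosparse intro: finite_imp_sparse)
  with R show ?thesis
  proof eventually_elim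
    case (elim w)
    have "poly (nn * P) w = poly (smult ((1 - X) ^ (n - 1)) (dd * rp)) w" by (simp only: nn_P)
    then have "poly nn w * poly P w = (1 - X) ^ (r - p - q - 1) * poly dd w * pochhammer (of_nat r * w) r"
      by (simp add: poly_rp n_def)
    moreover have "poly dd w \<noteq> 0" "poly P w \<noteq> 0" using elim by auto
    ultimately show ?case unfolding elim(1) by (simp add: frac_eq_eq mult_ac)
  qed
qed

definition divisor_bound :: "complex poly" where
  "divisor_bound = pochhammer [:of_real a + 1, of_nat p:] (p - 1) * pochhammer [:of_real b + 1, of_nat q:] (q - 1) *
     pochhammer [:- of_real a, of_nat (r - p):] (r - p) * pochhammer [:- of_real b, of_nat (r - q):] (r - q)"

text \<open>Since \<open>PG = 0\<close>, the contiguity matrix at \<open>x\<close> is triangular and its determinant is \<open>P PD\<close> up to known factors.\<close>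

lemma P_dvd: "P dvd divisor_bound"
proof -
  have "smult ((1 - X) * X) (P * PD) = smult ((- 1) ^ (p + q + r) * X ^ r * (1 - X) ^ n) divisor_bound"
  proof (rule poly_eqI_off_reals)
    fix w :: complex assume w: "Im w \<noteq> 0"
    define A where "A = \<alpha>' (w + 1)"
    define B where "B = \<beta>' (w + 1)"
    define c where "c = of_nat r * (w + 1)"
    note pt = poly_trunc[OF w, folded A_def B_def c_def]
    note ints = parameters_not_Ints[OF w, folded A_def B_def c_def]
    have rw: "of_nat r * w \<notin> \<int>" "of_nat r * w + 1 \<notin> \<int>" using w r0 by (auto intro!: not_Ints_Im)
    have c0: "c \<noteq> 0" "c - 1 \<noteq> 0" using ints by (auto simp: eq_iff_diff_eq_0[symmetric])
    have d0: "c - A \<noteq> 0" "c - B \<noteq> 0" using ints by (auto simp: eq_iff_diff_eq_0[symmetric])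
    have p1: "pochhammer (of_nat r * w) r \<noteq> 0" "pochhammer (of_nat r * w) (r - 1) \<noteq> 0" "pochhammer (of_nat r * w + 1) (r - 2) \<noteq> 0"
      using pochhammer_ne_0 rw by auto
    have U0: "poly (truncG A B c s t r) X = 0" using pt(2) p1 by (simp add: PG_eq_0)
    have "poly (([:1, -1:] * truncF A B c s t r) * ([:0, wconst A B c:] * truncG A B c s t (r - 1)) -
         ([:0, wconst A B c:] * truncG A B c s t r) * ([:1, -1:] * truncF A B c s t (r - 1))) X =
         poly (smult (contig_det_const A B c s t r) ([:0, 1:] ^ r * [:1, -1:] ^ (s + t - r))) X"
      by (subst hyp2F1_contiguity_det[OF ints st(2,3) n(3)]) simp
    then have det: "((1 - X) * poly (truncF A B c s t r) X) * (wconst A B c * X * poly (truncG A B c s t (r - 1)) X) =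
        contig_det_const A B c s t r * (X ^ r * (1 - X) ^ n)"
      by (simp add: U0 n(2) algebra_simps)
    have e: "A - of_nat s = of_nat s * w - of_real a" "B - of_nat t = of_nat t * w - of_real b"
      "c - of_nat r + 1 = of_nat r * w + 1" "r - s = p" "r - t = q"
      using pq by (simp_all add: A_def B_def c_def \<alpha>'_def \<beta>'_def s_def t_def algebra_simps)
    have e2: "A - c = - (of_nat p * (w + 1) + of_real a)" "B - c = - (of_nat q * (w + 1) + of_real b)"
      using pq by (simp_all add: A_def B_def c_def \<alpha>'_def \<beta>'_def s_def t_def of_nat_diff algebra_simps)
    \<comment> \<open>The last factor is split off because it is \<open>c - A\<close> or
      \<open>c - B\<close> and cancels against \<open>wconst\<close>; this leaves the lengths
      \<open>p - 1\<close> and \<open>q - 1\<close>.\<close>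
    have neg: "pochhammer (- (of_nat m * (w + 1) + z)) m = (- 1) ^ m * (pochhammer (of_nat m * w + z + 1) (m - 1) * (of_nat m * (w + 1) + z))"
      if m: "m > 0" for m z
    proof -
      have "pochhammer (- (of_nat m * (w + 1) + z)) m = (- 1) ^ m * pochhammer (of_nat m * (w + 1) + z - of_nat m + 1) m"
        by (rule pochhammer_minus)
      also have "of_nat m * (w + 1) + z - of_nat m + 1 = of_nat m * w + z + 1" by (simp add: algebra_simps)
      also have "pochhammer (of_nat m * w + z + 1) m = pochhammer (of_nat m * w + z + 1) (m - 1) * (of_nat m * (w + 1) + z)"
      proof -
        have "pochhammer (of_nat m * w + z + 1) (Suc (m - 1)) =
           pochhammer (of_nat m * w + z + 1) (m - 1) * (of_nat m * w + z + 1 + of_nat (m - 1))"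
          by (rule pochhammer_Suc)
        then show ?thesis using m by (simp add: of_nat_diff algebra_simps)
      qed
      finally show ?thesis .
    qed
    \<comment> \<open>The two factors split off are the denominators of \<open>wconst\<close>, and
      the remaining symbol is the prefactor of \<open>PD\<close>.\<close>
    have den: "pochhammer (of_nat r * w + 1) r = pochhammer (of_nat r * w + 1) (r - 2) * (c - 1) * c"
    proof -
      have "pochhammer (of_nat r * w + 1) (Suc (Suc (r - 2))) = pochhammer (of_nat r * w + 1) (r - 2) *
          (of_nat r * w + 1 + of_nat (r - 2)) * (of_nat r * w + 1 + of_nat (Suc (r - 2)))"
        by (simp add: pochhammer_Suc del: of_nat_Suc)
      also have "of_nat r * w + 1 + of_nat (r - 2) = c - 1" using st' by (simp add: c_def of_nat_diff algebra_simps)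
      also have "of_nat r * w + 1 + of_nat (Suc (r - 2)) = c" using st' by (simp add: c_def of_nat_diff algebra_simps)
      finally show ?thesis unfolding st'(4) .
    qed
    have den2: "pochhammer (1 - c) r = (- 1) ^ r * pochhammer (of_nat r * w) r"
      unfolding pochhammer_one_minus by (simp add: c_def algebra_simps)
    have cA: "c - A = of_nat p * (w + 1) + of_real a" "c - B = of_nat q * (w + 1) + of_real b"
      using e2 by (simp_all add: algebra_simps)
    have q0: "q > 0" by (rule pq)
    define Pa where "Pa = pochhammer (of_nat p * w + of_real a + 1) (p - 1)"
    define Pb where "Pb = pochhammer (of_nat q * w + of_real b + 1) (q - 1)"
    define Ps where "Ps = pochhammer (of_nat s * w - of_real a) s"
    define Pt where "Pt = pochhammer (of_nat t * w - of_real b) t"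
    define R0 where "R0 = pochhammer (of_nat r * w) r"
    define R2 where "R2 = pochhammer (of_nat r * w + 1) (r - 2)"
    have dc: "contig_det_const A B c s t r = Ps * Pt * ((- 1) ^ p * (Pa * (c - A))) * ((- 1) ^ q * (Pb * (c - B))) /
       ((R2 * (c - 1) * c) * ((- 1) ^ r * R0))"
      unfolding contig_det_const_def e e2 neg[OF p0] neg[OF q0] den den2 cA Ps_def Pt_def Pa_def Pb_def R0_def R2_def ..
    have R: "R0 \<noteq> 0" "R2 \<noteq> 0" using p1 by (simp_all add: R0_def R2_def)
    have TP: "poly (truncF A B c s t r) X = poly P w / R0" "poly (truncG A B c s t (r - 1)) X = poly PD w / R2"
      using pt(1,3) R by (simp_all add: R0_def[symmetric] R2_def[symmetric])
    have sgn: "inverse ((- 1) ^ r) = ((- 1) ^ r :: complex)" by (simp flip: power_inverse)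
    have "(1 - X) * X * (poly P w * poly PD w) = (- 1) ^ (p + q + r) * X ^ r * (1 - X) ^ n * (Pa * Pb * Ps * Pt)"
    proof -
      have "(1 - X) * X * (poly P w * poly PD w) * ((c - A) * (c - B) / (R0 * R2 * c * (c - 1))) =
        ((1 - X) * poly (truncF A B c s t r) X) * (wconst A B c * X * poly (truncG A B c s t (r - 1)) X)"
        unfolding TP wconst_def by (simp add: mult_ac)
      also have "\<dots> = (- 1) ^ p * (- 1) ^ q * inverse ((- 1) ^ r) * X ^ r * (1 - X) ^ n * (Pa * Pb * Ps * Pt) *
          ((c - A) * (c - B) / (R0 * R2 * c * (c - 1)))"
        unfolding det dc by (simp add: divide_inverse mult_ac)
      finally have "(1 - X) * X * (poly P w * poly PD w) = (- 1) ^ p * (- 1) ^ q * inverse ((- 1) ^ r) * X ^ r * (1 - X) ^ n * (Pa * Pb * Ps * Pt)"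
        using R c0 d0 by simp
      then show ?thesis unfolding sgn power_add .
    qed
    moreover have "poly divisor_bound w = Pa * Pb * Ps * Pt"
      unfolding divisor_bound_def poly_mult poly_pochhammer Pa_def Pb_def Ps_def Pt_def
      by (simp add: s_def t_def algebra_simps)
    ultimately show "poly (smult ((1 - X) * X) (P * PD)) w = poly (smult ((- 1) ^ (p + q + r) * X ^ r * (1 - X) ^ n) divisor_bound) w"
      by simp
  qed
  then have "P dvd smult ((- 1) ^ (p + q + r) * X ^ r * (1 - X) ^ n) divisor_bound"
    by (metis dvd_smult dvd_triv_left)
  then show ?thesis using one_minus_X by (simp add: dvd_smult_iff)
qed

end

theorem theorem2p10:
  fixes p q r a b x :: real
  assumes "0 < q" and "q \<le> p" and "p + q \<le> r" and "0 < x" and "x < 1"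
    and "closed_form_solution (of_real p) (of_real q) (of_real r) (of_real a) (of_real b) (of_real x)"
    and "\<not> elementary (of_real p) (of_real q) (of_real r) (of_real a) (of_real b) (of_real x)"
    and "type_A (of_real p) (of_real q) (of_real r) (of_real a) (of_real b) (of_real x)"
  shows "\<exists>p' q' r' :: nat. p = real p' \<and> q = real q' \<and> r = real r' \<and>
     \<comment> \<open>(1)\<close>
     (\<exists>X Y :: int poly. is_XY p' q' r' X Y \<and> Y \<noteq> 0 \<and> poly (map_poly of_int Y) x = 0) \<and>
     algebraic x \<and>
     (p' \<noteq> q' \<longrightarrow> algebraic_degree x \<le> r' - 1) \<and>
     (p' = q' \<longrightarrow> algebraic_degree x \<le> r' - p' - 1) \<and>
     \<comment> \<open>(2)\<close>
     p' + q' < r' \<and> even (r' - p' - q') \<and>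
     \<comment> \<open>(3)\<close>
     (\<exists>P :: complex poly.
        (\<forall>w. pochhammer (of_nat r' * w) r' \<noteq> 0 \<longrightarrow>
             poly P w = hyp_P_val p' q' r' (of_real a) (of_real b) (of_real x) w) \<and>
        degree P = r' \<and>
        (\<forall>\<^sub>\<approx>w\<in>UNIV.
           hyp_R (of_real p) (of_real q) (of_real r) (of_real a) (of_real b) (of_real x) w =
             (1 - of_real x) ^ (r' - p' - q' - 1) * pochhammer (of_nat r' * w) r' / poly P w) \<and>
        P dvd
          pochhammer [:of_real a + 1, of_nat p':] (p' - 1) *
          pochhammer [:of_real b + 1, of_nat q':] (q' - 1) *
          pochhammer [:- of_real a, of_nat (r' - p'):] (r' - p') *
          pochhammer [:- of_real b, of_nat (r' - q'):] (r' - q'))"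
proof -
  obtain pi qi ri :: int where i: "complex_of_real p = of_int pi" "complex_of_real q = of_int qi"
      "complex_of_real r = of_int ri" "even (pi + qi + ri)"
    using assms(8) unfolding type_A_def by blast
  have i': "p = of_int pi" "q = of_int qi" "r = of_int ri"
    using i by (metis of_real_eq_iff of_real_of_int_eq)+
  define p' where "p' = nat pi"
  define q' where "q' = nat qi"
  define r' where "r' = nat ri"
  have ge: "0 < qi" "qi \<le> pi" "pi + qi \<le> ri" "0 \<le> pi" "0 \<le> ri"
    using assms(1-3) unfolding i' by linarith+
  then have nat: "p = real p'" "q = real q'" "r = real r'"
    unfolding i' p'_def q'_def r'_def by simp_all
  have pq: "0 < q'" "q' \<le> p'" "p' + q' \<le> r'"
    using ge by (simp_all add: p'_def q'_def r'_def flip: nat_add_distrib)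
  have even: "even (p' + q' + r')"
  proof -
    have "int (p' + q' + r') = pi + qi + ri" using ge by (simp add: p'_def q'_def r'_def)
    then show ?thesis using i(4) by (metis even_of_nat)
  qed
  obtain nn dd where R: "dd \<noteq> 0"
    "\<forall>\<^sub>\<approx>w\<in>UNIV. hyp_R (of_nat p') (of_nat q') (of_nat r') (of_real a) (of_real b) (of_real x) w = poly nn w / poly dd w"
    using assms(6) unfolding closed_form_solution_def rational_fun_over_def nat by auto
  interpret closed_form p' q' r' a b x nn dd
    by unfold_locales (use pq assms(4,5,7) R in \<open>auto simp: elementary_def nat\<close>)
  obtain X Y where XY: "is_XY p' q' r' X Y" "Y \<noteq> 0" "degree Y \<le> r' - 1" "p' = q' \<Longrightarrow> degree Y \<le> r' - p' - 1"
    using is_XY_exists[OF pq] by metis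
  define Yr where "Yr = (map_poly of_int Y :: real poly)"
  have Yr: "Yr \<noteq> 0" "degree Yr = degree Y" "coeff Yr k = of_int (coeff Y k)" for k
  proof -
    show c: "coeff Yr k = of_int (coeff Y k)" for k by (simp add: Yr_def coeff_map_poly)
    show "degree Yr = degree Y" unfolding Yr_def by (rule degree_map_poly) simp
    then show "Yr \<noteq> 0" using XY(2) c[of "degree Y"] by (metis coeff_0 leading_coeff_0_iff of_int_eq_0_iff)
  qed
  have root: "poly Yr x = 0"
  proof -
    have "sqrt (hyp_Delta p' q' r' x) > 0"
      using sqrt_Delta(2)[of p' q' r' x] pq assms(4,5) by simp
    moreover have "hyp_Z s p' q' r' x = poly (map_poly of_int X) x + s * poly Yr x * sqrt (hyp_Delta p' q' r' x)"
      if "s \<in> {1, - 1}" for s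
      using XY(1) assms(4,5) that unfolding is_XY_def Yr_def by auto
    \<comment> \<open>Subtracting the two representations leaves twice the term with the square
      root.\<close>
    from this[of 1] this[of "- 1"] hyp_Z_agree
    have "poly Yr x * sqrt (hyp_Delta p' q' r' x) = 0" by simp
    ultimately show ?thesis by simp
  qed
  have alg: "algebraic x"
    unfolding algebraic_altdef using Yr root by (intro exI[of _ Yr]) auto
  have deg: "algebraic_degree x \<le> degree Y"
    unfolding algebraic_degree_def using Yr root by (intro Least_le exI[of _ Yr]) auto
  have deg': "algebraic_degree x \<le> r' - 1" "p' = q' \<longrightarrow> algebraic_degree x \<le> r' - p' - 1"
    using deg XY(3,4) by (auto intro: order.trans)
  have ev: "even (r' - p' - q')"
    using even pq by presburger
  have ex: "\<exists>X Y :: int poly. is_XY p' q' r' X Y \<and> Y \<noteq> 0 \<and> poly (map_poly of_int Y) x = 0"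
    using XY(1,2) root unfolding Yr_def by blast
  have R': "\<forall>\<^sub>\<approx>w\<in>UNIV.
     hyp_R (of_real p) (of_real q) (of_real r) (of_real a) (of_real b) (of_real x) w =
       (1 - of_real x) ^ (r' - p' - q' - 1) * pochhammer (of_nat r' * w) r' / poly P w"
    using hyp_R_eq by (simp add: nat)
  show ?thesis
    by (rule exI[of _ p'], rule exI[of _ q'], rule exI[of _ r'], intro conjI exI[of _ P] allI impI)
       (fact nat ex alg deg' p_plus_q_less ev poly_P degree_P R' P_dvd[unfolded divisor_bound_def] |
        use deg' in simp)+
qed

end
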